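(* Let $\boldsymbol{\mathcal P} = \{\boldsymbol x \in \mathbb K^n : \boldsymbol A \boldsymbol x \le \boldsymbol b\}$, with $\boldsymbol A \in \mathbb K^{m\times n}$ and $\boldsymbol b \in \mathbb K^m$, be a polyhedron over Puiseux series and let $\boldsymbol c \in \mathbb K^n$. Suppose that: (i) $\boldsymbol{\mathcal P} \subset \mathbb K_{\ge 0}^n$ and $0 \in \boldsymbol{\mathcal P}$; (ii) the image $\operatorname{val}\boldsymbol{\mathcal P}\subset\mathbb T^n$ of $\boldsymbol{\mathcal P}$ under the valuation map is a regular set, i.e., it is equal to the closure of its interior; (iii) $\boldsymbol c \in (\mathbb K_{>0})^n$. Then, for all $\boldsymbol\mu \in \mathbb K_{>0}$, the limit $$\lim_{t\to+\infty} \log_t \mathcal C_{\boldsymbol{\mathcal P}(t),\boldsymbol c(t)}(\boldsymbol\mu(t))$$ (where $\log_t$ is applied entrywise) exists and is equal to the tropical barycenter of the tropical polytope $$\{x \in \operatorname{val}\boldsymbol{\mathcal P} : \langle \operatorname{val}\boldsymbol c, x\rangle_{\mathbb T} \le \operatorname{val}\boldsymbol\mu\}.$$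
   Context: Field $\mathbb K$: the field of absolutely convergent generalized real Puiseux series, i.e., series $\boldsymbol z=\sum_{\alpha\in\mathbb R} c_\alpha t^\alpha$ such that (a) the support $\{\alpha\in\mathbb R : c_\alpha\neq 0\}$ is either finite or has $-\infty$ as its unique accumulation point; (b) the coefficients $c_\alpha$ are real and the series is absolutely convergent for all sufficiently large real $t$ (written $t\gg 1$). For such $t$, $\boldsymbol z(t)\in\mathbb R$ is the value of the series; evaluation of vectors and matrices is entrywise. $\mathbb K$ is totally ordered by $\boldsymbol x\le\boldsymbol y$ iff $\boldsymbol x=\boldsymbol y$ or the coefficient of the leading term (greatest exponent) of $\boldsymbol y-\boldsymbol x$ is positive (equivalently $\boldsymbol x(t)\le\boldsymbol y(t)$ for all large $t$). $\mathbb K_{\ge0}$ and $\mathbb K_{>0}$ are the sets of nonnegative and positive elements. The valuation $\operatorname{val}\boldsymbol z$ is the greatest element of the support of $\boldsymbol z$ ($-\infty$ if $\boldsymbol z=0$); equivalently $\operatorname{val}\boldsymbol z=\lim_{t\to+\infty}\log_t|\boldsymbol z(t)|$, where $\log_t(\cdot)=\log(\cdot)/\log t$. It is extended entrywise to vectors. For a polyhedron $\boldsymbol{\mathcal P}=\{\boldsymbol x\in\mathbb K^n:\boldsymbol A\boldsymbol x\le\boldsymbol b\}$ and $t\gg1$, $\boldsymbol{\mathcal P}(t)=\{x\in\mathbb R^n:\boldsymbol A(t)x\le\boldsymbol b(t)\}$. Tropical notions: $\mathbb T=\mathbb R\cup\{-\infty\}$ with the operations $\max$ and $+$; $\mathbb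 T^n$ has its usual topology and entrywise order. $\langle x,y\rangle_{\mathbb T}=\max_i(x_i+y_i)$. A tropical polyhedron is a set of $x\in\mathbb T^n$ satisfying finitely many inequalities $\max(\alpha_0,\alpha_1+x_1,\dots,\alpha_n+x_n)\le\max(\beta_0,\beta_1+x_1,\dots,\beta_n+x_n)$ with $\alpha_i,\beta_i\in\mathbb T$; a tropical polytope is a compact tropical polyhedron. The tropical barycenter of a (nonempty) compact tropically convex set in $\mathbb T^n$, in particular of a tropical polytope, is its greatest element for the entrywise order. Entropic central path: for a polyhedron $\mathcal P\subset\mathbb R^n$, let $f_{\mathcal P}(\theta)=\log\int_{\mathcal P}e^{\langle\theta,x\rangle}dx$ and let $f^*_{\mathcal P}$ be its Fenchel conjugate (the entropic barrier). For $c\in\mathbb R^n$ and $\mu>0$, $\mathcal C_{\mathcal P,c}(\mu)$ denotes the unique optimal solution of: minimize $\langle c,x\rangle+\mu f^*_{\mathcal P}(x)$ subject to $x\in\operatorname{int}\mathcal P$. *)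

theory Defs
  imports "HOL-Analysis.Analysis"
begin

section \<open>The ordered field of absolutely convergent generalized real Puiseux series\<close>

text \<open>
  A series is identified with its coefficient function. Accumulation points of the support are
  taken in the extended real line.
\<close>

definition puiseux_support :: "real set \<Rightarrow> bool" where
  "puiseux_support S \<longleftrightarrow> finite S \<or> {a. a islimpt ereal ` S} = {-\<infinity>}"

lemma puiseux_support_iff: "puiseux_support S \<longleftrightarrow> (\<forall>r. finite {\<alpha>\<in>S. r \<le> \<alpha>})"
proof
  assume S: "puiseux_support S"
  show "\<forall>r. finite {\<alpha>\<in>S. r \<le> \<alpha>}"
  proof (cases "finite S")
    case False
    then have lim: "\<And>a. a islimpt ereal ` S \<Longrightarrow> a = -\<infinity>"
      using S unfolding puiseux_support_def by blast
    show ?thesis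
    proof
      fix r
      have "finite ({ereal r..} \<inter> ereal ` S)"
      proof (rule finite_not_islimpt_in_compact)
        show "compact {ereal r..}"
          by (rule compact_eq_closed[THEN iffD2]) simp
        show "\<not> z islimpt ereal ` S" if "z \<in> {ereal r..}" for z
          using lim[of z] that by auto
      qed
      moreover have "ereal ` {\<alpha>\<in>S. r \<le> \<alpha>} = {ereal r..} \<inter> ereal ` S"
        by auto
      ultimately show "finite {\<alpha>\<in>S. r \<le> \<alpha>}"
        by (metis (no_types, lifting) finite_imageD inj_on_def ereal.inject)
    qed
  qed simp
next
  assume fin: "\<forall>r. finite {\<alpha>\<in>S. r \<le> \<alpha>}"
  show "puiseux_support S"
  proof (cases "finite S")
    case False
    have "a = -\<infinity>" if a: "a islimpt ereal ` S" for a
    proof (rule ccontr)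
      assume "a \<noteq> -\<infinity>"
      then obtain r where r: "ereal r < a"
        by (metis ereal_dense2 ereal_infty_less(2) less_ereal.simps(5) )
      have "a islimpt ereal ` S \<inter> {ereal r<..}"
        using order_tendstoD(1)[OF tendsto_ident_at r, of UNIV]
        by (intro islimpt_Int_eventually[OF a]) simp
      moreover have "finite (ereal ` S \<inter> {ereal r<..})"
      proof (rule finite_subset)
        show "ereal ` S \<inter> {ereal r<..} \<subseteq> ereal ` {\<alpha>\<in>S. r \<le> \<alpha>}" by auto
        show "finite (ereal ` {\<alpha>\<in>S. r \<le> \<alpha>})" using fin by blast
      qed
      ultimately show False using islimpt_finite by blast
    qed
    moreover have "\<exists>a. a islimpt ereal ` S"
    proof -
      have "infinite (ereal ` S)" using False by (simp add: finite_image_iff inj_on_def)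
      then show ?thesis
        using finite_not_islimpt_in_compact[OF compact_UNIV, of "ereal ` S"] by auto
    qed
    ultimately have "{a. a islimpt ereal ` S} = {-\<infinity>}" by blast
    then show ?thesis by (simp add: puiseux_support_def)
  qed (simp add: puiseux_support_def)
qed

definition abs_conv_at :: "(real \<Rightarrow> real) \<Rightarrow> real \<Rightarrow> bool" where
  "abs_conv_at c t \<longleftrightarrow> (\<lambda>\<alpha>. \<bar>c \<alpha> * t powr \<alpha>\<bar>) summable_on UNIV"

typedef puiseux =
  "{c :: real \<Rightarrow> real. puiseux_support {\<alpha>. c \<alpha> \<noteq> 0} \<and> (\<forall>\<^sub>F t in at_top. abs_conv_at c t)}"
  morphisms pcoeff Abs_puiseux
proof
  show "(\<lambda>_. 0) \<in> {c :: real \<Rightarrow> real. puiseux_support {\<alpha>. c \<alpha> \<noteq> 0} \<and> (\<forall>\<^sub>F t in at_top. abs_conv_at c t)}"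
    by (simp add: puiseux_support_def abs_conv_at_def)
qed

text \<open>
  The value of a series at \<open>t\<close> is only meaningful for large \<open>t\<close>, where the series converges
  absolutely; elsewhere \<open>peval z t\<close> may be arbitrary.
\<close>

definition peval :: "puiseux \<Rightarrow> real \<Rightarrow> real" where
  "peval z t = (\<Sum>\<^sub>\<infinity>\<alpha>. pcoeff z \<alpha> * t powr \<alpha>)"

definition lead_exp :: "puiseux \<Rightarrow> real" where
  "lead_exp z = (GREATEST \<alpha>. pcoeff z \<alpha> \<noteq> 0)"

definition is_puiseux :: "(real \<Rightarrow> real) \<Rightarrow> bool" where
  "is_puiseux c \<longleftrightarrow> puiseux_support {\<alpha>. c \<alpha> \<noteq> 0} \<and> (\<forall>\<^sub>F t in at_top. abs_conv_at c t)"

lemma coeff_is_puiseux: "is_puiseux (pcoeff z)"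
  using pcoeff[of z] by (simp add: is_puiseux_def)

lemma coeff_Abs: "is_puiseux c \<Longrightarrow> pcoeff (Abs_puiseux c) = c"
  by (simp add: Abs_puiseux_inverse is_puiseux_def)

lemma puiseux_eqI:
  assumes "\<And>\<alpha>. pcoeff x \<alpha> = pcoeff y \<alpha>"
  shows "x = y"
proof -
  have "pcoeff x = pcoeff y" using assms by (rule ext)
  then show ?thesis by (simp add: pcoeff_inject)
qed

lemma is_puiseux_iff:
  "is_puiseux c \<longleftrightarrow> (\<forall>r. finite {\<alpha>. c \<alpha> \<noteq> 0 \<and> r \<le> \<alpha>}) \<and> (\<forall>\<^sub>F t in at_top. abs_conv_at c t)"
  by (simp add: is_puiseux_def puiseux_support_iff)

lemma finite_support_ge: "finite {\<alpha>. pcoeff z \<alpha> \<noteq> 0 \<and> r \<le> \<alpha>}"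
  using coeff_is_puiseux[of z] by (simp add: is_puiseux_iff)

lemma abs_conv_coeff: "\<forall>\<^sub>F t in at_top. abs_conv_at (pcoeff z) t"
  using coeff_is_puiseux[of z] by (simp add: is_puiseux_iff)

lemma abs_conv_at_iff: "abs_conv_at c t \<longleftrightarrow> (\<lambda>\<alpha>. c \<alpha> * t powr \<alpha>) summable_on UNIV"
  by (simp add: abs_conv_at_def summable_on_iff_abs_summable_on_real[of "\<lambda>\<alpha>. c \<alpha> * t powr \<alpha>"])

lemma is_puiseux_single: "is_puiseux (\<lambda>\<alpha>. if \<alpha> = a then c else 0)"
proof -
  have 1: "finite {\<alpha>. (if \<alpha> = a then c else 0) \<noteq> 0 \<and> r \<le> \<alpha>}" for r
    by (rule finite_subset[of _ "{a}"]) auto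
  have 2: "abs_conv_at (\<lambda>\<alpha>. if \<alpha> = a then c else 0) t" for t
    unfolding abs_conv_at_iff
    by (rule finite_nonzero_values_imp_summable_on, rule finite_subset[of _ "{a}"]) auto
  show ?thesis unfolding is_puiseux_iff using 1 by (simp add: always_eventually 2)
qed

lemma is_puiseux_add:
  assumes "is_puiseux c" "is_puiseux d"
  shows "is_puiseux (\<lambda>\<alpha>. c \<alpha> + d \<alpha>)"
  unfolding is_puiseux_iff
proof
  show "\<forall>r. finite {\<alpha>. c \<alpha> + d \<alpha> \<noteq> 0 \<and> r \<le> \<alpha>}"
  proof
    fix r
    show "finite {\<alpha>. c \<alpha> + d \<alpha> \<noteq> 0 \<and> r \<le> \<alpha>}"
      by (rule finite_subset[of _ "{\<alpha>. c \<alpha> \<noteq> 0 \<and> r \<le> \<alpha>} \<union> {\<alpha>. d \<alpha> \<noteq> 0 \<and> r \<le> \<alpha>}"])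
        (use assms in \<open>auto simp: is_puiseux_iff\<close>)
  qed
  have "\<forall>\<^sub>F t in at_top. abs_conv_at c t" "\<forall>\<^sub>F t in at_top. abs_conv_at d t"
    using assms by (auto simp: is_puiseux_iff)
  then show "\<forall>\<^sub>F t in at_top. abs_conv_at (\<lambda>\<alpha>. c \<alpha> + d \<alpha>) t"
    by eventually_elim (simp add: abs_conv_at_iff distrib_right summable_on_add)
qed

lemma is_puiseux_uminus:
  assumes "is_puiseux c"
  shows "is_puiseux (\<lambda>\<alpha>. - c \<alpha>)"
  using assms by (simp add: is_puiseux_iff abs_conv_at_def)

definition cauchy_prod :: "(real \<Rightarrow> real) \<Rightarrow> (real \<Rightarrow> real) \<Rightarrow> real \<Rightarrow> real" where
  "cauchy_prod c d \<gamma> = (\<Sum>\<alpha> | c \<alpha> \<noteq> 0 \<and> d (\<gamma> - \<alpha>) \<noteq> 0. c \<alpha> * d (\<gamma> - \<alpha>))"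

lemma support_bdd:
  assumes "\<forall>r. finite {\<alpha>. c \<alpha> \<noteq> 0 \<and> r \<le> \<alpha>}"
  obtains B :: real where "\<And>\<alpha>. c \<alpha> \<noteq> 0 \<Longrightarrow> \<alpha> \<le> B"
proof -
  have "bdd_above {\<alpha>. c \<alpha> \<noteq> 0 \<and> 0 \<le> \<alpha>}"
    using assms by (intro bdd_above_finite) auto
  then obtain M where M: "\<And>\<alpha>. c \<alpha> \<noteq> 0 \<Longrightarrow> 0 \<le> \<alpha> \<Longrightarrow> \<alpha> \<le> M"
    by (auto simp: bdd_above_def)
  show thesis
    by (rule that[of "max M 0"]) (use M in force)
qed

lemma cauchy_prod_finite_pairs:
  assumes c: "\<forall>r. finite {\<alpha>. c \<alpha> \<noteq> 0 \<and> r \<le> \<alpha>}" and d: "\<forall>r. finite {\<alpha>. d \<alpha> \<noteq> 0 \<and> r \<le> \<alpha>}"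
  shows "finite {(\<alpha>, \<beta>). c \<alpha> \<noteq> 0 \<and> d \<beta> \<noteq> 0 \<and> (r::real) \<le> \<alpha> + \<beta>}"
proof -
  obtain A where A: "\<And>\<alpha>. c \<alpha> \<noteq> 0 \<Longrightarrow> \<alpha> \<le> A" using support_bdd[OF c] by blast
  obtain B where B: "\<And>\<alpha>. d \<alpha> \<noteq> 0 \<Longrightarrow> \<alpha> \<le> B" using support_bdd[OF d] by blast
  show ?thesis
    by (rule finite_subset[of _ "{\<alpha>. c \<alpha> \<noteq> 0 \<and> r - B \<le> \<alpha>} \<times> {\<alpha>. d \<alpha> \<noteq> 0 \<and> r - A \<le> \<alpha>}"])
      (use A B c d in force)+
qed

lemma cauchy_prod_finite:
  assumes c: "\<forall>r. finite {\<alpha>. c \<alpha> \<noteq> 0 \<and> r \<le> \<alpha>}" and d: "\<forall>r. finite {\<alpha>. d \<alpha> \<noteq> 0 \<and> r \<le> \<alpha>}"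
  shows "finite {\<alpha>. c \<alpha> \<noteq> 0 \<and> d ((\<gamma>::real) - \<alpha>) \<noteq> 0}"
  by (rule finite_subset[of _ "fst ` {(\<alpha>, \<beta>). c \<alpha> \<noteq> 0 \<and> d \<beta> \<noteq> 0 \<and> \<gamma> \<le> \<alpha> + \<beta>}"])
    (use cauchy_prod_finite_pairs[OF c d] in \<open>force simp: image_iff\<close>)+

lemma cauchy_prod_infsum:
  assumes c: "\<forall>r. finite {\<alpha>. c \<alpha> \<noteq> 0 \<and> r \<le> \<alpha>}" and d: "\<forall>r. finite {\<alpha>. d \<alpha> \<noteq> 0 \<and> r \<le> \<alpha>}"
  shows "cauchy_prod c d \<gamma> = (\<Sum>\<^sub>\<infinity>\<alpha>. c \<alpha> * d (\<gamma> - \<alpha>))"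
proof -
  have "(\<Sum>\<^sub>\<infinity>\<alpha>. c \<alpha> * d (\<gamma> - \<alpha>)) = (\<Sum>\<^sub>\<infinity>\<alpha>\<in>{\<alpha>. c \<alpha> \<noteq> 0 \<and> d (\<gamma> - \<alpha>) \<noteq> 0}. c \<alpha> * d (\<gamma> - \<alpha>))"
    by (rule infsum_cong_neutral) auto
  then show ?thesis using cauchy_prod_finite[OF c d] by (simp add: cauchy_prod_def)
qed

lemma cauchy_prod_eval:
  assumes c: "\<forall>r. finite {\<alpha>. c \<alpha> \<noteq> 0 \<and> r \<le> \<alpha>}" and d: "\<forall>r. finite {\<alpha>. d \<alpha> \<noteq> 0 \<and> r \<le> \<alpha>}"
    and ct: "abs_conv_at c t" and dt: "abs_conv_at d t" and t: "t > 0"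
  shows "abs_conv_at (cauchy_prod c d) t"
    and "(\<Sum>\<^sub>\<infinity>\<gamma>. cauchy_prod c d \<gamma> * t powr \<gamma>) = (\<Sum>\<^sub>\<infinity>\<alpha>. c \<alpha> * t powr \<alpha>) * (\<Sum>\<^sub>\<infinity>\<alpha>. d \<alpha> * t powr \<alpha>)"
proof -
  let ?f = "\<lambda>(\<alpha>, \<beta>). (c \<alpha> * t powr \<alpha>) * (d \<beta> * t powr \<beta>)"
  let ?g = "\<lambda>(\<gamma>, \<alpha>). (c \<alpha> * d (\<gamma> - \<alpha>)) * t powr \<gamma>"
  have fs: "?f summable_on UNIV \<times> UNIV"
  proof (rule Infinite_Sum.abs_summable_summable, rule Infinite_Sum.abs_summable_on_Sigma_iff[THEN iffD2], intro conjI ballI)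
    show "(\<lambda>\<beta>. norm (case (\<alpha>, \<beta>) of (\<alpha>, \<beta>) \<Rightarrow> (c \<alpha> * t powr \<alpha>) * (d \<beta> * t powr \<beta>))) summable_on UNIV" for \<alpha>
      using summable_on_cmult_right[OF dt[unfolded abs_conv_at_def], of "\<bar>c \<alpha> * t powr \<alpha>\<bar>"]
      by (simp add: abs_mult)
    show "(\<lambda>\<alpha>. norm (\<Sum>\<^sub>\<infinity>\<beta>. norm (case (\<alpha>, \<beta>) of (\<alpha>, \<beta>) \<Rightarrow> (c \<alpha> * t powr \<alpha>) * (d \<beta> * t powr \<beta>)))) summable_on UNIV"
      using summable_on_cmult_left[OF ct[unfolded abs_conv_at_def], of "\<Sum>\<^sub>\<infinity>\<beta>. \<bar>d \<beta> * t powr \<beta>\<bar>"]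
      by (simp add: abs_mult infsum_cmult_right' infsum_nonneg)
  qed
  have gf: "?g summable_on UNIV \<times> UNIV \<longleftrightarrow> ?f summable_on UNIV \<times> UNIV"
    by (rule summable_on_reindex_bij_witness[of _ "\<lambda>(\<alpha>, \<beta>). (\<alpha> + \<beta>, \<alpha>)" "\<lambda>(\<gamma>, \<alpha>). (\<alpha>, \<gamma> - \<alpha>)"])
      (use t in \<open>auto simp: powr_diff\<close>)
  have gf': "infsum ?g (UNIV \<times> UNIV) = infsum ?f (UNIV \<times> UNIV)"
    by (rule infsum_reindex_bij_witness[of _ "\<lambda>(\<alpha>, \<beta>). (\<alpha> + \<beta>, \<alpha>)" "\<lambda>(\<gamma>, \<alpha>). (\<alpha>, \<gamma> - \<alpha>)"])
      (use t in \<open>auto simp: powr_diff\<close>)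
  have gs: "?g summable_on UNIV \<times> UNIV" using gf fs by simp
  have inner: "(\<Sum>\<^sub>\<infinity>\<alpha>. (c \<alpha> * d (\<gamma> - \<alpha>)) * t powr \<gamma>) = cauchy_prod c d \<gamma> * t powr \<gamma>" for \<gamma>
    by (simp add: cauchy_prod_infsum[OF c d] infsum_cmult_left')
  show "abs_conv_at (cauchy_prod c d) t"
    using summable_on_Sigma_banach[of "\<lambda>\<gamma> \<alpha>. (c \<alpha> * d (\<gamma> - \<alpha>)) * t powr \<gamma>" UNIV "\<lambda>_. UNIV"] gs
    by (simp add: inner abs_conv_at_iff)
  have "(\<Sum>\<^sub>\<infinity>\<gamma>. cauchy_prod c d \<gamma> * t powr \<gamma>) = infsum ?g (UNIV \<times> UNIV)"
    using infsum_Sigma'_banach[of "\<lambda>\<gamma> \<alpha>. (c \<alpha> * d (\<gamma> - \<alpha>)) * t powr \<gamma>" UNIV "\<lambda>_. UNIV"] gs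
    by (simp add: inner)
  also have "\<dots> = infsum ?f (UNIV \<times> UNIV)" by (rule gf')
  also have "\<dots> = (\<Sum>\<^sub>\<infinity>\<alpha>. \<Sum>\<^sub>\<infinity>\<beta>. (c \<alpha> * t powr \<alpha>) * (d \<beta> * t powr \<beta>))"
    using infsum_Sigma'_banach[of "\<lambda>\<alpha> \<beta>. (c \<alpha> * t powr \<alpha>) * (d \<beta> * t powr \<beta>)" UNIV "\<lambda>_. UNIV"] fs
    by simp
  also have "\<dots> = (\<Sum>\<^sub>\<infinity>\<alpha>. c \<alpha> * t powr \<alpha>) * (\<Sum>\<^sub>\<infinity>\<alpha>. d \<alpha> * t powr \<alpha>)"
    by (simp add: infsum_cmult_right' infsum_cmult_left')
  finally show "(\<Sum>\<^sub>\<infinity>\<gamma>. cauchy_prod c d \<gamma> * t powr \<gamma>) = (\<Sum>\<^sub>\<infinity>\<alpha>. c \<alpha> * t powr \<alpha>) * (\<Sum>\<^sub>\<infinity>\<alpha>. d \<alpha> * t powr \<alpha>)" .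
qed

lemma is_puiseux_cauchy_prod:
  assumes "is_puiseux c" "is_puiseux d"
  shows "is_puiseux (cauchy_prod c d)"
proof -
  have c: "\<forall>r. finite {\<alpha>. c \<alpha> \<noteq> 0 \<and> r \<le> \<alpha>}" and d: "\<forall>r. finite {\<alpha>. d \<alpha> \<noteq> 0 \<and> r \<le> \<alpha>}"
    and cc: "\<forall>\<^sub>F t in at_top. abs_conv_at c t" and dd: "\<forall>\<^sub>F t in at_top. abs_conv_at d t"
    using assms by (auto simp: is_puiseux_iff)
  have "finite {\<gamma>. cauchy_prod c d \<gamma> \<noteq> 0 \<and> r \<le> \<gamma>}" for r
  proof (rule finite_subset)
    show "finite ((\<lambda>(\<alpha>, \<beta>). \<alpha> + \<beta>) ` {(\<alpha>, \<beta>). c \<alpha> \<noteq> 0 \<and> d \<beta> \<noteq> 0 \<and> r \<le> \<alpha> + \<beta>})"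
      by (intro finite_imageI cauchy_prod_finite_pairs c d)
    show "{\<gamma>. cauchy_prod c d \<gamma> \<noteq> 0 \<and> r \<le> \<gamma>}
       \<subseteq> (\<lambda>(\<alpha>, \<beta>). \<alpha> + \<beta>) ` {(\<alpha>, \<beta>). c \<alpha> \<noteq> 0 \<and> d \<beta> \<noteq> 0 \<and> r \<le> \<alpha> + \<beta>}"
    proof
      fix \<gamma> assume \<gamma>: "\<gamma> \<in> {\<gamma>. cauchy_prod c d \<gamma> \<noteq> 0 \<and> r \<le> \<gamma>}"
      then have "{\<alpha>. c \<alpha> \<noteq> 0 \<and> d (\<gamma> - \<alpha>) \<noteq> 0} \<noteq> {}"
        unfolding cauchy_prod_def by (intro notI) simp
      then obtain \<alpha> where "c \<alpha> \<noteq> 0" "d (\<gamma> - \<alpha>) \<noteq> 0" by blast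
      then show "\<gamma> \<in> (\<lambda>(\<alpha>, \<beta>). \<alpha> + \<beta>) ` {(\<alpha>, \<beta>). c \<alpha> \<noteq> 0 \<and> d \<beta> \<noteq> 0 \<and> r \<le> \<alpha> + \<beta>}"
        using \<gamma> by (intro image_eqI[where x = "(\<alpha>, \<gamma> - \<alpha>)"]) simp_all
    qed
  qed
  moreover have "\<forall>\<^sub>F t in at_top. abs_conv_at (cauchy_prod c d) t"
    using cc dd eventually_gt_at_top[of 0] by eventually_elim (rule cauchy_prod_eval[OF c d])
  ultimately show ?thesis by (simp add: is_puiseux_iff)
qed

instantiation puiseux :: ab_group_add
begin

definition "0 = Abs_puiseux (\<lambda>_. 0)"
definition "x + y = Abs_puiseux (\<lambda>\<alpha>. pcoeff x \<alpha> + pcoeff y \<alpha>)"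
definition "- x = Abs_puiseux (\<lambda>\<alpha>. - pcoeff x \<alpha>)"
definition "x - y = Abs_puiseux (\<lambda>\<alpha>. pcoeff x \<alpha> - pcoeff y \<alpha>)" for x y :: puiseux

lemma pcoeff_0 [simp]: "pcoeff 0 \<alpha> = 0"
  using is_puiseux_single[of 0 0] by (simp add: zero_puiseux_def coeff_Abs)

lemma pcoeff_add [simp]: "pcoeff (x + y) \<alpha> = pcoeff x \<alpha> + pcoeff y \<alpha>"
  by (simp add: plus_puiseux_def coeff_Abs is_puiseux_add coeff_is_puiseux)

lemma pcoeff_uminus [simp]: "pcoeff (- x) \<alpha> = - pcoeff x \<alpha>"
  by (simp add: uminus_puiseux_def coeff_Abs is_puiseux_uminus coeff_is_puiseux)

lemma pcoeff_diff [simp]: "pcoeff (x - y) \<alpha> = pcoeff x \<alpha> - pcoeff y \<alpha>"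
  using is_puiseux_add[OF coeff_is_puiseux is_puiseux_uminus[OF coeff_is_puiseux], of x y]
  by (simp add: minus_puiseux_def coeff_Abs)

instance
  by standard (auto intro!: puiseux_eqI)

end

definition psingle :: "real \<Rightarrow> real \<Rightarrow> puiseux" where
  "psingle a c = Abs_puiseux (\<lambda>\<alpha>. if \<alpha> = a then c else 0)"

lemma pcoeff_psingle: "pcoeff (psingle a c) \<alpha> = (if \<alpha> = a then c else 0)"
  by (simp add: psingle_def coeff_Abs is_puiseux_single)

lemma eval_psingle: "peval (psingle a c) t = c * t powr a"
proof -
  have "peval (psingle a c) t = (\<Sum>\<^sub>\<infinity>\<alpha>\<in>{a}. c * t powr \<alpha>)"
    unfolding peval_def by (rule infsum_cong_neutral) (auto simp: pcoeff_psingle)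
  then show ?thesis by simp
qed

lemma eval_0 [simp]: "peval 0 t = 0"
  by (simp add: peval_def)

lemma eval_uminus: "peval (- x) t = - peval x t"
  by (simp add: peval_def infsum_uminus)

lemma eval_add:
  assumes "abs_conv_at (pcoeff x) t" "abs_conv_at (pcoeff y) t"
  shows "abs_conv_at (pcoeff (x + y)) t" "peval (x + y) t = peval x t + peval y t"
  using assms by (auto simp: abs_conv_at_iff peval_def distrib_right summable_on_add infsum_add)

lemma abs_conv_uminus: "abs_conv_at (pcoeff (- x)) t \<longleftrightarrow> abs_conv_at (pcoeff x) t"
  by (simp add: abs_conv_at_def)

lemma ev_eval_add: "\<forall>\<^sub>F t in at_top. peval (x + y) t = peval x t + peval y t"
  using abs_conv_coeff[of x] abs_conv_coeff[of y] by eventually_elim (rule eval_add)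

lemma ev_eval_diff: "\<forall>\<^sub>F t in at_top. peval (x - y) t = peval x t - peval y t"
  using ev_eval_add[of x "- y"] by (simp add: eval_uminus)

lemma support_has_greatest:
  assumes "pcoeff z b \<noteq> 0"
  obtains a where "pcoeff z a \<noteq> 0" "\<And>\<alpha>. pcoeff z \<alpha> \<noteq> 0 \<Longrightarrow> \<alpha> \<le> a"
proof -
  let ?S = "{\<alpha>. pcoeff z \<alpha> \<noteq> 0 \<and> b \<le> \<alpha>}"
  have fin: "finite ?S" by (rule finite_support_ge)
  have ne: "?S \<noteq> {}" using assms by auto
  have "Max ?S \<in> ?S" using fin ne by (rule Max_in)
  moreover have "\<alpha> \<le> Max ?S" if "pcoeff z \<alpha> \<noteq> 0" for \<alpha>
  proof (cases "b \<le> \<alpha>")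
    case True then show ?thesis using that fin by (intro Max_ge) auto
  next
    case False then show ?thesis using Max_in[OF fin ne] by auto
  qed
  ultimately show thesis by (intro that[of "Max ?S"]) auto
qed

lemma lead_exp_eqI:
  assumes "pcoeff z a \<noteq> 0" "\<And>\<alpha>. pcoeff z \<alpha> \<noteq> 0 \<Longrightarrow> \<alpha> \<le> a"
  shows "lead_exp z = a"
  unfolding lead_exp_def using assms by (rule Greatest_equality)

lemma lead_exp_props:
  assumes "z \<noteq> 0"
  shows "pcoeff z (lead_exp z) \<noteq> 0" "pcoeff z \<alpha> \<noteq> 0 \<Longrightarrow> \<alpha> \<le> lead_exp z"
proof -
  obtain b where "pcoeff z b \<noteq> 0" using assms by (metis pcoeff_0 puiseux_eqI)
  then obtain a where a: "pcoeff z a \<noteq> 0" "\<And>\<alpha>. pcoeff z \<alpha> \<noteq> 0 \<Longrightarrow> \<alpha> \<le> a"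
    using support_has_greatest by blast
  have "lead_exp z = a" using a by (rule lead_exp_eqI)
  then show "pcoeff z (lead_exp z) \<noteq> 0" "pcoeff z \<alpha> \<noteq> 0 \<Longrightarrow> \<alpha> \<le> lead_exp z"
    using a by auto
qed

lemma lead_exp_uminus: "lead_exp (- z) = lead_exp z"
  by (simp add: lead_exp_def)

definition pnorm :: "puiseux \<Rightarrow> real \<Rightarrow> real" where
  "pnorm z t = (\<Sum>\<^sub>\<infinity>\<alpha>. \<bar>pcoeff z \<alpha> * t powr \<alpha>\<bar>)"

lemma pnorm_nonneg: "0 \<le> pnorm z t"
  by (simp add: pnorm_def infsum_nonneg)

lemma abs_eval_le_pnorm:
  assumes "abs_conv_at (pcoeff z) t"
  shows "\<bar>peval z t\<bar> \<le> pnorm z t"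
  using norm_infsum_bound[of "\<lambda>\<alpha>. pcoeff z \<alpha> * t powr \<alpha>" UNIV] assms
  by (simp add: peval_def pnorm_def abs_conv_at_def)

lemma pnorm_growth:
  assumes conv: "abs_conv_at (pcoeff z) t0" and t0: "t0 > 0" and t: "t0 \<le> t"
    and b: "\<And>\<alpha>. pcoeff z \<alpha> \<noteq> 0 \<Longrightarrow> \<alpha> \<le> b"
  shows "abs_conv_at (pcoeff z) t" "pnorm z t \<le> pnorm z t0 * (t / t0) powr b"
proof -
  have le: "\<bar>pcoeff z \<alpha> * t powr \<alpha>\<bar> \<le> \<bar>pcoeff z \<alpha> * t0 powr \<alpha>\<bar> * (t / t0) powr b" for \<alpha>
  proof (cases "pcoeff z \<alpha> = 0")
    case False
    have "t powr \<alpha> = t0 powr \<alpha> * (t / t0) powr \<alpha>"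
      using t0 t by (simp add: powr_divide)
    moreover have "(t / t0) powr \<alpha> \<le> (t / t0) powr b"
      using b[OF False] t0 t by (intro powr_mono) auto
    ultimately show ?thesis
      using t0 by (simp add: abs_mult mult.assoc mult_left_mono)
  qed simp
  have s: "(\<lambda>\<alpha>. \<bar>pcoeff z \<alpha> * t0 powr \<alpha>\<bar> * (t / t0) powr b) summable_on UNIV"
    using conv by (intro summable_on_cmult_left) (simp add: abs_conv_at_def)
  show c: "abs_conv_at (pcoeff z) t"
    unfolding abs_conv_at_def by (rule summable_on_comparison_test[OF s]) (use le in auto)
  have "pnorm z t \<le> (\<Sum>\<^sub>\<infinity>\<alpha>. \<bar>pcoeff z \<alpha> * t0 powr \<alpha>\<bar> * (t / t0) powr b)"
    unfolding pnorm_def using c s by (intro infsum_mono le) (auto simp: abs_conv_at_def)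
  then show "pnorm z t \<le> pnorm z t0 * (t / t0) powr b"
    by (simp add: pnorm_def infsum_cmult_left')
qed

lemma pnorm_bound:
  assumes b: "\<And>\<alpha>. pcoeff z \<alpha> \<noteq> 0 \<Longrightarrow> \<alpha> \<le> b"
  obtains M where "\<forall>\<^sub>F t in at_top. abs_conv_at (pcoeff z) t \<and> pnorm z t \<le> M * t powr b"
proof -
  have "\<forall>\<^sub>F t in at_top. abs_conv_at (pcoeff z) t \<and> t > 0"
    using abs_conv_coeff[of z] eventually_gt_at_top[of 0] by eventually_elim simp
  then obtain t0 where t0: "abs_conv_at (pcoeff z) t0" "t0 > 0"
    by (metis (no_types, lifting) eventually_at_top_linorder order_refl)
  show thesis
  proof (rule that[of "pnorm z t0 / t0 powr b"])
    show "\<forall>\<^sub>F t in at_top. abs_conv_at (pcoeff z) t \<and> pnorm z t \<le> pnorm z t0 / t0 powr b * t powr b"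
      using eventually_ge_at_top[of t0]
    proof eventually_elim
      case (elim t)
      show ?case
        using pnorm_growth[OF t0 elim b] t0 elim by (simp add: powr_divide)
    qed
  qed
qed

lemma support_gap:
  obtains \<delta> :: real where "\<delta> > 0" "\<And>\<alpha>. pcoeff z \<alpha> \<noteq> 0 \<Longrightarrow> \<alpha> < a \<Longrightarrow> \<alpha> \<le> a - \<delta>"
proof -
  let ?S = "insert (a - 1) {\<alpha>. (pcoeff z \<alpha> \<noteq> 0 \<and> a - 1 \<le> \<alpha>) \<and> \<alpha> < a}"
  have fin: "finite ?S"
    by (intro finite.insertI finite_subset[OF _ finite_support_ge[of z "a - 1"]]) auto
  have m: "Max ?S \<in> ?S" by (rule Max_in[OF fin]) simp
  show thesis
  proof (rule that[of "a - Max ?S"])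
    show "a - Max ?S > 0" using m by auto
    fix \<alpha> assume \<alpha>: "pcoeff z \<alpha> \<noteq> 0" "\<alpha> < a"
    have "\<alpha> \<le> Max ?S"
    proof (cases "a - 1 \<le> \<alpha>")
      case True then show ?thesis using \<alpha> fin by (intro Max_ge) auto
    next
      case False
      have "a - 1 \<le> Max ?S" using fin by (intro Max_ge) auto
      then show ?thesis using False by simp
    qed
    then show "\<alpha> \<le> a - (a - Max ?S)" by simp
  qed
qed

lemma eval_leading:
  obtains M \<delta> where "\<delta> > 0"
    "\<forall>\<^sub>F t in at_top. \<bar>peval z t - pcoeff z (lead_exp z) * t powr lead_exp z\<bar> \<le> M * t powr (lead_exp z - \<delta>)"
proof -
  let ?a = "lead_exp z"
  define y where "y = z - psingle ?a (pcoeff z ?a)"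
  have y: "pcoeff y \<alpha> = (if \<alpha> = ?a then 0 else pcoeff z \<alpha>)" for \<alpha>
    by (simp add: y_def pcoeff_psingle)
  obtain \<delta> where \<delta>: "\<delta> > 0" "\<And>\<alpha>. pcoeff z \<alpha> \<noteq> 0 \<Longrightarrow> \<alpha> < ?a \<Longrightarrow> \<alpha> \<le> ?a - \<delta>"
    using support_gap by blast
  have yb: "\<alpha> \<le> ?a - \<delta>" if "pcoeff y \<alpha> \<noteq> 0" for \<alpha>
  proof -
    have "\<alpha> \<noteq> ?a" "pcoeff z \<alpha> \<noteq> 0" using that y by (auto split: if_splits)
    moreover then have "\<alpha> \<le> ?a" by (metis lead_exp_props(2) pcoeff_0)
    ultimately show ?thesis using \<delta> by auto
  qed
  obtain M where M: "\<forall>\<^sub>F t in at_top. abs_conv_at (pcoeff y) t \<and> pnorm y t \<le> M * t powr (?a - \<delta>)"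
    using pnorm_bound[OF yb] by blast
  show thesis
  proof (rule that[OF \<delta>(1)])
    show "\<forall>\<^sub>F t in at_top. \<bar>peval z t - pcoeff z ?a * t powr ?a\<bar> \<le> M * t powr (?a - \<delta>)"
      using M ev_eval_diff[of z "psingle ?a (pcoeff z ?a)"]
    proof eventually_elim
      case (elim t)
      then have "peval z t - pcoeff z ?a * t powr ?a = peval y t" by (simp add: y_def eval_psingle)
      then show ?case using abs_eval_le_pnorm[of y t] elim by linarith
    qed
  qed
qed

lemma eval_asymp: "((\<lambda>t. peval z t / t powr lead_exp z) \<longlongrightarrow> pcoeff z (lead_exp z)) at_top"
proof -
  let ?a = "lead_exp z"
  obtain M \<delta> where \<delta>: "\<delta> > 0"
    and M: "\<forall>\<^sub>F t in at_top. \<bar>peval z t - pcoeff z ?a * t powr ?a\<bar> \<le> M * t powr (?a - \<delta>)"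
    using eval_leading by blast
  have lim: "((\<lambda>t. M * t powr (- \<delta>)) \<longlongrightarrow> 0) at_top"
    using tendsto_mult_right_zero[OF tendsto_neg_powr[of "- \<delta>" "\<lambda>t. t" at_top]] \<delta>
    by (simp add: filterlim_ident)
  have "((\<lambda>t. peval z t / t powr ?a - pcoeff z ?a) \<longlongrightarrow> 0) at_top"
  proof (rule Lim_null_comparison[OF _ lim])
    show "\<forall>\<^sub>F t in at_top. norm (peval z t / t powr ?a - pcoeff z ?a) \<le> M * t powr (- \<delta>)"
      using M eventually_gt_at_top[of 0]
    proof eventually_elim
      case (elim t)
      have "peval z t / t powr ?a - pcoeff z ?a = (peval z t - pcoeff z ?a * t powr ?a) / t powr ?a"
        using elim by (simp add: field_simps)
      then have "\<bar>peval z t / t powr ?a - pcoeff z ?a\<bar> \<le> M * t powr (?a - \<delta>) / t powr ?a"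
        using elim by (simp add: divide_right_mono)
      also have "\<dots> = M * t powr (- \<delta>)"
        using elim by (simp add: powr_diff powr_minus field_simps)
      finally show ?case by simp
    qed
  qed
  then show ?thesis by (rule LIM_zero_cancel)
qed

lemma eval_pos:
  assumes "pcoeff z (lead_exp z) > 0"
  shows "\<forall>\<^sub>F t in at_top. peval z t > 0"
  using order_tendstoD(1)[OF eval_asymp assms] eventually_gt_at_top[of 0]
  by eventually_elim (simp add: zero_less_divide_iff)

lemma eval_neg:
  assumes "pcoeff z (lead_exp z) < 0"
  shows "\<forall>\<^sub>F t in at_top. peval z t < 0"
  using eval_pos[of "- z"] assms by (simp add: lead_exp_uminus eval_uminus)

lemma eval_eqI:
  assumes "\<forall>\<^sub>F t in at_top. peval x t = peval y t"
  shows "x = y"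
proof (rule ccontr)
  assume "x \<noteq> y"
  then have "x - y \<noteq> 0" by simp
  then have "pcoeff (x - y) (lead_exp (x - y)) \<noteq> 0" by (rule lead_exp_props)
  then have "\<forall>\<^sub>F t in at_top. peval (x - y) t \<noteq> 0"
  proof (cases "pcoeff (x - y) (lead_exp (x - y)) > 0")
    case True
    then show ?thesis using eval_pos[of "x - y"] by (auto elim: eventually_mono)
  next
    case False
    then have "pcoeff (x - y) (lead_exp (x - y)) < 0"
      using \<open>pcoeff (x - y) (lead_exp (x - y)) \<noteq> 0\<close> by linarith
    then show ?thesis using eval_neg[of "x - y"] by (auto elim: eventually_mono)
  qed
  then have "\<forall>\<^sub>F t :: real in at_top. False"
    using assms ev_eval_diff[of x y] by eventually_elim simp
  then show False by simp
qed

instantiation puiseux :: comm_ring_1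
begin

text \<open>The Cauchy product; the index set of the sum is finite (\<open>cauchy_prod_finite\<close>).\<close>

definition "1 = psingle 0 1"

definition "x * y = Abs_puiseux
  (\<lambda>\<gamma>. \<Sum>\<alpha> | pcoeff x \<alpha> \<noteq> 0 \<and> pcoeff y (\<gamma> - \<alpha>) \<noteq> 0. pcoeff x \<alpha> * pcoeff y (\<gamma> - \<alpha>))"

lemma pcoeff_mult: "pcoeff (x * y) = cauchy_prod (pcoeff x) (pcoeff y)"
  using is_puiseux_cauchy_prod[OF coeff_is_puiseux coeff_is_puiseux, of x y]
  by (simp add: times_puiseux_def coeff_Abs cauchy_prod_def[abs_def])

lemma eval_mult:
  assumes "abs_conv_at (pcoeff x) t" "abs_conv_at (pcoeff y) t" "t > 0"
  shows "abs_conv_at (pcoeff (x * y)) t" "peval (x * y) t = peval x t * peval y t"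
  using cauchy_prod_eval[OF _ _ assms] finite_support_ge by (auto simp: peval_def pcoeff_mult)

lemma ev_eval_mult: "\<forall>\<^sub>F t in at_top. peval (x * y) t = peval x t * peval y t"
  using abs_conv_coeff[of x] abs_conv_coeff[of y] eventually_gt_at_top[of 0]
  by eventually_elim (rule eval_mult)

lemma ev_eval_1: "\<forall>\<^sub>F t in at_top. peval 1 t = 1"
  using eventually_gt_at_top[of 0] by eventually_elim (simp add: one_puiseux_def eval_psingle)

instance
proof
  fix a b c :: puiseux
  show "a * b * c = a * (b * c)"
    by (rule eval_eqI, use ev_eval_mult[of a b] ev_eval_mult[of "a * b" c] ev_eval_mult[of b c]
      ev_eval_mult[of a "b * c"] in eventually_elim) simp
  show "a * b = b * a"
    by (rule eval_eqI, use ev_eval_mult[of a b] ev_eval_mult[of b a] in eventually_elim) simp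
  show "1 * a = a"
    by (rule eval_eqI, use ev_eval_mult[of 1 a] ev_eval_1 in eventually_elim) simp
  show "(a + b) * c = a * c + b * c"
    by (rule eval_eqI, use ev_eval_mult[of "a + b" c] ev_eval_add[of a b] ev_eval_mult[of a c]
      ev_eval_mult[of b c] ev_eval_add[of "a * c" "b * c"] in eventually_elim) (simp add: distrib_right)
  have "pcoeff (0::puiseux) 0 \<noteq> pcoeff 1 0" by (simp add: one_puiseux_def pcoeff_psingle)
  then show "(0::puiseux) \<noteq> 1" by metis
qed

end

instantiation puiseux :: linordered_idom
begin

definition "x \<le> y \<longleftrightarrow> x = y \<or> pcoeff (y - x) (lead_exp (y - x)) > 0"
definition "x < y \<longleftrightarrow> x \<le> y \<and> x \<noteq> y" for x y :: puiseux
definition "\<bar>x\<bar> = (if x < 0 then - x else x)" for x :: puiseux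
definition "sgn x = (if x = 0 then 0 else if 0 < x then 1 else - 1)" for x :: puiseux

lemma ev_less_of_lead:
  assumes "pcoeff (y - x) (lead_exp (y - x)) > 0"
  shows "\<forall>\<^sub>F t in at_top. peval x t < peval y t"
  using eval_pos[OF assms] ev_eval_diff[of y x] by eventually_elim simp

lemma puiseux_less_iff: "x < y \<longleftrightarrow> (\<forall>\<^sub>F t in at_top. peval x t < peval y t)"
proof
  assume "x < y"
  then have "pcoeff (y - x) (lead_exp (y - x)) > 0"
    by (auto simp: less_puiseux_def less_eq_puiseux_def)
  then show "\<forall>\<^sub>F t in at_top. peval x t < peval y t" by (rule ev_less_of_lead)
next
  assume ev: "\<forall>\<^sub>F t in at_top. peval x t < peval y t"
  have "y - x \<noteq> 0"
  proof
    assume "y - x = 0"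
    then have "\<forall>\<^sub>F t :: real in at_top. False" using ev by auto
    then show False by simp
  qed
  then have "pcoeff (y - x) (lead_exp (y - x)) \<noteq> 0" by (rule lead_exp_props)
  moreover have "\<not> pcoeff (y - x) (lead_exp (y - x)) < 0"
  proof
    assume "pcoeff (y - x) (lead_exp (y - x)) < 0"
    from eval_neg[OF this] have "\<forall>\<^sub>F t :: real in at_top. False"
      using ev ev_eval_diff[of y x] by eventually_elim simp
    then show False by simp
  qed
  ultimately show "x < y" using \<open>y - x \<noteq> 0\<close> by (auto simp: less_puiseux_def less_eq_puiseux_def)
qed

lemma puiseux_le_iff: "x \<le> y \<longleftrightarrow> (\<forall>\<^sub>F t in at_top. peval x t \<le> peval y t)"
proof
  assume "x \<le> y"
  then consider "x = y" | "x < y" by (auto simp: less_puiseux_def)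
  then show "\<forall>\<^sub>F t in at_top. peval x t \<le> peval y t"
  proof cases
    case 2 then show ?thesis unfolding puiseux_less_iff by eventually_elim simp
  qed simp
next
  assume ev: "\<forall>\<^sub>F t in at_top. peval x t \<le> peval y t"
  show "x \<le> y"
  proof (rule ccontr)
    assume n: "\<not> x \<le> y"
    have "y - x \<noteq> 0" using n by (auto simp: less_eq_puiseux_def)
    then have "pcoeff (y - x) (lead_exp (y - x)) \<noteq> 0" by (rule lead_exp_props)
    then have "pcoeff (y - x) (lead_exp (y - x)) < 0" using n by (auto simp: less_eq_puiseux_def)
    from eval_neg[OF this] have "\<forall>\<^sub>F t :: real in at_top. False"
      using ev ev_eval_diff[of y x] by eventually_elim simp
    then show False by simp
  qed
qed

instance
proof
  fix x y z :: puiseux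
  show "x \<le> x" by (simp add: less_eq_puiseux_def)
  show "x \<le> z" if "x \<le> y" "y \<le> z"
    using that unfolding puiseux_le_iff by eventually_elim simp
  show anti: "x = y" if "x \<le> y" "y \<le> x"
    using that unfolding puiseux_le_iff by (intro eval_eqI, eventually_elim) simp
  show "(x < y) = (x \<le> y \<and> \<not> y \<le> x)"
    using anti by (auto simp: less_puiseux_def less_eq_puiseux_def[of x x])
  show "x \<le> y \<or> y \<le> x"
  proof (cases "x = y")
    case False
    have e: "x - y = - (y - x)" by simp
    from False have "y - x \<noteq> 0" by simp
    then have "pcoeff (y - x) (lead_exp (y - x)) \<noteq> 0" by (rule lead_exp_props)
    then show ?thesis unfolding less_eq_puiseux_def e by (simp add: lead_exp_uminus del: minus_diff_eq) auto
  qed (simp add: less_eq_puiseux_def)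
  show "z + x \<le> z + y" if "x \<le> y"
    using that by (simp add: less_eq_puiseux_def)
  show "z * x < z * y" if "x < y" "0 < z"
    using that ev_eval_mult[of z x] ev_eval_mult[of z y] unfolding puiseux_less_iff
    by eventually_elim simp
  show "\<bar>x\<bar> = (if x < 0 then - x else x)" by (rule abs_puiseux_def)
  show "sgn x = (if x = 0 then 0 else if 0 < x then 1 else - 1)" by (rule sgn_puiseux_def)
qed

end

lemma pcoeff_mult_nonzero:
  assumes "pcoeff (x * y) \<gamma> \<noteq> 0"
  obtains \<alpha> \<beta> where "pcoeff x \<alpha> \<noteq> 0" "pcoeff y \<beta> \<noteq> 0" "\<gamma> = \<alpha> + \<beta>"
proof -
  have "{\<alpha>. pcoeff x \<alpha> \<noteq> 0 \<and> pcoeff y (\<gamma> - \<alpha>) \<noteq> 0} \<noteq> {}"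
    using assms unfolding pcoeff_mult cauchy_prod_def by (intro notI) simp
  then obtain \<alpha> where "pcoeff x \<alpha> \<noteq> 0" "pcoeff y (\<gamma> - \<alpha>) \<noteq> 0" by blast
  then show thesis by (intro that[of \<alpha> "\<gamma> - \<alpha>"]) auto
qed

lemma pnorm_mult:
  assumes x: "abs_conv_at (pcoeff x) t" and y: "abs_conv_at (pcoeff y) t" and t: "t > 0"
  shows "pnorm (x * y) t \<le> pnorm x t * pnorm y t"
proof -
  let ?c = "\<lambda>\<alpha>. \<bar>pcoeff x \<alpha>\<bar>" and ?d = "\<lambda>\<alpha>. \<bar>pcoeff y \<alpha>\<bar>"
  have fc: "\<forall>r. finite {\<alpha>. ?c \<alpha> \<noteq> 0 \<and> r \<le> \<alpha>}" and fd: "\<forall>r. finite {\<alpha>. ?d \<alpha> \<noteq> 0 \<and> r \<le> \<alpha>}"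
    using finite_support_ge by auto
  have cc: "abs_conv_at ?c t" and dd: "abs_conv_at ?d t"
    using x y by (auto simp: abs_conv_at_def abs_mult)
  have le: "\<bar>pcoeff (x * y) \<gamma> * t powr \<gamma>\<bar> \<le> cauchy_prod ?c ?d \<gamma> * t powr \<gamma>" for \<gamma>
  proof -
    have "\<bar>cauchy_prod (pcoeff x) (pcoeff y) \<gamma>\<bar> \<le> cauchy_prod ?c ?d \<gamma>"
      unfolding cauchy_prod_def by (rule order_trans[OF sum_abs]) (simp add: abs_mult)
    then show ?thesis by (simp add: abs_mult pcoeff_mult mult_right_mono)
  qed
  have "pnorm (x * y) t \<le> (\<Sum>\<^sub>\<infinity>\<gamma>. cauchy_prod ?c ?d \<gamma> * t powr \<gamma>)"
    unfolding pnorm_def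
    by (intro infsum_mono le)
      (use eval_mult(1)[OF x y t] cauchy_prod_eval(1)[OF fc fd cc dd t] in
        \<open>auto simp: abs_conv_at_def abs_conv_at_iff[of "cauchy_prod ?c ?d", symmetric]\<close>)
  also have "\<dots> = pnorm x t * pnorm y t"
    unfolding cauchy_prod_eval(2)[OF fc fd cc dd t] by (simp add: pnorm_def abs_mult)
  finally show ?thesis .
qed

lemma power_conv:
  assumes w: "abs_conv_at (pcoeff w) t" and t: "t > 0"
  shows "abs_conv_at (pcoeff (w ^ k)) t \<and> peval (w ^ k) t = peval w t ^ k \<and> pnorm (w ^ k) t \<le> pnorm w t ^ k"
proof (induction k)
  case 0
  have "abs_conv_at (pcoeff 1) t"
    unfolding one_puiseux_def abs_conv_at_iff pcoeff_psingle
    by (rule finite_nonzero_values_imp_summable_on, rule finite_subset[of _ "{0}"]) auto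
  moreover have "pnorm 1 t = (\<Sum>\<^sub>\<infinity>\<alpha>\<in>{0::real}. 1)"
    unfolding pnorm_def by (rule infsum_cong_neutral) (use t in \<open>auto simp: one_puiseux_def pcoeff_psingle\<close>)
  ultimately show ?case using t by (simp add: one_puiseux_def eval_psingle)
next
  case (Suc k)
  have "pnorm w t * pnorm (w ^ k) t \<le> pnorm w t * pnorm w t ^ k"
    using Suc by (intro mult_left_mono pnorm_nonneg) simp
  then show ?case
    using eval_mult[OF w _ t, of "w ^ k"] pnorm_mult[OF w _ t, of "w ^ k"] Suc by force
qed

lemma power_support:
  assumes w: "\<And>\<alpha>. pcoeff w \<alpha> \<noteq> 0 \<Longrightarrow> \<alpha> \<le> - \<delta>" and "pcoeff (w ^ k) \<gamma> \<noteq> 0"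
  shows "\<gamma> \<le> - (real k * \<delta>)"
  using assms(2)
proof (induction k arbitrary: \<gamma>)
  case 0
  then show ?case by (simp add: one_puiseux_def pcoeff_psingle split: if_splits)
next
  case (Suc k)
  then obtain \<alpha> \<beta> where "pcoeff w \<alpha> \<noteq> 0" "pcoeff (w ^ k) \<beta> \<noteq> 0" "\<gamma> = \<alpha> + \<beta>"
    by (auto elim: pcoeff_mult_nonzero)
  then show ?case using w[of \<alpha>] Suc.IH[of \<beta>] by (simp add: algebra_simps)
qed

lemma geometric_inverse:
  assumes \<delta>: "\<delta> > 0" and w: "\<And>\<alpha>. pcoeff w \<alpha> \<noteq> 0 \<Longrightarrow> \<alpha> \<le> - \<delta>"
  shows "\<exists>y. y * (1 - w) = 1"
proof -
  define c where "c \<gamma> = (\<Sum>\<^sub>\<infinity>k. pcoeff (w ^ k) \<gamma>)" for \<gamma>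
  obtain M where M: "\<forall>\<^sub>F t in at_top. abs_conv_at (pcoeff w) t \<and> pnorm w t \<le> M * t powr (- \<delta>)"
    using pnorm_bound[OF w] by blast
  have "((\<lambda>t. M * t powr (- \<delta>)) \<longlongrightarrow> 0) at_top"
    using tendsto_mult_right_zero[OF tendsto_neg_powr[of "- \<delta>" "\<lambda>t. t" at_top]] \<delta>
    by (simp add: filterlim_ident)
  then have "\<forall>\<^sub>F t in at_top. M * t powr (- \<delta>) < 1" by (rule order_tendstoD) simp
  with M have W: "\<forall>\<^sub>F t in at_top. abs_conv_at (pcoeff w) t \<and> pnorm w t < 1 \<and> t > 0"
    using eventually_gt_at_top[of 0] by eventually_elim auto
  have main: "abs_conv_at c t \<and> (\<Sum>\<^sub>\<infinity>\<gamma>. c \<gamma> * t powr \<gamma>) = 1 / (1 - peval w t)"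
    if wt: "abs_conv_at (pcoeff w) t" and lt: "pnorm w t < 1" and t: "t > 0" for t
  proof -
    let ?h = "\<lambda>(k, \<gamma>). pcoeff (w ^ k) \<gamma> * t powr \<gamma>"
    have hs: "?h summable_on UNIV \<times> UNIV"
    proof (rule Infinite_Sum.abs_summable_summable, rule Infinite_Sum.abs_summable_on_Sigma_iff[THEN iffD2],
        intro conjI ballI)
      show "(\<lambda>\<gamma>. norm (case (k, \<gamma>) of (k, \<gamma>) \<Rightarrow> pcoeff (w ^ k) \<gamma> * t powr \<gamma>)) summable_on UNIV" for k
        using power_conv[OF wt t, of k] by (simp add: abs_conv_at_def)
      have "(\<lambda>k. pnorm w t ^ k) summable_on UNIV"
        using lt pnorm_nonneg[of w t] by (intro summable_nonneg_imp_summable_on summable_geometric) auto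
      then have "(\<lambda>k. pnorm (w ^ k) t) summable_on UNIV"
        by (rule summable_on_comparison_test) (use power_conv[OF wt t] pnorm_nonneg in auto)
      then show "(\<lambda>k. norm (\<Sum>\<^sub>\<infinity>\<gamma>. norm (case (k, \<gamma>) of (k, \<gamma>) \<Rightarrow> pcoeff (w ^ k) \<gamma> * t powr \<gamma>))) summable_on UNIV"
        using pnorm_nonneg by (simp add: pnorm_def)
    qed
    have hs': "(\<lambda>(\<gamma>, k). pcoeff (w ^ k) \<gamma> * t powr \<gamma>) summable_on UNIV \<times> UNIV"
      using hs by (subst summable_on_reindex_bij_witness[of _ prod.swap prod.swap "UNIV \<times> UNIV" ?h]) auto
    have inner: "(\<Sum>\<^sub>\<infinity>k. pcoeff (w ^ k) \<gamma> * t powr \<gamma>) = c \<gamma> * t powr \<gamma>" for \<gamma>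
      by (simp add: c_def infsum_cmult_left')
    have ab: "abs_conv_at c t"
      using summable_on_Sigma_banach[of "\<lambda>\<gamma> k. pcoeff (w ^ k) \<gamma> * t powr \<gamma>" UNIV "\<lambda>_. UNIV"] hs'
      by (simp add: inner abs_conv_at_iff)
    have "(\<Sum>\<^sub>\<infinity>\<gamma>. c \<gamma> * t powr \<gamma>) = (\<Sum>\<^sub>\<infinity>\<gamma>. \<Sum>\<^sub>\<infinity>k. pcoeff (w ^ k) \<gamma> * t powr \<gamma>)"
      by (simp add: inner)
    also have "\<dots> = (\<Sum>\<^sub>\<infinity>k. \<Sum>\<^sub>\<infinity>\<gamma>. pcoeff (w ^ k) \<gamma> * t powr \<gamma>)"
      by (rule infsum_swap_banach) (use hs' in simp)
    also have "\<dots> = (\<Sum>\<^sub>\<infinity>k. peval w t ^ k)"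
      using power_conv[OF wt t] by (simp add: peval_def[symmetric])
    also have "\<dots> = 1 / (1 - peval w t)"
    proof (rule infsumI, rule norm_summable_imp_has_sum)
      have e: "\<bar>peval w t\<bar> < 1" using abs_eval_le_pnorm[OF wt] lt by simp
      then show "summable (\<lambda>k. norm (peval w t ^ k))" by (simp add: power_abs summable_geometric)
      show "(\<lambda>k. peval w t ^ k) sums (1 / (1 - peval w t))" using e by (simp add: geometric_sums)
    qed
    finally show ?thesis using ab by blast
  qed
  have "finite {\<gamma>. c \<gamma> \<noteq> 0 \<and> r \<le> \<gamma>}" for r
  proof (rule finite_subset)
    show "finite (\<Union>k\<in>{..nat \<lceil>- r / \<delta>\<rceil>}. {\<gamma>. pcoeff (w ^ k) \<gamma> \<noteq> 0 \<and> r \<le> \<gamma>})"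
      using finite_support_ge by (intro finite_UN_I) auto
    show "{\<gamma>. c \<gamma> \<noteq> 0 \<and> r \<le> \<gamma>} \<subseteq> (\<Union>k\<in>{..nat \<lceil>- r / \<delta>\<rceil>}. {\<gamma>. pcoeff (w ^ k) \<gamma> \<noteq> 0 \<and> r \<le> \<gamma>})"
    proof
      fix \<gamma> assume \<gamma>: "\<gamma> \<in> {\<gamma>. c \<gamma> \<noteq> 0 \<and> r \<le> \<gamma>}"
      then obtain k where k: "pcoeff (w ^ k) \<gamma> \<noteq> 0"
        unfolding c_def by (metis (mono_tags, lifting) infsum_0 mem_Collect_eq)
      have "r \<le> - (real k * \<delta>)" using power_support[OF w k] \<gamma> by simp
      then have "real k \<le> - r / \<delta>" using \<delta> by (simp add: field_simps)
      then have "k \<le> nat \<lceil>- r / \<delta>\<rceil>" by linarith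
      then show "\<gamma> \<in> (\<Union>k\<in>{..nat \<lceil>- r / \<delta>\<rceil>}. {\<gamma>. pcoeff (w ^ k) \<gamma> \<noteq> 0 \<and> r \<le> \<gamma>})"
        using k \<gamma> by auto
    qed
  qed
  moreover have "\<forall>\<^sub>F t in at_top. abs_conv_at c t"
    using W by eventually_elim (use main in blast)
  ultimately have c: "is_puiseux c" by (simp add: is_puiseux_iff)
  have "Abs_puiseux c * (1 - w) = 1"
  proof (rule eval_eqI)
    show "\<forall>\<^sub>F t in at_top. peval (Abs_puiseux c * (1 - w)) t = peval 1 t"
      using W ev_eval_mult[of "Abs_puiseux c" "1 - w"] ev_eval_diff[of 1 w] ev_eval_1
    proof eventually_elim
      case (elim t)
      have "peval w t < 1" using abs_eval_le_pnorm[of w t] elim by linarith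
      moreover have "peval (Abs_puiseux c) t = 1 / (1 - peval w t)"
        using main[of t] elim by (simp add: peval_def coeff_Abs[OF c])
      ultimately show ?case using elim by simp
    qed
  qed
  then show ?thesis ..
qed

lemma psingle_mult: "psingle a c * psingle b d = psingle (a + b) (c * d)"
proof (rule eval_eqI)
  show "\<forall>\<^sub>F t in at_top. peval (psingle a c * psingle b d) t = peval (psingle (a + b) (c * d)) t"
    using ev_eval_mult[of "psingle a c" "psingle b d"]
    by eventually_elim (simp add: eval_psingle powr_add)
qed

lemma puiseux_inverse_exists:
  fixes z :: puiseux
  assumes "z \<noteq> 0"
  shows "\<exists>y. y * z = 1"
proof -
  let ?a = "lead_exp z"
  define s where "s = psingle (- ?a) (1 / pcoeff z ?a)"
  define w where "w = 1 - s * z"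
  have nz: "pcoeff z ?a \<noteq> 0" using assms by (rule lead_exp_props)
  have ws: "w = s * (psingle ?a (pcoeff z ?a) - z)"
    using nz by (simp add: w_def s_def right_diff_distrib psingle_mult one_puiseux_def)
  obtain \<delta> where \<delta>: "\<delta> > 0" "\<And>\<alpha>. pcoeff z \<alpha> \<noteq> 0 \<Longrightarrow> \<alpha> < ?a \<Longrightarrow> \<alpha> \<le> ?a - \<delta>"
    using support_gap by blast
  have "\<gamma> \<le> - \<delta>" if "pcoeff w \<gamma> \<noteq> 0" for \<gamma>
  proof -
    from that obtain \<alpha> \<beta> where ab: "pcoeff s \<alpha> \<noteq> 0" "pcoeff (psingle ?a (pcoeff z ?a) - z) \<beta> \<noteq> 0" "\<gamma> = \<alpha> + \<beta>"
      unfolding ws by (rule pcoeff_mult_nonzero)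
    have "\<alpha> = - ?a" using ab(1) by (simp add: s_def pcoeff_psingle split: if_splits)
    moreover have "\<beta> \<noteq> ?a" "pcoeff z \<beta> \<noteq> 0" using ab(2) by (auto simp: pcoeff_psingle split: if_splits)
    moreover then have "\<beta> \<le> ?a - \<delta>" using lead_exp_props(2)[OF assms] \<delta>(2) by force
    ultimately show ?thesis using ab(3) by simp
  qed
  then obtain y where "y * (1 - w) = 1" using geometric_inverse[OF \<delta>(1)] by blast
  then have "(y * s) * z = 1" by (simp add: w_def mult.assoc)
  then show ?thesis ..
qed

instantiation puiseux :: linordered_field
begin

definition "inverse z = (if z = 0 then 0 else THE y. y * z = 1)" for z :: puiseux
definition "x div y = x * inverse y" for x y :: puiseux

instance
proof
  fix a b :: puiseux
  show "inverse a * a = 1" if a: "a \<noteq> 0"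
  proof -
    obtain y where y: "y * a = 1" using puiseux_inverse_exists[OF a] ..
    then have "inverse a = y" unfolding inverse_puiseux_def using a
      by (auto intro!: the_equality) (metis mult.assoc mult.commute mult.left_neutral)
    then show ?thesis using y by simp
  qed
  show "a div b = a * inverse b" by (rule divide_puiseux_def)
  show "inverse (0 :: puiseux) = 0" by (simp add: inverse_puiseux_def)
qed

end

section \<open>Valuation and evaluation\<close>

definition val :: "puiseux \<Rightarrow> ereal" where
  "val z = (if z = 0 then -\<infinity> else ereal (lead_exp z))"

definition val_vec :: "puiseux ^ 'n \<Rightarrow> ereal ^ 'n" where
  "val_vec x = (\<chi> i. val (x $ i))"

definition peval_vec :: "puiseux ^ 'n \<Rightarrow> real \<Rightarrow> real ^ 'n" where
  "peval_vec x t = (\<chi> i. peval (x $ i) t)"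

definition peval_mat :: "puiseux ^ 'n ^ 'm \<Rightarrow> real \<Rightarrow> real ^ 'n ^ 'm" where
  "peval_mat A t = (\<chi> i j. peval (A $ i $ j) t)"

definition polyhedron_of :: "'a::{semiring_1, ord} ^ 'n ^ 'm \<Rightarrow> 'a ^ 'm \<Rightarrow> ('a ^ 'n) set" where
  "polyhedron_of A b = {x. A *v x \<le> b}"


section \<open>Tropical geometry\<close>

text \<open>
  The tropical semifield is the set of extended reals other than \<open>\<infinity>\<close>. Tropical vectors are
  vectors of extended reals lying in \<open>trop_space\<close>, with the subspace topology.
\<close>

definition trop_space :: "(ereal ^ 'n) set" where
  "trop_space = {x. \<forall>i. x $ i \<noteq> \<infinity>}"

definition trop_inner :: "ereal ^ 'n \<Rightarrow> ereal ^ 'n \<Rightarrow> ereal" where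
  "trop_inner x y = (MAX i\<in>UNIV. x $ i + y $ i)"

definition trop_affine :: "ereal \<Rightarrow> ereal ^ 'n \<Rightarrow> ereal ^ 'n \<Rightarrow> ereal" where
  "trop_affine \<alpha>0 \<alpha> x = max \<alpha>0 (trop_inner \<alpha> x)"

definition tropical_polyhedron :: "(ereal ^ 'n) set \<Rightarrow> bool" where
  "tropical_polyhedron S \<longleftrightarrow>
    (\<exists>H. finite H \<and>
      (\<forall>(\<alpha>0, \<alpha>, \<beta>0, \<beta>)\<in>H. \<alpha>0 \<noteq> \<infinity> \<and> \<alpha> \<in> trop_space \<and> \<beta>0 \<noteq> \<infinity> \<and> \<beta> \<in> trop_space) \<and>
      S = {x \<in> trop_space. \<forall>(\<alpha>0, \<alpha>, \<beta>0, \<beta>)\<in>H. trop_affine \<alpha>0 \<alpha> x \<le> trop_affine \<beta>0 \<beta> x})"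

definition tropical_polytope :: "(ereal ^ 'n) set \<Rightarrow> bool" where
  "tropical_polytope S \<longleftrightarrow> tropical_polyhedron S \<and> compact S"

definition trop_regular :: "(ereal ^ 'n) set \<Rightarrow> bool" where
  "trop_regular S \<longleftrightarrow>
    top_of_set trop_space closure_of (top_of_set trop_space interior_of S) = S"

definition is_tropical_barycenter :: "(ereal ^ 'n) set \<Rightarrow> ereal ^ 'n \<Rightarrow> bool" where
  "is_tropical_barycenter S x \<longleftrightarrow> x \<in> S \<and> (\<forall>y\<in>S. y \<le> x)"

definition trop_log :: "real \<Rightarrow> real \<Rightarrow> ereal" where
  "trop_log t x = (if x = 0 then -\<infinity> else ereal (log t x))"

definition trop_log_vec :: "real \<Rightarrow> real ^ 'n \<Rightarrow> ereal ^ 'n" where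
  "trop_log_vec t x = (\<chi> i. trop_log t (x $ i))"


section \<open>The entropic central path\<close>

definition ln_ennreal :: "ennreal \<Rightarrow> ereal" where
  "ln_ennreal a = (if a = 0 then -\<infinity> else if a = \<infinity> then \<infinity> else ereal (ln (enn2real a)))"

text \<open>
  The integral may diverge, in which case \<open>log_partition P \<theta> = \<infinity>\<close> and \<open>\<theta>\<close> does not contribute to
  the supremum defining the conjugate.
\<close>

definition log_partition :: "(real ^ 'n) set \<Rightarrow> real ^ 'n \<Rightarrow> ereal" where
  "log_partition P \<theta> = ln_ennreal (\<integral>\<^sup>+x\<in>P. ennreal (exp (\<theta> \<bullet> x)) \<partial>lborel)"

definition fenchel_conjugate :: "(real ^ 'n \<Rightarrow> ereal) \<Rightarrow> real ^ 'n \<Rightarrow> ereal" where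
  "fenchel_conjugate f x = (SUP \<theta>. ereal (\<theta> \<bullet> x) - f \<theta>)"

definition entropic_barrier :: "(real ^ 'n) set \<Rightarrow> real ^ 'n \<Rightarrow> ereal" where
  "entropic_barrier P = fenchel_conjugate (log_partition P)"

definition entropic_objective ::
    "(real ^ 'n) set \<Rightarrow> real ^ 'n \<Rightarrow> real \<Rightarrow> real ^ 'n \<Rightarrow> ereal" where
  "entropic_objective P c \<mu> x = ereal (c \<bullet> x) + ereal \<mu> * entropic_barrier P x"

text \<open>
  The minimizer need not exist or be unique for arbitrary arguments, and the definite description
  is then unspecified.
\<close>

definition entropic_central_path :: "(real ^ 'n) set \<Rightarrow> real ^ 'n \<Rightarrow> real \<Rightarrow> real ^ 'n" where
  "entropic_central_path P c \<mu> = (THE x. x \<in> interior P \<and>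
    (\<forall>y\<in>interior P. entropic_objective P c \<mu> x \<le> entropic_objective P c \<mu> y))"

end

theory Submission
  imports Defs
begin

text \<open>
  The point of the central path with parameter \<open>\<mu>\<close> on a real polyhedron \<open>P\<close> is the mean of the
  probability measure on \<open>P\<close> with density proportional to \<open>exp (- \<langle>c, x\<rangle> / \<mu>)\<close>. This is duality:
  the conjugate of the log-partition function at that mean is attained at \<open>\<theta> = - c / \<mu>\<close>, so the mean
  minimizes the objective, and the first-order behaviour of the log-partition function at \<open>\<theta>\<close>
  excludes any other minimizer (\<open>entropic_central_path_eq_mean\<close>). It remains to find the order of
  magnitude in \<open>t\<close> of these means, and for that crude estimates of the integrals suffice, because
  constant factors, and even factors \<open>t powr \<epsilon>\<close>, are invisible to \<open>log\<^sub>t\<close> in the limit.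
  
  Let \<open>Q\<close> be the part of \<open>P\<close> where \<open>\<langle>c, x\<rangle> \<le> \<mu>\<close>. Over the Puiseux series, \<open>Q\<close> is the convex
  hull of finitely many points; let \<open>M\<close> be the sum of these points. Every point of \<open>Q\<close> is bounded
  by \<open>M\<close> and some multiple of \<open>M\<close> lies in \<open>Q\<close>, so that the valuation of \<open>M\<close> is the greatest element
  of the valuation of \<open>Q\<close>. Up to constant factors the constraint \<open>\<langle>c, x\<rangle> \<le> \<mu>\<close> and its tropical
  counterpart agree on nonnegative vectors, hence this is the required barycenter
  (\<open>val_truncation\<close>, \<open>truncation_tropical\<close>).
  
  Upper bounds. For large \<open>t\<close>, all points of \<open>Q(t)\<close> have \<open>x\<^sub>j \<le> M\<^sub>j(t)\<close>. Since \<open>P(t)\<close> is star-shaped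
  around \<open>0\<close>, all its points satisfy \<open>x\<^sub>j \<le> M\<^sub>j(t) (1 + \<langle>c, x\<rangle> / \<mu>)\<close>, and so the exponential weight is
  dominated by a product of one-dimensional exponentials on the scale of \<open>M(t)\<close>. Lower bounds. By
  regularity, arbitrarily close to the barycenter there is an interior point \<open>\<zeta>\<close> of the valuation
  of \<open>P\<close>, and it can be moved down a little so as to satisfy the constraint on \<open>c\<close> strictly. Then
  every row of the system holds at \<open>\<zeta>\<close> with a gap between the valuations of its positive and its
  negative part (\<open>row_gap\<close>), and consequently the whole box of real vectors between
  \<open>t powr \<zeta> / 2\<close> and \<open>t powr \<zeta>\<close> lies in \<open>P(t)\<close> for large \<open>t\<close>. Its volume bounds the integrals
  from below (\<open>mean_upper\<close>, \<open>mean_lower\<close>).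
  
  What is left is to pass from the ordered field of series to real numbers and to show that the
  valuation of \<open>Q\<close> is a tropical polytope. Both rest on one fact: the generators of a polyhedral
  cone are produced by a procedure that only looks at signs, so that evaluating the generators at a
  large \<open>t\<close> yields generators of the evaluated cone (\<open>polyhedral_cone_generators\<close>). The valuation
  of a finitely generated cone is described by a finite combination of conjunctions and
  disjunctions, which distributivity turns into finitely many tropical inequalities
  (\<open>val_cone_span\<close>, \<open>tropical_polyhedronI_cone\<close>).
\<close>

section \<open>Finitely generated cones over an ordered field\<close>

definition dot :: "('i::finite \<Rightarrow> 'a) \<Rightarrow> ('i \<Rightarrow> 'a) \<Rightarrow> 'a::semiring_0" where
  "dot a z = (\<Sum>i\<in>UNIV. a i * z i)"

definition cone_span :: "('i \<Rightarrow> 'a) set \<Rightarrow> ('i \<Rightarrow> 'a::linordered_field) set" where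
  "cone_span G = {z. \<exists>l. (\<forall>g\<in>G. 0 \<le> l g) \<and> z = (\<lambda>i. \<Sum>g\<in>G. l g * g i)}"

lemma cone_spanI:
  assumes "\<And>g. g \<in> G \<Longrightarrow> 0 \<le> l g"
  shows "(\<lambda>i. \<Sum>g\<in>G. l g * g i) \<in> cone_span G"
  using assms unfolding cone_span_def by blast

lemma cone_spanE:
  assumes "z \<in> cone_span G"
  obtains l where "\<And>g. g \<in> G \<Longrightarrow> 0 \<le> l g" "z = (\<lambda>i. \<Sum>g\<in>G. l g * g i)"
  using assms unfolding cone_span_def by blast

lemma cone_span_scale:
  assumes "z \<in> cone_span G" "0 \<le> r"
  shows "(\<lambda>i. r * z i) \<in> cone_span G"
proof -
  obtain l where l: "\<And>g. g \<in> G \<Longrightarrow> 0 \<le> l g" "z = (\<lambda>i. \<Sum>g\<in>G. l g * g i)"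
    using cone_spanE[OF assms(1)] by blast
  have "(\<lambda>i. r * z i) = (\<lambda>i. \<Sum>g\<in>G. (r * l g) * g i)"
    by (simp add: l(2) sum_distrib_left mult.assoc)
  then show ?thesis using cone_spanI[of G "\<lambda>g. r * l g"] l(1) assms(2) by simp
qed

lemma cone_span_add:
  assumes "y \<in> cone_span G" "z \<in> cone_span G"
  shows "(\<lambda>i. y i + z i) \<in> cone_span G"
proof -
  obtain k where k: "\<And>g. g \<in> G \<Longrightarrow> 0 \<le> k g" "y = (\<lambda>i. \<Sum>g\<in>G. k g * g i)"
    using cone_spanE[OF assms(1)] by blast
  obtain l where l: "\<And>g. g \<in> G \<Longrightarrow> 0 \<le> l g" "z = (\<lambda>i. \<Sum>g\<in>G. l g * g i)"
    using cone_spanE[OF assms(2)] by blast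
  have "(\<lambda>i. y i + z i) = (\<lambda>i. \<Sum>g\<in>G. (k g + l g) * g i)"
    by (simp add: k(2) l(2) sum.distrib distrib_right)
  then show ?thesis using cone_spanI[of G "\<lambda>g. k g + l g"] k(1) l(1) by simp
qed

lemma cone_span_zero: "(\<lambda>i. 0) \<in> cone_span G"
  using cone_spanI[of G "\<lambda>_. 0"] by simp

lemma cone_span_base:
  assumes "finite G" "g \<in> G"
  shows "g \<in> cone_span G"
proof -
  have "(\<Sum>h\<in>G. (if h = g then 1 else 0) * h i) = (\<Sum>h\<in>{g}. h i)" for i
    by (rule sum.mono_neutral_cong_right) (use assms in auto)
  then have "g = (\<lambda>i. \<Sum>h\<in>G. (if h = g then 1 else 0) * h i)" by (simp add: fun_eq_iff)
  also have "\<dots> \<in> cone_span G" by (rule cone_spanI) simp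
  finally show ?thesis .
qed

lemma cone_span_sum:
  assumes "\<And>k. k \<in> K \<Longrightarrow> f k \<in> cone_span G"
  shows "(\<lambda>i. \<Sum>k\<in>K. f k i) \<in> cone_span G"
  using assms
proof (induction K rule: infinite_finite_induct)
  case (insert x F)
  then show ?case using cone_span_add[of "f x" G "\<lambda>i. \<Sum>k\<in>F. f k i"] by simp
qed (simp_all add: cone_span_zero)

lemma dot_sum_right: "dot a (\<lambda>i. \<Sum>g\<in>G. l g * g i) = (\<Sum>g\<in>G. l g * dot a g)"
  for a :: "'i::finite \<Rightarrow> 'a::comm_semiring_0"
proof -
  have "dot a (\<lambda>i. \<Sum>g\<in>G. l g * g i) = (\<Sum>i\<in>UNIV. \<Sum>g\<in>G. l g * (a i * g i))"
    by (simp add: dot_def sum_distrib_left algebra_simps)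
  also have "\<dots> = (\<Sum>g\<in>G. l g * dot a g)"
    by (subst sum.swap) (simp add: dot_def sum_distrib_left)
  finally show ?thesis .
qed

text \<open>
  One step of the double description method: the generators on the right side of the hyperplane,
  together with the point at which the segment between two generators on opposite sides crosses it
  (up to a positive factor).
\<close>

definition halfspace_cut :: "('i::finite \<Rightarrow> 'a) \<Rightarrow> ('i \<Rightarrow> 'a) set \<Rightarrow> ('i \<Rightarrow> 'a::linordered_field) set" where
  "halfspace_cut a G = {g \<in> G. dot a g \<le> 0} \<union>
     (\<lambda>(g, h) i. dot a g * h i - dot a h * g i) ` ({g \<in> G. 0 < dot a g} \<times> {h \<in> G. dot a h < 0})"

lemma finite_halfspace_cut: "finite G \<Longrightarrow> finite (halfspace_cut a G)"
  by (simp add: halfspace_cut_def)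

lemma cone_span_subset:
  assumes "\<And>g. g \<in> H \<Longrightarrow> g \<in> cone_span G"
  shows "cone_span H \<subseteq> cone_span G"
proof
  fix z assume "z \<in> cone_span H"
  then obtain l where l: "\<And>g. g \<in> H \<Longrightarrow> 0 \<le> l g" "z = (\<lambda>i. \<Sum>g\<in>H. l g * g i)"
    by (rule cone_spanE) blast
  show "z \<in> cone_span G"
    unfolding l(2) by (rule cone_span_sum) (use assms l(1) cone_span_scale in blast)
qed

lemma halfspace_cut_nonpos:
  assumes "h \<in> halfspace_cut a G"
  shows "dot a h \<le> 0"
proof -
  have "dot a (\<lambda>i. dot a g * h i - dot a h * g i) = 0" for g h
  proof -
    have "dot a (\<lambda>i. dot a g * h i - dot a h * g i) = (\<Sum>i\<in>UNIV. dot a g * (a i * h i) - dot a h * (a i * g i))"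
      by (subst dot_def) (simp add: algebra_simps)
    also have "\<dots> = dot a g * dot a h - dot a h * dot a g"
      unfolding sum_subtractf sum_distrib_left[symmetric] by (simp add: dot_def)
    finally show ?thesis by simp
  qed
  then show ?thesis using assms by (auto simp: halfspace_cut_def)
qed

text \<open>
  If the negative part of a combination outweighs its positive part, each positive generator can be
  balanced by the negative ones in proportion to their weight. With \<open>P\<close> and \<open>N\<close> the weights of the
  two parts, what remains of the negative part after that is its fraction \<open>1 - P / N\<close>.
\<close>

lemma cone_span_halfspace_cut:
  fixes a :: "'i::finite \<Rightarrow> 'a::linordered_field"
  assumes fin: "finite G"
  shows "cone_span (halfspace_cut a G) = {z \<in> cone_span G. dot a z \<le> 0}"
proof (intro equalityI subsetI)
  fix z assume z: "z \<in> cone_span (halfspace_cut a G)"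
  have "h \<in> cone_span G" if "h \<in> halfspace_cut a G" for h
  proof (cases "h \<in> G")
    case True then show ?thesis by (rule cone_span_base[OF fin])
  next
    case False
    then obtain g k where gk: "g \<in> G" "k \<in> G" "0 < dot a g" "dot a k < 0"
      "h = (\<lambda>i. dot a g * k i - dot a k * g i)"
      using \<open>h \<in> halfspace_cut a G\<close> unfolding halfspace_cut_def by auto
    have "(\<lambda>i. dot a g * k i + (- dot a k) * g i) \<in> cone_span G"
      by (intro cone_span_add cone_span_scale cone_span_base fin gk) (use gk in auto)
    then show ?thesis using gk(5) by simp
  qed
  then have "z \<in> cone_span G" using cone_span_subset z by blast
  moreover obtain l where l: "\<And>g. g \<in> halfspace_cut a G \<Longrightarrow> 0 \<le> l g" "z = (\<lambda>i. \<Sum>g\<in>halfspace_cut a G. l g * g i)"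
    using cone_spanE[OF z] by blast
  have "dot a z \<le> 0"
    unfolding l(2) dot_sum_right by (intro sum_nonpos mult_nonneg_nonpos l halfspace_cut_nonpos)
  ultimately show "z \<in> {z \<in> cone_span G. dot a z \<le> 0}" by simp
next
  fix z assume "z \<in> {z \<in> cone_span G. dot a z \<le> 0}"
  then have z: "z \<in> cone_span G" and az: "dot a z \<le> 0" by auto
  obtain l where l: "\<And>g. g \<in> G \<Longrightarrow> 0 \<le> l g" "z = (\<lambda>i. \<Sum>g\<in>G. l g * g i)"
    using cone_spanE[OF z] by blast
  define Gp where "Gp = {g \<in> G. 0 < dot a g}"
  define Gm where "Gm = {g \<in> G. dot a g < 0}"
  define G0 where "G0 = {g \<in> G. dot a g = 0}"
  have G: "G = Gp \<union> Gm \<union> G0" by (auto simp: Gp_def Gm_def G0_def)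
  have fins: "finite Gp" "finite Gm" "finite G0"
    using fin by (auto simp: Gp_def Gm_def G0_def)
  have split: "(\<Sum>g\<in>G. f g) = (\<Sum>g\<in>Gp. f g) + (\<Sum>g\<in>Gm. f g) + (\<Sum>g\<in>G0. f g)"
    for f :: "('i \<Rightarrow> 'a) \<Rightarrow> 'a"
    unfolding G
    by (subst sum.union_disjoint, use fins in \<open>auto simp: Gp_def Gm_def G0_def\<close>)
       (subst sum.union_disjoint, auto simp: Gp_def Gm_def G0_def)
  define P where "P = (\<Sum>g\<in>Gp. l g * dot a g)"
  define N where "N = (\<Sum>g\<in>Gm. l g * (- dot a g))"
  have "dot a z = P - N"
    unfolding l(2) dot_sum_right unfolding split P_def N_def
    by (simp add: G0_def sum_negf)
  then have PN: "P \<le> N" using az by simp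
  have P0: "0 \<le> P" unfolding P_def by (intro sum_nonneg mult_nonneg_nonneg) (auto simp: Gp_def l(1))
  have finc: "finite (halfspace_cut a G)" by (rule finite_halfspace_cut[OF fin])
  have base: "g \<in> cone_span (halfspace_cut a G)" if "g \<in> Gm \<union> G0" for g
    by (rule cone_span_base[OF finc]) (use that in \<open>auto simp: halfspace_cut_def Gm_def G0_def\<close>)
  have comb: "(\<lambda>i. dot a g * h i - dot a h * g i) \<in> cone_span (halfspace_cut a G)" if "g \<in> Gp" "h \<in> Gm" for g h
    by (rule cone_span_base[OF finc]) (use that in \<open>auto simp: halfspace_cut_def Gm_def Gp_def intro!: image_eqI[where x = "(g, h)"]\<close>)
  have lp: "0 \<le> l g" if "g \<in> Gp \<union> Gm \<union> G0" for g using that l(1) G by auto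
  have s0: "(\<lambda>i. \<Sum>g\<in>G0. l g * g i) \<in> cone_span (halfspace_cut a G)"
    by (intro cone_span_sum cone_span_scale base) (auto simp: lp)
  show "z \<in> cone_span (halfspace_cut a G)"
  proof (cases "N = 0")
    case True
    then have "P = 0" using PN P0 by simp
    then have "\<forall>g\<in>Gp. l g * dot a g = 0"
      unfolding P_def using fins by (subst (asm) sum_nonneg_eq_0_iff) (auto simp: Gp_def l(1))
    then have "l g = 0" if "g \<in> Gp" for g using that by (auto simp: Gp_def)
    then have "z = (\<lambda>i. (\<Sum>g\<in>Gm. l g * g i) + (\<Sum>g\<in>G0. l g * g i))"
      unfolding l(2) split by simp
    moreover have "(\<lambda>i. \<Sum>g\<in>Gm. l g * g i) \<in> cone_span (halfspace_cut a G)"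
      by (intro cone_span_sum cone_span_scale base) (auto simp: lp)
    ultimately show ?thesis using cone_span_add s0 by force
  next
    case False
    then have N: "N > 0" using PN P0 by simp
    \<comment> \<open>The multiplier of each crossing point is chosen so that the sum over \<open>h\<close> reproduces \<open>l g * g\<close>.\<close>
    define A where "A = (\<lambda>i. \<Sum>g\<in>Gp. \<Sum>h\<in>Gm. (l g * l h / N) * (dot a g * h i - dot a h * g i))"
    define B where "B = (\<lambda>i. \<Sum>h\<in>Gm. ((1 - P / N) * l h) * h i)"
    have "A \<in> cone_span (halfspace_cut a G)"
      unfolding A_def by (intro cone_span_sum cone_span_scale comb) (use N lp in auto)
    moreover have "B \<in> cone_span (halfspace_cut a G)"
      unfolding B_def by (intro cone_span_sum cone_span_scale base) (use N PN lp in \<open>auto simp: field_simps intro!: mult_right_mono\<close>)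
    moreover have "z = (\<lambda>i. (A i + B i) + (\<Sum>g\<in>G0. l g * g i))"
    proof
      fix i
      have "A i = (\<Sum>g\<in>Gp. \<Sum>h\<in>Gm. (l g * dot a g) * (l h * h i) / N + (l h * (- dot a h)) * (l g * g i) / N)"
        unfolding A_def
        by (intro sum.cong refl) (simp add: diff_divide_distrib algebra_simps)
      also have "\<dots> = (\<Sum>g\<in>Gp. \<Sum>h\<in>Gm. (l g * dot a g) * (l h * h i)) / N
          + (\<Sum>h\<in>Gm. \<Sum>g\<in>Gp. (l h * (- dot a h)) * (l g * g i)) / N"
        by (simp only: sum.distrib sum_divide_distrib[symmetric]) (subst (2) sum.swap, simp)
      also have "\<dots> = P * (\<Sum>h\<in>Gm. l h * h i) / N + N * (\<Sum>g\<in>Gp. l g * g i) / N"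
        by (simp only: P_def N_def sum_product)
      finally have "A i = P / N * (\<Sum>h\<in>Gm. l h * h i) + (\<Sum>g\<in>Gp. l g * g i)" using N by simp
      moreover have "B i = (1 - P / N) * (\<Sum>h\<in>Gm. l h * h i)"
        by (simp add: B_def sum_distrib_left mult.assoc)
      ultimately have "A i + B i = (\<Sum>g\<in>Gp. l g * g i) + (\<Sum>h\<in>Gm. l h * h i)" by (simp add: algebra_simps)
      then show "z i = (A i + B i) + (\<Sum>g\<in>G0. l g * g i)" unfolding l(2) split by simp
    qed
    ultimately show ?thesis by (simp only: cone_span_add s0)
  qed
qed

definition unit_fun :: "'i \<Rightarrow> 'i \<Rightarrow> 'a::zero_neq_one" where
  "unit_fun i = (\<lambda>j. if j = i then 1 else 0)"

lemma cone_span_units: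
  "cone_span (range unit_fun \<union> (\<lambda>i j. - unit_fun i j) ` UNIV) = (UNIV :: ('i::finite \<Rightarrow> 'a::linordered_field) set)"
proof (intro equalityI subsetI)
  fix z :: "'i \<Rightarrow> 'a"
  let ?G = "range unit_fun \<union> (\<lambda>i j. - unit_fun i j) ` (UNIV :: 'i set) :: ('i \<Rightarrow> 'a) set"
  have "(\<lambda>j. \<Sum>i\<in>UNIV. max (z i) 0 * unit_fun i j + max (- z i) 0 * - unit_fun i j) \<in> cone_span ?G"
    by (intro cone_span_sum cone_span_add cone_span_scale cone_span_base) auto
  moreover have "(\<Sum>i\<in>UNIV. max (z i) 0 * unit_fun i j + max (- z i) 0 * - unit_fun i j) = z j" for j
  proof -
    have "(\<Sum>i\<in>UNIV. max (z i) 0 * unit_fun i j + max (- z i) 0 * - unit_fun i j) =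
       (\<Sum>i\<in>UNIV. if i = j then z i else 0)"
      by (intro sum.cong refl) (auto simp: unit_fun_def max_def)
    then show ?thesis by simp
  qed
  ultimately show "z \<in> cone_span ?G" by simp
qed simp

section \<open>Evaluation of polyhedral cones\<close>

definition peval_fun :: "real \<Rightarrow> ('i \<Rightarrow> puiseux) \<Rightarrow> 'i \<Rightarrow> real" where
  "peval_fun t z = (\<lambda>i. peval (z i) t)"

lemma ev_eval_sum:
  "\<forall>\<^sub>F t in at_top. peval (\<Sum>k\<in>K. f k) t = (\<Sum>k\<in>K. peval (f k) t)"
proof (induction K rule: infinite_finite_induct)
  case (insert x F)
  from insert.IH ev_eval_add[of "f x" "\<Sum>k\<in>F. f k"] show ?case
    unfolding sum.insert[OF insert.hyps(1,2)] by eventually_elim simp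
qed simp_all

lemma ev_eval_dot: "\<forall>\<^sub>F t in at_top. peval (dot a z) t = dot (peval_fun t a) (peval_fun t z)"
proof -
  have "\<forall>\<^sub>F t in at_top. \<forall>i. peval (a i * z i) t = peval (a i) t * peval (z i) t"
    by (intro eventually_all_finite ev_eval_mult)
  with ev_eval_sum[of "\<lambda>i. a i * z i" UNIV] show ?thesis
    by eventually_elim (simp add: dot_def peval_fun_def)
qed

lemma ev_sgn: "\<forall>\<^sub>F t in at_top. sgn (peval z t) = (if z = 0 then 0 else if 0 < z then 1 else - 1)"
proof -
  consider "z = 0" | "0 < z" | "z < 0" by (rule linorder_cases) auto
  then show ?thesis
  proof cases
    case 2
    then have "\<forall>\<^sub>F t in at_top. 0 < peval z t" by (simp add: puiseux_less_iff)
    then show ?thesis by eventually_elim (use 2 in simp)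
  next
    case 3
    then have "\<forall>\<^sub>F t in at_top. peval z t < 0" by (simp add: puiseux_less_iff)
    then show ?thesis by eventually_elim (use 3 in simp)
  qed simp
qed

lemma ev_sign_iff:
  "\<forall>\<^sub>F t in at_top. (peval z t \<le> 0 \<longleftrightarrow> z \<le> 0) \<and> (0 < peval z t \<longleftrightarrow> 0 < z) \<and> (peval z t < 0 \<longleftrightarrow> z < 0)"
  using ev_sgn[of z]
proof eventually_elim
  case (elim t)
  then show ?case
    by (cases z "0 :: puiseux" rule: linorder_cases) (auto simp: sgn_if split: if_splits)
qed

text \<open>
  Finitely many sign decisions and field operations determine the new generators, and evaluation
  at a large \<open>t\<close> respects all of them.
\<close>

lemma ev_halfspace_cut:
  assumes "finite G"
  shows "\<forall>\<^sub>F t in at_top. peval_fun t ` halfspace_cut a G = halfspace_cut (peval_fun t a) (peval_fun t ` G)"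
proof -
  have "\<forall>\<^sub>F t in at_top. \<forall>g\<in>G. peval (dot a g) t = dot (peval_fun t a) (peval_fun t g)"
    using assms by (intro eventually_ball_finite ballI ev_eval_dot)
  moreover have "\<forall>\<^sub>F t in at_top. \<forall>g\<in>G. (peval (dot a g) t \<le> 0 \<longleftrightarrow> dot a g \<le> 0) \<and>
      (0 < peval (dot a g) t \<longleftrightarrow> 0 < dot a g) \<and> (peval (dot a g) t < 0 \<longleftrightarrow> dot a g < 0)"
    using assms by (intro eventually_ball_finite ballI ev_sign_iff)
  moreover have "\<forall>\<^sub>F t in at_top. \<forall>g\<in>G. \<forall>h\<in>G. \<forall>i. peval (dot a g * h i - dot a h * g i) t =
      peval (dot a g) t * peval (h i) t - peval (dot a h) t * peval (g i) t"
  proof (intro eventually_ball_finite ballI eventually_all_finite assms)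
    fix g h i
    show "\<forall>\<^sub>F t in at_top. peval (dot a g * h i - dot a h * g i) t =
      peval (dot a g) t * peval (h i) t - peval (dot a h) t * peval (g i) t"
      using ev_eval_diff[of "dot a g * h i" "dot a h * g i"] ev_eval_mult[of "dot a g" "h i"]
        ev_eval_mult[of "dot a h" "g i"]
      by eventually_elim simp
  qed
  ultimately show ?thesis
  proof eventually_elim
    case (elim t)
    note e = elim(1)[rule_format] and s = elim(2)[rule_format] and m = elim(3)[rule_format]
    have 1: "peval_fun t ` {g \<in> G. dot a g \<le> 0} = {g \<in> peval_fun t ` G. dot (peval_fun t a) g \<le> 0}"
      using e s by force
    have 2: "peval_fun t ` {g \<in> G. 0 < dot a g} = {g \<in> peval_fun t ` G. 0 < dot (peval_fun t a) g}"
      using e s by force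
    have 3: "peval_fun t ` {g \<in> G. dot a g < 0} = {g \<in> peval_fun t ` G. dot (peval_fun t a) g < 0}"
      using e s by force
    have 4: "peval_fun t (\<lambda>i. dot a g * h i - dot a h * g i) =
        (\<lambda>i. dot (peval_fun t a) (peval_fun t g) * peval_fun t h i - dot (peval_fun t a) (peval_fun t h) * peval_fun t g i)"
      if "g \<in> G" "h \<in> G" for g h
      using m[OF that] e that unfolding peval_fun_def by simp
    have 5: "peval_fun t ` (\<lambda>(g, h) i. dot a g * h i - dot a h * g i) ` ({g \<in> G. 0 < dot a g} \<times> {h \<in> G. dot a h < 0})
       = (\<lambda>(g, h) i. dot (peval_fun t a) g * h i - dot (peval_fun t a) h * g i) `
          ((peval_fun t ` {g \<in> G. 0 < dot a g}) \<times> (peval_fun t ` {h \<in> G. dot a h < 0}))"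
      unfolding map_prod_surj_on[OF refl refl, symmetric] image_image
      by (rule image_cong) (use 4 in auto)
    show ?case unfolding halfspace_cut_def image_Un 5 1 2 3 ..
  qed
qed

lemma ev_units:
  "\<forall>\<^sub>F t in at_top. peval_fun t ` (range unit_fun \<union> (\<lambda>i j. - unit_fun i j) ` UNIV) =
     (range unit_fun \<union> (\<lambda>i j. - unit_fun i j) ` UNIV :: ('i::finite \<Rightarrow> real) set)"
  using ev_eval_1
proof eventually_elim
  case (elim t)
  have "peval_fun t (unit_fun i) = unit_fun i" "peval_fun t (\<lambda>j. - unit_fun i j) = (\<lambda>j. - unit_fun i j)" for i :: 'i
    using elim by (auto simp: peval_fun_def unit_fun_def fun_eq_iff eval_uminus)
  then show ?case by (simp add: image_Un image_image)
qed

text \<open>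
  This is a transfer principle for linear systems: a consequence of the system that can be read off
  its generators holds for the series if and only if it holds after evaluation at all large \<open>t\<close>.
\<close>

theorem polyhedral_cone_generators:
  fixes R :: "('a::finite \<Rightarrow> puiseux) set"
  assumes "finite R"
  obtains G where "finite G" "cone_span G = {z. \<forall>a\<in>R. dot a z \<le> 0}"
    "\<forall>\<^sub>F t in at_top. cone_span (peval_fun t ` G) = {z. \<forall>a\<in>R. dot (peval_fun t a) z \<le> 0}"
proof -
  have "\<exists>G. finite G \<and> cone_span G = {z. \<forall>a\<in>R. dot a z \<le> 0} \<and>
    (\<forall>\<^sub>F t in at_top. cone_span (peval_fun t ` G) = {z. \<forall>a\<in>R. dot (peval_fun t a) z \<le> 0})"
    using assms
  proof induction
    case empty
    let ?U = "range unit_fun \<union> (\<lambda>i j. - unit_fun i j) ` UNIV :: ('a \<Rightarrow> puiseux) set"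
    have "\<forall>\<^sub>F t in at_top. cone_span (peval_fun t ` ?U) = UNIV"
      using ev_units[where 'i = 'a] by eventually_elim (simp only: cone_span_units)
    then show ?case
      by (intro exI[of _ ?U]) (simp add: cone_span_units)
  next
    case (insert a R)
    then obtain G where G: "finite G" "cone_span G = {z. \<forall>a\<in>R. dot a z \<le> 0}"
      and ev: "\<forall>\<^sub>F t in at_top. cone_span (peval_fun t ` G) = {z. \<forall>a\<in>R. dot (peval_fun t a) z \<le> 0}"
      by blast
    have "\<forall>\<^sub>F t in at_top. cone_span (peval_fun t ` halfspace_cut a G) = {z. \<forall>b\<in>insert a R. dot (peval_fun t b) z \<le> 0}"
      using ev ev_halfspace_cut[OF G(1), of a]
      by eventually_elim (use G(1) in \<open>auto simp: cone_span_halfspace_cut\<close>)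
    moreover have "cone_span (halfspace_cut a G) = {z. \<forall>b\<in>insert a R. dot b z \<le> 0}"
      using G by (auto simp: cone_span_halfspace_cut)
    ultimately show ?case using finite_halfspace_cut[OF G(1), of a] by blast
  qed
  then show thesis using that by blast
qed

section \<open>Valuation and order of growth\<close>

lemma lim_log_peval:
  assumes "z \<noteq> 0"
  shows "((\<lambda>t. log t \<bar>peval z t\<bar>) \<longlongrightarrow> lead_exp z) at_top"
proof -
  let ?a = "lead_exp z" and ?c = "pcoeff z (lead_exp z)"
  have c: "?c \<noteq> 0" using assms by (rule lead_exp_props)
  have lim: "((\<lambda>t. ln \<bar>peval z t / t powr ?a\<bar>) \<longlongrightarrow> ln \<bar>?c\<bar>) at_top"
    by (intro tendsto_ln tendsto_rabs eval_asymp) (use c in simp)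
  have ne: "\<forall>\<^sub>F t in at_top. peval z t / t powr ?a \<noteq> 0"
    using tendsto_imp_eventually_ne[OF eval_asymp c] .
  have "((\<lambda>t. ln \<bar>peval z t / t powr ?a\<bar> / ln t) \<longlongrightarrow> 0) at_top"
    using lim ln_at_top by (rule tendsto_divide_0[OF _ filterlim_at_top_imp_at_infinity])
  then have "((\<lambda>t. ?a + ln \<bar>peval z t / t powr ?a\<bar> / ln t) \<longlongrightarrow> ?a + 0) at_top"
    by (intro tendsto_add tendsto_const)
  moreover have "\<forall>\<^sub>F t in at_top. ?a + ln \<bar>peval z t / t powr ?a\<bar> / ln t = log t \<bar>peval z t\<bar>"
    using ne eventually_gt_at_top[of 1]
  proof eventually_elim
    case (elim t)
    then have "ln \<bar>peval z t / t powr ?a\<bar> = ln \<bar>peval z t\<bar> - ?a * ln t"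
      by (simp add: abs_divide ln_div ln_powr)
    then show ?case using elim by (simp add: log_def field_simps)
  qed
  ultimately show ?thesis by (simp add: tendsto_cong)
qed

lemma val_0 [simp]: "val 0 = -\<infinity>" by (simp add: val_def)
lemma val_eq_MInf [simp]: "val z = -\<infinity> \<longleftrightarrow> z = 0" by (simp add: val_def)
lemma val_not_PInf [simp]: "val z \<noteq> \<infinity>" by (simp add: val_def)
lemma val_nonzero: "z \<noteq> 0 \<Longrightarrow> val z = ereal (lead_exp z)" by (simp add: val_def)

lemma lead_exp_psingle: "c \<noteq> 0 \<Longrightarrow> lead_exp (psingle a c) = a"
  by (rule lead_exp_eqI) (auto simp: pcoeff_psingle split: if_splits)

lemma psingle_pos: "0 < psingle a c \<longleftrightarrow> 0 < c"
proof -
  have "0 < psingle a c \<longleftrightarrow> (\<forall>\<^sub>F t :: real in at_top. 0 < c)"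
    unfolding puiseux_less_iff
    by (rule eventually_cong[OF eventually_gt_at_top[of 0]]) (simp add: eval_psingle zero_less_mult_iff)
  then show ?thesis by simp
qed

lemma val_psingle: "0 < c \<Longrightarrow> val (psingle a c) = ereal a"
  using psingle_pos[of a c] by (subst val_nonzero) (auto simp: lead_exp_psingle)

lemma val_mult: "val (x * y) = val x + val y"
proof (cases "x = 0 \<or> y = 0")
  case True
  then show ?thesis by (cases "val x"; cases "val y") auto
next
  case False
  have "((\<lambda>t. log t \<bar>peval x t\<bar> + log t \<bar>peval y t\<bar>) \<longlongrightarrow> lead_exp x + lead_exp y) at_top"
    using False by (intro tendsto_add lim_log_peval) auto
  moreover have "\<forall>\<^sub>F t in at_top. log t \<bar>peval x t\<bar> + log t \<bar>peval y t\<bar> = log t \<bar>peval (x * y) t\<bar>"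
    using ev_eval_mult[of x y] ev_sgn[of x] ev_sgn[of y] eventually_gt_at_top[of 1]
  proof eventually_elim
    case (elim t)
    have "peval x t \<noteq> 0" "peval y t \<noteq> 0"
      using elim(2,3) False by (auto simp: sgn_if split: if_splits)
    then show ?case using elim by (simp add: abs_mult log_mult)
  qed
  ultimately have "((\<lambda>t. log t \<bar>peval (x * y) t\<bar>) \<longlongrightarrow> lead_exp x + lead_exp y) at_top"
    by (simp add: tendsto_cong)
  moreover have "((\<lambda>t. log t \<bar>peval (x * y) t\<bar>) \<longlongrightarrow> lead_exp (x * y)) at_top"
    using False by (intro lim_log_peval) auto
  ultimately have "lead_exp (x * y) = lead_exp x + lead_exp y"
    using tendsto_unique[OF trivial_limit_at_top_linorder] by blast
  then show ?thesis using False by (simp add: val_nonzero)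
qed

lemma val_mono:
  assumes "0 \<le> x" "x \<le> y"
  shows "val x \<le> val y"
proof (cases "x = 0")
  case False
  then have pos: "0 < x" "0 < y" using assms by auto
  have "lead_exp x \<le> lead_exp y"
  proof (rule tendsto_le[OF trivial_limit_at_top_linorder])
    show "((\<lambda>t. log t \<bar>peval y t\<bar>) \<longlongrightarrow> lead_exp y) at_top" "((\<lambda>t. log t \<bar>peval x t\<bar>) \<longlongrightarrow> lead_exp x) at_top"
      using pos by (auto intro!: lim_log_peval)
    have "\<forall>\<^sub>F t in at_top. 0 < peval x t" "\<forall>\<^sub>F t in at_top. peval x t \<le> peval y t"
      using pos(1) assms(2) by (auto simp: puiseux_less_iff puiseux_le_iff)
    then show "\<forall>\<^sub>F t in at_top. log t \<bar>peval x t\<bar> \<le> log t \<bar>peval y t\<bar>"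
      using eventually_gt_at_top[of 1] by eventually_elim simp
  qed
  then show ?thesis using pos by (simp add: val_nonzero)
qed simp

lemma val_1 [simp]: "val 1 = 0"
  unfolding one_puiseux_def by (subst val_psingle) auto

lemma two_puiseux: "(2 :: puiseux) = psingle 0 2"
proof -
  have "(2 :: puiseux) = 1 + 1" by simp
  also have "\<dots> = psingle 0 2" unfolding one_puiseux_def by (rule puiseux_eqI) (simp only: pcoeff_add pcoeff_psingle, simp)
  finally show ?thesis .
qed

lemma val_add_nonneg:
  assumes "0 \<le> x" "0 \<le> y"
  shows "val (x + y) = max (val x) (val y)"
proof (rule antisym)
  have "val (x + y) \<le> val (2 * max x y)"
    using assms by (intro val_mono) (auto simp: max_def)
  also have "\<dots> = val (max x y)" by (simp add: val_mult two_puiseux val_psingle)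
  also have "\<dots> \<le> max (val x) (val y)" by (cases "x \<le> y") (simp_all add: max_absorb1 max_absorb2)
  finally show "val (x + y) \<le> max (val x) (val y)" .
  show "max (val x) (val y) \<le> val (x + y)"
    using assms by (intro max.boundedI val_mono) auto
qed

lemma val_sum_nonneg:
  assumes "finite K" "\<And>k. k \<in> K \<Longrightarrow> 0 \<le> f k"
  shows "val (\<Sum>k\<in>K. f k) = (SUP k\<in>K. val (f k))"
  using assms
proof (induction K)
  case (insert k K)
  then show ?case by (simp add: val_add_nonneg sum_nonneg sup_max)
qed (simp add: bot_ereal_def)

lemma ev_peval_less_powr:
  assumes "0 \<le> z" "val z < ereal R"
  shows "\<forall>\<^sub>F t in at_top. peval z t < t powr R"
proof (cases "z = 0")
  case True
  show ?thesis by (rule eventually_mono[OF eventually_gt_at_top[of 0]]) (simp add: True)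
next
  case False
  then have "0 < z" using assms by simp
  then have "\<forall>\<^sub>F t in at_top. 0 < peval z t" by (simp add: puiseux_less_iff)
  moreover have "\<forall>\<^sub>F t in at_top. log t \<bar>peval z t\<bar> < R"
    using assms False by (intro order_tendstoD(2)[OF lim_log_peval]) (auto simp: val_nonzero)
  ultimately show ?thesis using eventually_gt_at_top[of 1]
    by eventually_elim (simp add: log_less_iff)
qed

lemma ev_powr_less_peval:
  assumes "0 \<le> z" "ereal r < val z"
  shows "\<forall>\<^sub>F t in at_top. t powr r < peval z t"
proof -
  have "0 < z" using assms by (cases "z = 0") auto
  then have "\<forall>\<^sub>F t in at_top. 0 < peval z t" by (simp add: puiseux_less_iff)
  moreover have "\<forall>\<^sub>F t in at_top. r < log t \<bar>peval z t\<bar>"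
    using assms \<open>0 < z\<close> by (intro order_tendstoD(1)[OF lim_log_peval]) (auto simp: val_nonzero)
  ultimately show ?thesis using eventually_gt_at_top[of 1]
    by eventually_elim (simp add: less_log_iff)
qed

section \<open>Generators of the truncated polyhedron\<close>

text \<open>
  The coordinate \<open>None\<close> is the homogenizing one.
\<close>

definition homogenize :: "'a ^ 'n \<Rightarrow> 'a \<Rightarrow> 'n option \<Rightarrow> 'a" where
  "homogenize x s i = (case i of None \<Rightarrow> s | Some j \<Rightarrow> x $ j)"

lemma homogenize_simps [simp]: "homogenize x s None = s" "homogenize x s (Some j) = x $ j"
  by (simp_all add: homogenize_def)

lemma homogenize_eta: "homogenize (\<chi> j. z (Some j)) (z None) = z"
  by (rule ext) (auto simp: homogenize_def split: option.split)

lemma sum_option: "(\<Sum>i\<in>(UNIV :: 'n::finite option set). f i) = f None + (\<Sum>j\<in>UNIV. f (Some j))"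
  by (simp add: UNIV_option_conv sum.reindex)

lemma dot_homogenize: "dot (homogenize a r) (homogenize x s) = r * s + (\<Sum>j\<in>UNIV. a $ j * x $ j)"
  by (simp add: dot_def sum_option)

definition truncation :: "'a::linordered_field ^ 'n ^ 'm \<Rightarrow> 'a ^ 'm \<Rightarrow> 'a ^ 'n \<Rightarrow> 'a \<Rightarrow> ('a ^ 'n) set" where
  "truncation A b c \<mu> = {x \<in> polyhedron_of A b. (\<Sum>j\<in>UNIV. c $ j * x $ j) \<le> \<mu>}"

definition truncation_rows :: "'a::linordered_field ^ 'n ^ 'm \<Rightarrow> 'a ^ 'm \<Rightarrow> 'a ^ 'n \<Rightarrow> 'a \<Rightarrow> ('n option \<Rightarrow> 'a) set" where
  "truncation_rows A b c \<mu> =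
     range (\<lambda>k. homogenize (A $ k) (- b $ k)) \<union> {homogenize c (- \<mu>), homogenize 0 (- 1)}"

lemma truncation_rows_iff:
  "(\<forall>a\<in>truncation_rows A b c \<mu>. dot a (homogenize x s) \<le> 0) \<longleftrightarrow>
    0 \<le> s \<and> A *v x \<le> (\<chi> k. s * b $ k) \<and> (\<Sum>j\<in>UNIV. c $ j * x $ j) \<le> s * \<mu>"
  by (auto simp: truncation_rows_def dot_homogenize less_eq_vec_def matrix_vector_mult_def algebra_simps)

lemma truncation_iff:
  "x \<in> truncation A b c \<mu> \<longleftrightarrow> (\<forall>a\<in>truncation_rows A b c \<mu>. dot a (homogenize x 1) \<le> 0)"
  unfolding truncation_rows_iff by (simp add: truncation_def polyhedron_of_def)

lemma ev_truncation_rows: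
  fixes c :: "puiseux ^ 'n"
  shows "\<forall>\<^sub>F t in at_top. peval_fun t ` truncation_rows A b c \<mu> =
     truncation_rows (peval_mat A t) (peval_vec b t) (peval_vec c t) (peval \<mu> t)"
  using ev_eval_1
proof eventually_elim
  case (elim t)
  have "peval_fun t (homogenize x s) = homogenize (peval_vec x t) (peval s t)" for x :: "puiseux ^ 'n" and s
    by (auto simp: fun_eq_iff peval_fun_def peval_vec_def homogenize_def split: option.split)
  moreover have "peval_vec (0 :: puiseux ^ 'n) t = 0" by (simp add: peval_vec_def vec_eq_iff)
  ultimately show ?case
    using elim by (simp add: truncation_rows_def image_Un image_image eval_uminus peval_mat_def peval_vec_def)
qed

lemma matrix_vector_scale: "A *v (\<chi> j. r * x $ j) = (\<chi> k. r * (A *v x) $ k)"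
  for A :: "'a::comm_ring_1 ^ 'n ^ 'm"
  by (simp add: matrix_vector_mult_def vec_eq_iff sum_distrib_left algebra_simps)

text \<open>
  The truncated polyhedron is bounded, as \<open>c\<close> is positive and all coordinates are nonnegative. Hence
  its homogenization has no generators at infinity, other than possibly \<open>0\<close>.
\<close>

lemma truncation_generators:
  fixes A :: "puiseux ^ 'n ^ 'm"
  assumes nn: "polyhedron_of A b \<subseteq> {x. \<forall>i. 0 \<le> x $ i}" and z: "0 \<in> polyhedron_of A b"
    and c: "\<forall>i. 0 < c $ i"
  obtains G where "finite G" "\<forall>g\<in>G. \<forall>i. 0 \<le> g i" "\<forall>g\<in>G. g None = 0 \<longrightarrow> (\<forall>i. g i = 0)"
    "\<And>x. x \<in> truncation A b c \<mu> \<longleftrightarrow> homogenize x 1 \<in> cone_span G"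
    "\<forall>\<^sub>F t in at_top. \<forall>x. x \<in> truncation (peval_mat A t) (peval_vec b t) (peval_vec c t) (peval \<mu> t)
        \<longleftrightarrow> homogenize x 1 \<in> cone_span (peval_fun t ` G)"
proof -
  have "finite (truncation_rows A b c \<mu>)" by (simp add: truncation_rows_def)
  then obtain G where G: "finite G" "cone_span G = {z. \<forall>a\<in>truncation_rows A b c \<mu>. dot a z \<le> 0}"
    and ev: "\<forall>\<^sub>F t in at_top. cone_span (peval_fun t ` G) = {z. \<forall>a\<in>truncation_rows A b c \<mu>. dot (peval_fun t a) z \<le> 0}"
    by (rule polyhedral_cone_generators) blast
  have b0: "0 \<le> b $ k" for k
    using z by (simp add: polyhedron_of_def less_eq_vec_def)
  have gen: "0 \<le> g i \<and> (g None = 0 \<longrightarrow> g i = 0)" if g: "g \<in> G" for g i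
  proof -
    define x where "x = (\<chi> j. g (Some j))"
    define s where "s = g None"
    have hg: "homogenize x s = g" unfolding x_def s_def by (rule homogenize_eta)
    have "g \<in> cone_span G" by (rule cone_span_base[OF G(1) g])
    then have "\<forall>a\<in>truncation_rows A b c \<mu>. dot a (homogenize x s) \<le> 0" unfolding G(2) hg by simp
    then have r: "0 \<le> s" "A *v x \<le> (\<chi> k. s * b $ k)" "(\<Sum>j\<in>UNIV. c $ j * x $ j) \<le> s * \<mu>"
      unfolding truncation_rows_iff by auto
    have x: "(\<forall>j. 0 \<le> x $ j) \<and> (s = 0 \<longrightarrow> (\<forall>j. x $ j = 0))"
    proof (cases "s = 0")
      case False
      then have s: "s > 0" using r(1) by simp
      have "(\<chi> j. inverse s * x $ j) \<in> polyhedron_of A b"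
        unfolding polyhedron_of_def mem_Collect_eq matrix_vector_scale less_eq_vec_def
      proof
        fix k
        have "(A *v x) $ k \<le> s * b $ k" using r(2) by (simp add: less_eq_vec_def)
        then have "inverse s * (A *v x) $ k \<le> inverse s * (s * b $ k)"
          using s by (intro mult_left_mono) auto
        moreover have "inverse s * (s * b $ k) = b $ k" using s by simp
        ultimately show "(\<chi> k. inverse s * (A *v x) $ k) $ k \<le> b $ k" by (simp only: vec_lambda_beta)
      qed
      then have "\<forall>j. 0 \<le> inverse s * x $ j" using nn by auto
      then show ?thesis using s by (auto simp: zero_le_mult_iff)
    next
      case True
      then have "(A *v x) $ k \<le> 0" for k using r(2) by (simp add: less_eq_vec_def)
      then have "x \<in> polyhedron_of A b"
        using b0 by (auto simp: polyhedron_of_def less_eq_vec_def intro: order_trans)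
      then have x0: "0 \<le> x $ j" for j using nn by auto
      then have "(\<Sum>j\<in>UNIV. c $ j * x $ j) = 0"
        using r(3) True c by (intro antisym sum_nonneg mult_nonneg_nonneg) (auto simp: less_imp_le)
      then have "\<forall>j\<in>UNIV. c $ j * x $ j = 0"
        using x0 c by (subst (asm) sum_nonneg_eq_0_iff) (auto simp: less_imp_le)
      then show ?thesis using x0 c by (metis UNIV_I mult_eq_0_iff order_less_irrefl)
    qed
    have "g i = homogenize x s i" using hg by simp
    then show ?thesis using x r(1) by (cases i) (auto simp: s_def)
  qed
  show thesis
  proof (rule that[OF G(1)])
    show "\<forall>\<^sub>F t in at_top. \<forall>x. x \<in> truncation (peval_mat A t) (peval_vec b t) (peval_vec c t) (peval \<mu> t)
        \<longleftrightarrow> homogenize x 1 \<in> cone_span (peval_fun t ` G)"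
      using ev ev_truncation_rows[of A b c \<mu>]
    proof eventually_elim
      case (elim t)
      show ?case by (simp add: truncation_iff elim(1) flip: elim(2))
    qed
  qed (use gen G(2) in \<open>auto simp: truncation_iff\<close>)
qed

text \<open>
  The generators with \<open>g None \<noteq> 0\<close>, scaled to \<open>g None = 1\<close>, are points whose convex hull is the
  polyhedron. Their sum bounds it from above, and is preferable to their maximum because evaluation
  commutes with sums. Generators with \<open>g None = 0\<close> contribute nothing to the sum since \<open>x / 0 = 0\<close>.
\<close>

lemma cone_span_vertex_bound:
  fixes G :: "('n::finite option \<Rightarrow> 'a::linordered_field) set"
  assumes fin: "finite G" and nn: "\<forall>g\<in>G. \<forall>i. 0 \<le> g i"
    and nz: "\<forall>g\<in>G. g None = 0 \<longrightarrow> (\<forall>i. g i = 0)"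
    and x: "homogenize x 1 \<in> cone_span G"
  shows "0 \<le> x $ j" "x $ j \<le> (\<Sum>g\<in>G. g (Some j) / g None)"
proof -
  obtain l where l: "\<And>g. g \<in> G \<Longrightarrow> 0 \<le> l g" "homogenize x 1 = (\<lambda>i. \<Sum>g\<in>G. l g * g i)"
    using cone_spanE[OF x] by blast
  have xj: "x $ j = (\<Sum>g\<in>G. l g * g (Some j))" using fun_cong[OF l(2), of "Some j"] by simp
  then show "0 \<le> x $ j" using l(1) nn by (simp add: sum_nonneg)
  have one: "1 = (\<Sum>g\<in>G. l g * g None)" using fun_cong[OF l(2), of None] by simp
  have "l g * g (Some j) \<le> g (Some j) / g None" if g: "g \<in> G" for g
  proof (cases "g None = 0")
    case True
    then show ?thesis using nz[rule_format, OF g True, of "Some j"] by simp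
  next
    case False
    then have gN: "0 < g None" using nn[rule_format, OF g, of None] by simp
    have "l g * g None \<le> 1"
      unfolding one by (rule member_le_sum[OF g]) (use l(1) nn fin in auto)
    then have "l g \<le> 1 / g None" using gN by (simp add: field_simps)
    then have "l g * g (Some j) \<le> (1 / g None) * g (Some j)" using nn[rule_format, OF g] by (rule mult_right_mono)
    then show ?thesis by simp
  qed
  then show "x $ j \<le> (\<Sum>g\<in>G. g (Some j) / g None)" unfolding xj by (rule sum_mono)
qed

lemma cone_span_vertex_mean:
  fixes G :: "('n::finite option \<Rightarrow> 'a::linordered_field) set"
  assumes fin: "finite G" and nn: "\<forall>g\<in>G. \<forall>i. 0 \<le> g i"
    and x: "homogenize x 1 \<in> cone_span G"
  obtains p :: nat where "p > 0"
    "homogenize (\<chi> j. (\<Sum>g\<in>G. g (Some j) / g None) / of_nat p) 1 \<in> cone_span G"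
proof -
  obtain l where l: "\<And>g. g \<in> G \<Longrightarrow> 0 \<le> l g" "homogenize x 1 = (\<lambda>i. \<Sum>g\<in>G. l g * g i)"
    using cone_spanE[OF x] by blast
  have one: "1 = (\<Sum>g\<in>G. l g * g None)" using fun_cong[OF l(2), of None] by simp
  define V where "V = {g \<in> G. g None \<noteq> 0}"
  have "V \<noteq> {}"
  proof
    assume "V = {}"
    then have "(\<Sum>g\<in>G. l g * g None) = 0" by (intro sum.neutral) (auto simp: V_def)
    then show False using one by simp
  qed
  then have p: "card V > 0" using fin by (simp add: V_def card_gt_0_iff)
  have "(\<lambda>i. \<Sum>g\<in>V. (1 / (of_nat (card V) * g None)) * g i) \<in> cone_span G"
    by (intro cone_span_sum cone_span_scale cone_span_base fin) (use nn in \<open>auto simp: V_def\<close>)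
  moreover have "(\<Sum>g\<in>V. (1 / (of_nat (card V) * g None)) * g i) =
      homogenize (\<chi> j. (\<Sum>g\<in>G. g (Some j) / g None) / of_nat (card V)) 1 i" for i
  proof (cases i)
    case None
    have "(\<Sum>g\<in>V. (1 / (of_nat (card V) * g None)) * g None) = (\<Sum>g\<in>V. 1 / of_nat (card V))"
      by (intro sum.cong) (auto simp: V_def)
    then show ?thesis using None p by simp
  next
    case (Some j)
    have "(\<Sum>g\<in>V. g (Some j) / g None) = (\<Sum>g\<in>G. g (Some j) / g None)"
      by (rule sum.mono_neutral_left) (use fin in \<open>auto simp: V_def\<close>)
    moreover have "(\<Sum>g\<in>V. (1 / (of_nat (card V) * g None)) * g (Some j)) =
        (\<Sum>g\<in>V. g (Some j) / g None) / of_nat (card V)"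
      by (simp add: sum_divide_distrib mult.commute)
    ultimately show ?thesis using Some by (simp only: homogenize_simps vec_lambda_beta)
  qed
  ultimately show thesis using that[OF p] by (simp add: fun_eq_iff cong: if_cong)
qed

section \<open>Valuations of finitely generated cones\<close>

lemma SUP_attained:
  fixes f :: "'a \<Rightarrow> ereal"
  assumes "finite K" "(SUP k\<in>K. f k) \<noteq> -\<infinity>"
  obtains k where "k \<in> K" "(SUP k\<in>K. f k) = f k"
proof -
  have "K \<noteq> {}" using assms by (auto simp: bot_ereal_def)
  then have "(SUP k\<in>K. f k) = Max (f ` K)" using assms(1) by (simp add: Max_Sup)
  moreover have "Max (f ` K) \<in> f ` K" using assms(1) \<open>K \<noteq> {}\<close> by (intro Max_in) auto
  ultimately show thesis using that by auto
qed

text \<open>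
  The valuation of a finitely generated cone is the tropical cone generated by the valuations of
  the generators: no cancellation occurs between nonnegative terms. A vector \<open>y\<close> belongs to a
  tropical cone iff each of its finite entries is met by some generator, scaled so as to agree with
  \<open>y\<close> there, that does not exceed \<open>y\<close> elsewhere.
\<close>

lemma val_cone_span:
  fixes G :: "('i::finite \<Rightarrow> puiseux) set"
  assumes fin: "finite G" and nn: "\<forall>g\<in>G. \<forall>i. 0 \<le> g i"
  shows "(\<exists>z\<in>cone_span G. \<forall>i. val (z i) = y i) \<longleftrightarrow>
    (\<forall>i. y i \<noteq> \<infinity>) \<and>
    (\<forall>i. y i \<noteq> -\<infinity> \<longrightarrow> (\<exists>g\<in>G. g i \<noteq> 0 \<and> (\<forall>j. y i + val (g j) \<le> y j + val (g i))))"
    (is "?L \<longleftrightarrow> ?R")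
proof
  assume ?L
  then obtain z where z: "z \<in> cone_span G" and y: "\<And>i. y i = val (z i)" by metis
  obtain l where l: "\<And>g. g \<in> G \<Longrightarrow> 0 \<le> l g" "z = (\<lambda>i. \<Sum>g\<in>G. l g * g i)"
    using cone_spanE[OF z] by blast
  have yi: "y i = (SUP g\<in>G. val (l g) + val (g i))" for i
    unfolding y l(2) by (subst val_sum_nonneg) (use fin l(1) nn in \<open>auto simp: val_mult\<close>)
  have "\<exists>g\<in>G. g i \<noteq> 0 \<and> (\<forall>j. y i + val (g j) \<le> y j + val (g i))" if ne: "y i \<noteq> -\<infinity>" for i
  proof -
    obtain g where g: "g \<in> G" "y i = val (l g) + val (g i)"
      unfolding yi by (rule SUP_attained[OF fin ne[unfolded yi]])
    have "g i \<noteq> 0" using g ne by (cases "val (l g)") auto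
    moreover have "y i + val (g j) \<le> y j + val (g i)" for j
    proof -
      have "val (l g) + val (g j) \<le> y j" unfolding yi by (rule SUP_upper[OF g(1)])
      then have "(val (l g) + val (g j)) + val (g i) \<le> y j + val (g i)" by (rule add_right_mono)
      then show ?thesis unfolding g(2) by (simp add: ac_simps)
    qed
    ultimately show ?thesis using g(1) by blast
  qed
  then show ?R by (auto simp: y)
next
  assume R: ?R
  define I where "I = {i. y i \<noteq> -\<infinity>}"
  obtain \<gamma> where \<gamma>: "\<And>i. i \<in> I \<Longrightarrow> \<gamma> i \<in> G" "\<And>i. i \<in> I \<Longrightarrow> \<gamma> i i \<noteq> 0"
    "\<And>i j. i \<in> I \<Longrightarrow> y i + val (\<gamma> i j) \<le> y j + val (\<gamma> i i)"
    using R unfolding I_def by (metis (mono_tags, lifting) mem_Collect_eq)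
  define e where "e i = real_of_ereal (y i) - lead_exp (\<gamma> i i)" for i
  \<comment> \<open>The generator chosen for \<open>i\<close>, scaled by the power of \<open>t\<close> that makes its entry \<open>i\<close> have valuation \<open>y i\<close>.\<close>
  define z where "z = (\<lambda>j. \<Sum>i\<in>I. psingle (e i) 1 * \<gamma> i j)"
  have pos: "0 \<le> psingle a 1" for a using psingle_pos[of a 1] by simp
  have zc: "z \<in> cone_span G"
    unfolding z_def by (intro cone_span_sum cone_span_scale cone_span_base fin \<gamma>(1) pos)
  have vz: "val (z j) = (SUP i\<in>I. ereal (e i) + val (\<gamma> i j))" for j
    unfolding z_def
    by (subst val_sum_nonneg) (use nn \<gamma>(1) pos in \<open>auto simp: val_mult val_psingle\<close>)
  have real: "y i = ereal (real_of_ereal (y i))" "val (\<gamma> i i) = ereal (lead_exp (\<gamma> i i))" if "i \<in> I" for i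
    using that R \<gamma>(2)[OF that] by (cases "y i"; simp add: I_def val_nonzero; metis)+
  have bnd: "ereal (e i) + val (\<gamma> i j) \<le> y j" if i: "i \<in> I" for i j
    using \<gamma>(3)[OF i, of j] real[OF i] unfolding e_def
    by (cases "y j"; cases "val (\<gamma> i j)"; cases "y i") (auto simp: algebra_simps)
  have "val (z j) = y j" for j
  proof (rule antisym)
    show "val (z j) \<le> y j" unfolding vz by (rule SUP_least) (rule bnd)
    show "y j \<le> val (z j)"
    proof (cases "j \<in> I")
      case True
      have "y j = ereal (e j) + val (\<gamma> j j)"
        unfolding real(2)[OF True] e_def by (subst real(1)[OF True]) simp
      also have "\<dots> \<le> val (z j)" unfolding vz by (rule SUP_upper[OF True])
      finally show ?thesis .
    qed (simp add: I_def)
  qed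
  then show ?L using zc by blast
qed

lemma trop_inner_SUP: "trop_inner x y = (SUP i\<in>UNIV. x $ i + y $ i)"
  by (simp add: trop_inner_def Max_Sup)

lemma SUP_option: "(SUP i\<in>(UNIV :: 'n option set). f i) = max (f None) (SUP j. f (Some j))"
  for f :: "'n option \<Rightarrow> ereal"
  by (simp add: UNIV_option_conv image_image sup_max)

lemma trop_affine_homogenize:
  "trop_affine (\<alpha> None) (\<chi> j. \<alpha> (Some j)) x = (SUP i. \<alpha> i + homogenize x 0 i)"
  by (simp add: trop_affine_def trop_inner_SUP SUP_option)

text \<open>
  The membership criterion has the form \<open>\<forall>i. \<exists>g. \<forall>j\<close>. Exchanging the inner quantifiers by means of
  choice functions \<open>\<phi>\<close> turns it into \<open>\<forall>i. \<forall>\<phi>. \<exists>g\<close>, where the existential quantifier over the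
  finite set of generators is a tropical sum. So there is one tropical inequality for each
  coordinate \<open>i\<close> and each choice function \<open>\<phi>\<close>. Choice functions only take values \<open>j\<close> with
  \<open>g j \<noteq> 0\<close>; for the other \<open>j\<close> the condition on \<open>g\<close> holds trivially.
\<close>

lemma tropical_polyhedronI_cone:
  fixes G :: "('n::finite option \<Rightarrow> puiseux) set"
  assumes fin: "finite G"
    and S: "\<And>y. y \<in> S \<longleftrightarrow> y \<in> trop_space \<and> (\<forall>i. homogenize y 0 i \<noteq> -\<infinity> \<longrightarrow>
      (\<exists>g\<in>G. g i \<noteq> 0 \<and> (\<forall>j. homogenize y 0 i + val (g j) \<le> homogenize y 0 j + val (g i))))"
  shows "tropical_polyhedron S"
proof -
  define Gi where "Gi i = {g \<in> G. g i \<noteq> 0}" for i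
  define \<Phi> where "\<Phi> i = (\<Pi>\<^sub>E g\<in>Gi i. {j. g j \<noteq> 0})" for i
  define \<alpha> where "\<alpha> i = (\<lambda>k :: 'n option. if k = i then 0 else -\<infinity> :: ereal)" for i
  define \<beta> where "\<beta> i \<phi> = (\<lambda>k. SUP g\<in>{g \<in> Gi i. \<phi> g = k}. ereal (lead_exp (g i) - lead_exp (g k)))" for i \<phi>
  define H where "H = (\<lambda>(i, \<phi>). (\<alpha> i None, \<chi> j. \<alpha> i (Some j), \<beta> i \<phi> None, \<chi> j. \<beta> i \<phi> (Some j))) ` (SIGMA i:UNIV. \<Phi> i)"
  have fGi: "finite (Gi i)" for i using fin by (simp add: Gi_def)
  have fin\<Phi>: "finite (\<Phi> i)" for i unfolding \<Phi>_def using fGi by (intro finite_PiE) auto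
  have finH: "finite H" unfolding H_def by (intro finite_imageI finite_SigmaI fin\<Phi>) simp
  have \<beta>_fin: "\<beta> i \<phi> k \<noteq> \<infinity>" for i \<phi> k
  proof (cases "\<beta> i \<phi> k = -\<infinity>")
    case False
    then show ?thesis unfolding \<beta>_def
      by (rule SUP_attained[rotated]) (use fGi in auto)
  qed simp
  have left: "(SUP k. \<alpha> i k + homogenize y 0 k) = homogenize y 0 i" if "y \<in> trop_space" for i and y :: "ereal ^ 'n"
  proof -
    have ne: "homogenize y 0 k \<noteq> \<infinity>" for k
      using that by (cases k) (auto simp: trop_space_def)
    show ?thesis
    proof (intro antisym SUP_least)
      show "\<alpha> i k + homogenize y 0 k \<le> homogenize y 0 i" for k
        using ne[of k] by (cases "homogenize y 0 k") (auto simp: \<alpha>_def)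
      show "homogenize y 0 i \<le> (SUP k. \<alpha> i k + homogenize y 0 k)"
        by (rule SUP_upper2[of i]) (auto simp: \<alpha>_def)
    qed
  qed
  have key: "(homogenize y 0 i \<noteq> -\<infinity> \<longrightarrow>
      (\<exists>g\<in>G. g i \<noteq> 0 \<and> (\<forall>j. homogenize y 0 i + val (g j) \<le> homogenize y 0 j + val (g i)))) \<longleftrightarrow>
      (\<forall>\<phi>\<in>\<Phi> i. homogenize y 0 i \<le> (SUP k. \<beta> i \<phi> k + homogenize y 0 k))" (is "?A \<longleftrightarrow> ?B")
    if y: "y \<in> trop_space" for i and y :: "ereal ^ 'n"
  proof (cases "homogenize y 0 i = -\<infinity>")
    case False
    let ?y = "homogenize y 0"
    have ne: "?y k \<noteq> \<infinity>" for k
      using y by (cases k) (auto simp: trop_space_def)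
    obtain r where r: "?y i = ereal r" using ne[of i] False by (cases "?y i") auto
    show ?thesis
    proof
      assume ?A
      then obtain g where g: "g \<in> Gi i" "\<And>j. ?y i + val (g j) \<le> ?y j + val (g i)"
        using False by (auto simp: Gi_def)
      show ?B
      proof
        fix \<phi> assume \<phi>: "\<phi> \<in> \<Phi> i"
        have nz: "g (\<phi> g) \<noteq> 0" "g i \<noteq> 0" using \<phi> g(1) by (auto simp: \<Phi>_def Gi_def PiE_iff)
        have "?y i \<le> ereal (lead_exp (g i) - lead_exp (g (\<phi> g))) + ?y (\<phi> g)"
          using g(2)[of "\<phi> g"] nz r by (cases "?y (\<phi> g)") (auto simp: val_nonzero)
        also have "\<dots> \<le> \<beta> i \<phi> (\<phi> g) + ?y (\<phi> g)"
          unfolding \<beta>_def by (intro add_right_mono SUP_upper) (use g in auto)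
        also have "\<dots> \<le> (SUP k. \<beta> i \<phi> k + ?y k)" by (rule SUP_upper) simp
        finally show "?y i \<le> (SUP k. \<beta> i \<phi> k + ?y k)" .
      qed
    next
      assume B: ?B
      have "\<exists>g\<in>Gi i. \<forall>j. ?y i + val (g j) \<le> ?y j + val (g i)"
      proof (rule ccontr)
        assume "\<not> ?thesis"
        then obtain \<psi> where \<psi>: "\<And>g. g \<in> Gi i \<Longrightarrow> \<not> ?y i + val (g (\<psi> g)) \<le> ?y (\<psi> g) + val (g i)"
          by metis
        define \<phi> where "\<phi> = restrict \<psi> (Gi i)"
        have nz: "g (\<phi> g) \<noteq> 0" if "g \<in> Gi i" for g
          using \<psi>[OF that] r that by (auto simp: \<phi>_def)
        then have "\<phi> \<in> \<Phi> i" by (auto simp: \<Phi>_def \<phi>_def)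
        then have le: "?y i \<le> (SUP k. \<beta> i \<phi> k + ?y k)" using B by blast
        then have "(SUP k. \<beta> i \<phi> k + ?y k) \<noteq> -\<infinity>" using r by auto
        then obtain k where k: "(SUP k. \<beta> i \<phi> k + ?y k) = \<beta> i \<phi> k + ?y k"
          by (rule SUP_attained[rotated]) auto
        have "\<beta> i \<phi> k \<noteq> -\<infinity>" using le ne[of k] r unfolding k by (cases "?y k") auto
        then obtain g where g: "g \<in> Gi i" "\<phi> g = k" "\<beta> i \<phi> k = ereal (lead_exp (g i) - lead_exp (g k))"
          unfolding \<beta>_def by (rule SUP_attained[rotated]) (use fGi in auto)
        have "?y i + val (g k) \<le> ?y k + val (g i)"
          using le nz[OF g(1)] g r unfolding k
          by (cases "?y k") (auto simp: val_nonzero Gi_def)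
        then show False using \<psi>[OF g(1)] g by (simp add: \<phi>_def restrict_def split: if_splits)
      qed
      then show ?A by (auto simp: Gi_def)
    qed
  qed simp
  have "S = {y \<in> trop_space. \<forall>(\<alpha>0, \<alpha>, \<beta>0, \<beta>)\<in>H. trop_affine \<alpha>0 \<alpha> y \<le> trop_affine \<beta>0 \<beta> y}"
  proof (intro set_eqI)
    fix y
    show "y \<in> S \<longleftrightarrow> y \<in> {y \<in> trop_space. \<forall>(\<alpha>0, \<alpha>, \<beta>0, \<beta>)\<in>H. trop_affine \<alpha>0 \<alpha> y \<le> trop_affine \<beta>0 \<beta> y}"
    proof (cases "y \<in> trop_space")
      case True
      have "y \<in> S \<longleftrightarrow> (\<forall>i. \<forall>\<phi>\<in>\<Phi> i. homogenize y 0 i \<le> (SUP k. \<beta> i \<phi> k + homogenize y 0 k))"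
        unfolding S using True key[OF True] by simp
      also have "\<dots> \<longleftrightarrow> (\<forall>(\<alpha>0, \<alpha>, \<beta>0, \<beta>)\<in>H. trop_affine \<alpha>0 \<alpha> y \<le> trop_affine \<beta>0 \<beta> y)"
        by (auto simp: H_def trop_affine_homogenize left[OF True])
      finally show ?thesis using True by simp
    qed (simp add: S)
  qed
  moreover have "\<forall>(\<alpha>0, \<alpha>, \<beta>0, \<beta>)\<in>H. \<alpha>0 \<noteq> \<infinity> \<and> \<alpha> \<in> trop_space \<and> \<beta>0 \<noteq> \<infinity> \<and> \<beta> \<in> trop_space"
    using \<beta>_fin by (auto simp: H_def trop_space_def \<alpha>_def)
  ultimately show ?thesis unfolding tropical_polyhedron_def using finH by blast
qed

section \<open>The valuation of the truncated polyhedron\<close>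

lemma compact_ereal_vec_le:
  fixes w :: "ereal ^ 'n"
  shows "compact {y. \<forall>i. y $ i \<le> w $ i}"
proof -
  have "compactin (product_topology (\<lambda>_. euclidean) UNIV) (\<Pi>\<^sub>E i\<in>UNIV. {..w $ i})"
    unfolding compactin_PiE
    by (simp add: compactin_euclidean_iff compact_eq_closed)
  then have "compact (\<Pi>\<^sub>E i\<in>UNIV. {..w $ i})"
    unfolding euclidean_product_topology compactin_euclidean_iff .
  then have "compact ((\<lambda>f. \<chi> i. f i) ` (\<Pi>\<^sub>E i\<in>UNIV. {..w $ i}))"
    by (rule compact_continuous_image[rotated])
      (auto intro!: continuous_on_vec_lambda continuous_on_subset[OF continuous_on_product_coordinates])
  moreover have "(\<lambda>f. \<chi> i. f i) ` (\<Pi>\<^sub>E i\<in>UNIV. {..w $ i}) = {y. \<forall>i. y $ i \<le> w $ i}"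
  proof (intro equalityI subsetI)
    fix y assume "y \<in> {y. \<forall>i. y $ i \<le> w $ i}"
    then show "y \<in> (\<lambda>f. \<chi> i. f i) ` (\<Pi>\<^sub>E i\<in>UNIV. {..w $ i})"
      by (intro image_eqI[where x = "\<lambda>i. y $ i"]) auto
  qed auto
  ultimately show ?thesis by simp
qed

lemma continuous_on_SUP_finite:
  fixes f :: "'i \<Rightarrow> 'a::topological_space \<Rightarrow> ereal"
  assumes "finite I" "\<And>i. i \<in> I \<Longrightarrow> continuous_on K (f i)"
  shows "continuous_on K (\<lambda>x. SUP i\<in>I. f i x)"
  using assms by (induction I) (auto simp: sup_max bot_ereal_def intro!: continuous_intros)

lemma continuous_on_trop_affine:
  assumes "\<alpha> \<in> trop_space" "K \<subseteq> trop_space"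
  shows "continuous_on K (trop_affine \<alpha>0 \<alpha>)"
proof -
  have "continuous_on K (\<lambda>y. \<alpha> $ i + y $ i)" for i
    unfolding continuous_on_def
  proof
    fix y assume y: "y \<in> K"
    have "((\<lambda>y. y $ i) \<longlongrightarrow> y $ i) (at y within K)" by (intro tendsto_intros)
    then show "((\<lambda>y. \<alpha> $ i + y $ i) \<longlongrightarrow> \<alpha> $ i + y $ i) (at y within K)"
      using assms y by (intro tendsto_add_ereal_general) (auto simp: trop_space_def)
  qed
  then show ?thesis
    unfolding trop_affine_def[abs_def] trop_inner_SUP
    by (intro continuous_on_max continuous_on_const continuous_on_SUP_finite) auto
qed

lemma closed_Collect_le_ereal:
  fixes f g :: "'a::topological_space \<Rightarrow> ereal"
  assumes "continuous_on K f" "continuous_on K g" "closed K"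
  shows "closed {x \<in> K. f x \<le> g x}"
proof -
  have "closed ((\<lambda>x. (f x, g x)) -` {p. fst p \<le> snd p} \<inter> K)"
    using assms
    by (intro continuous_on_closed_vimage[THEN iffD1, rule_format])
      (auto intro!: continuous_intros closed_Collect_le)
  moreover have "(\<lambda>x. (f x, g x)) -` {p. fst p \<le> snd p} \<inter> K = {x \<in> K. f x \<le> g x}" by auto
  ultimately show ?thesis by simp
qed

lemma tropical_polyhedron_bounded_compact:
  assumes S: "tropical_polyhedron S" and w: "w \<in> trop_space" "\<And>y. y \<in> S \<Longrightarrow> y \<le> w"
  shows "compact S"
proof -
  obtain H where H: "finite H" "\<forall>(\<alpha>0, \<alpha>, \<beta>0, \<beta>)\<in>H. \<alpha>0 \<noteq> \<infinity> \<and> \<alpha> \<in> trop_space \<and> \<beta>0 \<noteq> \<infinity> \<and> \<beta> \<in> trop_space"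
    and SH: "S = {x \<in> trop_space. \<forall>(\<alpha>0, \<alpha>, \<beta>0, \<beta>)\<in>H. trop_affine \<alpha>0 \<alpha> x \<le> trop_affine \<beta>0 \<beta> x}"
    using S unfolding tropical_polyhedron_def by blast
  define K where "K = {y. \<forall>i. y $ i \<le> w $ i}"
  have K: "compact K" "K \<subseteq> trop_space"
    using w(1) compact_ereal_vec_le[of w]
    by (auto simp: K_def trop_space_def) (metis ereal_infty_less_eq(1))
  have "closed (\<Inter>i. {y :: ereal ^ 'a. y $ i \<le> w $ i})"
    by (intro closed_INT ballI closed_Collect_le continuous_intros)
  then have clK: "closed K" by (simp add: K_def INTER_eq)
  have "closed {y \<in> K. trop_affine \<alpha>0 \<alpha> y \<le> trop_affine \<beta>0 \<beta> y}" if "(\<alpha>0, \<alpha>, \<beta>0, \<beta>) \<in> H" for \<alpha>0 \<alpha> \<beta>0 \<beta>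
    using that H(2) K(2) clK
    by (intro closed_Collect_le_ereal continuous_on_trop_affine) auto
  then have "closed (\<Inter>(\<alpha>0, \<alpha>, \<beta>0, \<beta>)\<in>H. {y \<in> K. trop_affine \<alpha>0 \<alpha> y \<le> trop_affine \<beta>0 \<beta> y})"
    by (intro closed_INT) auto
  then have "compact (K \<inter> (\<Inter>(\<alpha>0, \<alpha>, \<beta>0, \<beta>)\<in>H. {y \<in> K. trop_affine \<alpha>0 \<alpha> y \<le> trop_affine \<beta>0 \<beta> y}))"
    by (rule compact_Int_closed[OF K(1)])
  moreover have "S = K \<inter> (\<Inter>(\<alpha>0, \<alpha>, \<beta>0, \<beta>)\<in>H. {y \<in> K. trop_affine \<alpha>0 \<alpha> y \<le> trop_affine \<beta>0 \<beta> y})"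
  proof (intro equalityI subsetI)
    fix y assume y: "y \<in> S"
    then have "y \<in> K" using w(2)[OF y] by (simp add: K_def less_eq_vec_def)
    then show "y \<in> K \<inter> (\<Inter>(\<alpha>0, \<alpha>, \<beta>0, \<beta>)\<in>H. {y \<in> K. trop_affine \<alpha>0 \<alpha> y \<le> trop_affine \<beta>0 \<beta> y})"
      using y unfolding SH by auto
  next
    fix y assume "y \<in> K \<inter> (\<Inter>(\<alpha>0, \<alpha>, \<beta>0, \<beta>)\<in>H. {y \<in> K. trop_affine \<alpha>0 \<alpha> y \<le> trop_affine \<beta>0 \<beta> y})"
    then show "y \<in> S" using K(2) unfolding SH by auto
  qed
  ultimately show ?thesis by simp
qed

text \<open>
  Dehomogenization is harmless: a point of the cone whose last coordinate has valuation \<open>0\<close> can be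
  divided by that coordinate without changing any valuation.
\<close>

lemma truncation_val_iff:
  assumes fin: "finite G" and nn: "\<forall>g\<in>G. \<forall>i. 0 \<le> g i"
    and G: "\<And>x. x \<in> X \<longleftrightarrow> homogenize x 1 \<in> cone_span G"
  shows "y \<in> val_vec ` X \<longleftrightarrow> y \<in> trop_space \<and> (\<forall>i. homogenize y 0 i \<noteq> -\<infinity> \<longrightarrow>
      (\<exists>g\<in>G. g i \<noteq> 0 \<and> (\<forall>j. homogenize y 0 i + val (g j) \<le> homogenize y 0 j + val (g i))))"
proof -
  have "y \<in> val_vec ` X \<longleftrightarrow> (\<exists>z\<in>cone_span G. \<forall>i. val (z i) = homogenize y 0 i)"
  proof
    assume "y \<in> val_vec ` X"
    then obtain x where x: "homogenize x 1 \<in> cone_span G" "y = val_vec x" using G by auto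
    moreover have "val (homogenize x 1 i) = homogenize y 0 i" for i
      by (cases i) (simp_all add: x val_vec_def)
    ultimately show "\<exists>z\<in>cone_span G. \<forall>i. val (z i) = homogenize y 0 i" by blast
  next
    assume "\<exists>z\<in>cone_span G. \<forall>i. val (z i) = homogenize y 0 i"
    then obtain z where z: "z \<in> cone_span G" "\<And>i. val (z i) = homogenize y 0 i" by blast
    obtain l where l: "\<And>g. g \<in> G \<Longrightarrow> 0 \<le> l g" "z = (\<lambda>i. \<Sum>g\<in>G. l g * g i)"
      using cone_spanE[OF z(1)] by blast
    define r where "r = inverse (z None)"
    have "0 \<le> z None" unfolding l(2) using l(1) nn by (simp add: sum_nonneg)
    moreover have "val (z None) = 0" using z(2)[of None] by simp
    then have "z None \<noteq> 0" by (metis val_0 MInfty_neq_ereal(1) zero_ereal_def)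
    ultimately have r: "0 \<le> r" "r * z None = 1" by (auto simp: r_def)
    have "val (r * z None) = val r" unfolding val_mult using \<open>val (z None) = 0\<close> by simp
    then have vr: "val r = 0" unfolding r by simp
    have "(\<lambda>i. r * z i) \<in> cone_span G" by (rule cone_span_scale[OF z(1) r(1)])
    moreover have "(\<lambda>i. r * z i) = homogenize (\<chi> j. r * z (Some j)) 1"
      using r(2) by (auto simp: fun_eq_iff homogenize_def split: option.split)
    ultimately have "(\<chi> j. r * z (Some j)) \<in> X" using G by simp
    moreover have "y = val_vec (\<chi> j. r * z (Some j))"
      using z(2) by (simp add: vec_eq_iff val_vec_def val_mult vr)
    ultimately show "y \<in> val_vec ` X" by blast
  qed
  also have "\<dots> \<longleftrightarrow> y \<in> trop_space \<and> (\<forall>i. homogenize y 0 i \<noteq> -\<infinity> \<longrightarrow>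
      (\<exists>g\<in>G. g i \<noteq> 0 \<and> (\<forall>j. homogenize y 0 i + val (g j) \<le> homogenize y 0 j + val (g i))))"
    unfolding val_cone_span[OF fin nn] by (simp add: split_option_all trop_space_def)
  finally show ?thesis .
qed

lemma val_of_nat: "n > 0 \<Longrightarrow> val (of_nat n) = 0"
proof -
  assume "n > 0"
  have "val (\<Sum>k\<in>{..<n}. 1) = (SUP k\<in>{..<n}. val 1)" by (rule val_sum_nonneg) auto
  also have "\<dots> = 0" using \<open>n > 0\<close> by (subst cSUP_const) auto
  finally show ?thesis by simp
qed

lemma val_divide_of_nat: "n > 0 \<Longrightarrow> val (x / of_nat n) = val x"
proof -
  assume n: "n > 0"
  have "val x = val (x / of_nat n * of_nat n)" using n by simp
  also have "\<dots> = val (x / of_nat n)" unfolding val_mult using n by (simp add: val_of_nat)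
  finally show ?thesis by simp
qed

lemma ev_eval_divide: "\<forall>\<^sub>F t in at_top. peval (x / y) t = peval x t / peval y t"
proof (cases "y = 0")
  case False
  have "\<forall>\<^sub>F t in at_top. peval (x / y) t * peval y t = peval x t"
    using ev_eval_mult[of "x / y" y] by eventually_elim (use False in simp)
  then show ?thesis using ev_sgn[of y]
    by eventually_elim (use False in \<open>auto simp: sgn_if field_simps split: if_splits\<close>)
qed simp

text \<open>
  The witness \<open>M\<close> is the sum of the vertices. It dominates the truncated polyhedron, both over the
  series and after evaluation, and dividing it by the number of vertices, which does not affect the
  valuation, gives a point of the polyhedron.
\<close>

theorem truncation_tropical:
  fixes A :: "puiseux ^ 'n ^ 'm"
  assumes nn: "polyhedron_of A b \<subseteq> {x. \<forall>i. 0 \<le> x $ i}" and z: "0 \<in> polyhedron_of A b"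
    and c: "\<forall>i. 0 < c $ i" and \<mu>: "0 < \<mu>"
  obtains M :: "puiseux ^ 'n" where "\<forall>j. 0 \<le> M $ j"
    "tropical_polytope (val_vec ` truncation A b c \<mu>)"
    "is_tropical_barycenter (val_vec ` truncation A b c \<mu>) (val_vec M)"
    "\<forall>\<^sub>F t in at_top. \<forall>x\<in>truncation (peval_mat A t) (peval_vec b t) (peval_vec c t) (peval \<mu> t).
       \<forall>j. 0 \<le> x $ j \<and> x $ j \<le> peval (M $ j) t"
proof -
  obtain G where G: "finite G" "\<forall>g\<in>G. \<forall>i. 0 \<le> g i" "\<forall>g\<in>G. g None = 0 \<longrightarrow> (\<forall>i. g i = 0)"
    and GX: "\<And>x. x \<in> truncation A b c \<mu> \<longleftrightarrow> homogenize x 1 \<in> cone_span G"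
    and Gt: "\<forall>\<^sub>F t in at_top. \<forall>x. x \<in> truncation (peval_mat A t) (peval_vec b t) (peval_vec c t) (peval \<mu> t)
        \<longleftrightarrow> homogenize x 1 \<in> cone_span (peval_fun t ` G)"
    using truncation_generators[OF nn z c, of \<mu>] by blast
  define M where "M = (\<chi> j. \<Sum>g\<in>G. g (Some j) / g None)"
  have M0: "0 \<le> M $ j" for j unfolding M_def using G(2) by (simp add: sum_nonneg)
  have poly: "tropical_polyhedron (val_vec ` truncation A b c \<mu>)"
    using G(1) truncation_val_iff[OF G(1,2) GX] by (rule tropical_polyhedronI_cone)
  have le: "y \<le> val_vec M" if y: "y \<in> val_vec ` truncation A b c \<mu>" for y
  proof -
    obtain x where x: "homogenize x 1 \<in> cone_span G" "y = val_vec x" using y GX by auto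
    show ?thesis
      using cone_span_vertex_bound[OF G x(1)]
      by (auto simp: x(2) less_eq_vec_def val_vec_def M_def intro!: val_mono)
  qed
  have "0 \<in> truncation A b c \<mu>" using z \<mu> by (simp add: truncation_def)
  then have "homogenize 0 1 \<in> cone_span G" using GX by simp
  then obtain p :: nat where p: "p > 0"
    "homogenize (\<chi> j. (\<Sum>g\<in>G. g (Some j) / g None) / of_nat p) 1 \<in> cone_span G"
    by (rule cone_span_vertex_mean[OF G(1,2)])
  have M: "val_vec M \<in> val_vec ` truncation A b c \<mu>"
  proof (rule image_eqI)
    show "(\<chi> j. (\<Sum>g\<in>G. g (Some j) / g None) / of_nat p) \<in> truncation A b c \<mu>"
      unfolding GX by (rule p(2))
    show "val_vec M = val_vec (\<chi> j. (\<Sum>g\<in>G. g (Some j) / g None) / of_nat p)"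
      using p(1) by (simp add: val_vec_def M_def vec_eq_iff val_divide_of_nat)
  qed
  have bnd: "\<forall>\<^sub>F t in at_top. \<forall>x\<in>truncation (peval_mat A t) (peval_vec b t) (peval_vec c t) (peval \<mu> t).
       \<forall>j. 0 \<le> x $ j \<and> x $ j \<le> peval (M $ j) t"
  proof -
    have "\<forall>\<^sub>F t in at_top. \<forall>g\<in>G. \<forall>i. 0 \<le> peval (g i) t"
      using G(1,2) by (intro eventually_ball_finite ballI eventually_all_finite) (auto simp: puiseux_le_iff)
    moreover have "\<forall>\<^sub>F t in at_top. \<forall>g\<in>G. peval (g None) t = 0 \<longrightarrow> g None = 0"
      using G(1)
    proof (intro eventually_ball_finite ballI)
      fix g
      show "\<forall>\<^sub>F t in at_top. peval (g None) t = 0 \<longrightarrow> g None = 0"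
        using ev_sgn[of "g None"] by eventually_elim (auto split: if_splits)
    qed
    moreover have "\<forall>\<^sub>F t in at_top. \<forall>j. peval (M $ j) t = (\<Sum>g\<in>G. peval (g (Some j)) t / peval (g None) t)"
    proof (intro eventually_all_finite)
      fix j
      have "\<forall>\<^sub>F t in at_top. \<forall>g\<in>G. peval (g (Some j) / g None) t = peval (g (Some j)) t / peval (g None) t"
        using G(1) by (intro eventually_ball_finite ballI ev_eval_divide)
      then show "\<forall>\<^sub>F t in at_top. peval (M $ j) t = (\<Sum>g\<in>G. peval (g (Some j)) t / peval (g None) t)"
        using ev_eval_sum[of "\<lambda>g. g (Some j) / g None" G]
        by eventually_elim (simp add: M_def)
    qed
    ultimately show ?thesis using Gt
    proof eventually_elim
      case (elim t)
      let ?G = "peval_fun t ` G"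
      have fin: "finite ?G" using G(1) by simp
      have nn': "\<forall>h\<in>?G. \<forall>i. 0 \<le> h i"
        using elim(1) by (auto simp: peval_fun_def)
      have nz': "\<forall>h\<in>?G. h None = 0 \<longrightarrow> (\<forall>i. h i = 0)"
      proof (intro ballI impI allI)
        fix h i assume "h \<in> ?G" "h None = 0"
        then obtain g where g: "g \<in> G" "h = peval_fun t g" "peval (g None) t = 0"
          by (auto simp: peval_fun_def)
        have "g None = 0" by (rule elim(2)[rule_format, OF g(1,3)])
        then have "g i = 0" by (rule G(3)[rule_format, OF g(1)])
        then show "h i = 0" by (simp add: g(2) peval_fun_def)
      qed
      show ?case
      proof (intro ballI allI)
        fix x j
        assume "x \<in> truncation (peval_mat A t) (peval_vec b t) (peval_vec c t) (peval \<mu> t)"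
        then have x: "homogenize x 1 \<in> cone_span ?G" using elim(4) by blast
        note b = cone_span_vertex_bound[OF fin nn' nz' x, of j]
        have "(\<Sum>h\<in>?G. h (Some j) / h None) \<le> (\<Sum>g\<in>G. peval_fun t g (Some j) / peval_fun t g None)"
          using sum_image_le[OF G(1), of "\<lambda>h. h (Some j) / h None" "peval_fun t"] nn' by (auto simp: o_def)
        also have "\<dots> = peval (M $ j) t" using elim(3) by (simp add: peval_fun_def)
        finally show "0 \<le> x $ j \<and> x $ j \<le> peval (M $ j) t" using b by auto
      qed
    qed
  qed
  show thesis
  proof (rule that[of M])
    show "tropical_polytope (val_vec ` truncation A b c \<mu>)"
      unfolding tropical_polytope_def
      using poly tropical_polyhedron_bounded_compact[OF poly, of "val_vec M"] le
      by (auto simp: trop_space_def val_vec_def)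
    show "is_tropical_barycenter (val_vec ` truncation A b c \<mu>) (val_vec M)"
      using M le by (auto simp: is_tropical_barycenter_def)
  qed (use M0 bnd in auto)
qed

section \<open>Interior points of the valuation of a polyhedron\<close>

lemma le_const_mult_of_val_le:
  assumes "0 \<le> u" "0 < v" "val u \<le> val v"
  obtains r :: real where "1 \<le> r" "u \<le> psingle 0 r * v"
proof (cases "u = 0")
  case True
  show thesis
    by (rule that[of 1]) (use assms True in \<open>auto simp flip: one_puiseux_def\<close>)
next
  case False
  define q where "q = u / v"
  have q: "0 < q" "q * v = u" using False assms by (auto simp: q_def)
  define a where "a = lead_exp q"
  have "val u = val q + val v" using q(2) by (metis val_mult)
  then have "ereal a + val v \<le> val v" using assms(3) q(1) by (simp add: val_nonzero a_def)
  then have a: "a \<le> 0" using assms(2) by (simp add: val_nonzero)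
  define r where "r = \<bar>pcoeff q a\<bar> + 1"
  have "\<forall>\<^sub>F t in at_top. peval q t / t powr a < r"
    using eval_asymp[of q] unfolding a_def[symmetric] by (rule order_tendstoD) (simp add: r_def)
  then have "\<forall>\<^sub>F t in at_top. peval q t \<le> peval (psingle 0 r) t"
    using eventually_ge_at_top[of 1]
  proof eventually_elim
    case (elim t)
    have "peval q t \<le> r * t powr a" using elim by (simp add: pos_divide_less_eq)
    also have "\<dots> \<le> r * t powr 0"
      using elim a by (intro mult_left_mono powr_mono) (auto simp: r_def)
    finally show ?case by (simp add: eval_psingle)
  qed
  then have "q \<le> psingle 0 r" by (simp add: puiseux_le_iff)
  then have "u \<le> psingle 0 r * v" using assms(2) q(2) by (metis less_imp_le mult_right_mono)
  then show thesis by (rule that[rotated]) (simp add: r_def)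
qed

lemma less_of_val_less: "val u < val v \<Longrightarrow> 0 \<le> v \<Longrightarrow> u < v"
  using val_mono[of v u] by (meson leD leI)

lemma polyhedron_scale:
  fixes A :: "'a::linordered_field ^ 'n ^ 'm"
  assumes z: "0 \<in> polyhedron_of A b" and x: "x \<in> polyhedron_of A b" and s: "0 \<le> s" "s \<le> 1"
  shows "(\<chi> j. s * x $ j) \<in> polyhedron_of A b"
  unfolding polyhedron_of_def mem_Collect_eq matrix_vector_scale less_eq_vec_def
proof
  fix k
  have "0 \<le> b $ k" using z by (simp add: polyhedron_of_def less_eq_vec_def)
  have "s * (A *v x) $ k \<le> s * b $ k"
    using x s by (intro mult_left_mono) (auto simp: polyhedron_of_def less_eq_vec_def)
  also have "\<dots> \<le> 1 * b $ k" using s \<open>0 \<le> b $ k\<close> by (intro mult_right_mono) auto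
  finally show "(\<chi> k. s * (A *v x) $ k) $ k \<le> b $ k" by simp
qed

text \<open>
  The classical constraint implies the tropical one. Conversely, the tropical one gives the
  classical one up to a real factor, which scaling towards \<open>0\<close> removes without changing the
  valuation.
\<close>

lemma val_truncation:
  fixes A :: "puiseux ^ 'n ^ 'm"
  assumes nn: "polyhedron_of A b \<subseteq> {x. \<forall>i. 0 \<le> x $ i}" and z: "0 \<in> polyhedron_of A b"
    and c: "\<forall>i. 0 < c $ i" and \<mu>: "0 < \<mu>"
  shows "{x \<in> val_vec ` polyhedron_of A b. trop_inner (val_vec c) x \<le> val \<mu>} = val_vec ` truncation A b c \<mu>"
proof -
  have v: "val (\<Sum>j\<in>UNIV. c $ j * x $ j) = trop_inner (val_vec c) (val_vec x)" if "x \<in> polyhedron_of A b" for x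
    unfolding trop_inner_SUP
    by (subst val_sum_nonneg) (use that nn c in \<open>auto simp: val_mult val_vec_def less_imp_le\<close>)
  have s0: "0 \<le> (\<Sum>j\<in>UNIV. c $ j * x $ j)" if "x \<in> polyhedron_of A b" for x
    by (rule sum_nonneg) (use that nn c in \<open>auto simp: less_imp_le\<close>)
  show ?thesis
  proof (intro equalityI subsetI)
    fix y assume "y \<in> {x \<in> val_vec ` polyhedron_of A b. trop_inner (val_vec c) x \<le> val \<mu>}"
    then obtain x where x: "x \<in> polyhedron_of A b" "y = val_vec x" "trop_inner (val_vec c) (val_vec x) \<le> val \<mu>"
      by auto
    obtain r where r: "1 \<le> r" "(\<Sum>j\<in>UNIV. c $ j * x $ j) \<le> psingle 0 r * \<mu>"
      by (rule le_const_mult_of_val_le[OF s0[OF x(1)] \<mu>]) (use x v in auto)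
    define s where "s = psingle 0 (1 / r)"
    have sr: "s * psingle 0 r = 1" using r(1) by (simp add: s_def psingle_mult one_puiseux_def)
    have s: "0 < s" using r(1) by (simp add: s_def psingle_pos)
    have "s \<le> 1" unfolding s_def one_puiseux_def puiseux_le_iff
      by (rule eventually_mono[OF eventually_gt_at_top[of 0]]) (use r(1) in \<open>simp add: eval_psingle\<close>)
    then have "(\<chi> j. s * x $ j) \<in> polyhedron_of A b"
      using s by (intro polyhedron_scale[OF z x(1)]) auto
    moreover have "(\<Sum>j\<in>UNIV. c $ j * (s * x $ j)) \<le> \<mu>"
    proof -
      have "(\<Sum>j\<in>UNIV. c $ j * (s * x $ j)) = s * (\<Sum>j\<in>UNIV. c $ j * x $ j)"
        by (simp add: sum_distrib_left ac_simps)
      also have "\<dots> \<le> s * (psingle 0 r * \<mu>)" using r(2) s by (intro mult_left_mono) auto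
      also have "\<dots> = \<mu>" by (simp add: sr flip: mult.assoc)
      finally show ?thesis .
    qed
    ultimately have "(\<chi> j. s * x $ j) \<in> truncation A b c \<mu>" by (simp add: truncation_def)
    moreover have "y = val_vec (\<chi> j. s * x $ j)"
      using r(1) by (simp add: x(2) val_vec_def vec_eq_iff val_mult s_def val_psingle flip: zero_ereal_def)
    ultimately show "y \<in> val_vec ` truncation A b c \<mu>" by blast
  next
    fix y assume "y \<in> val_vec ` truncation A b c \<mu>"
    then obtain x where x: "x \<in> polyhedron_of A b" "y = val_vec x" "(\<Sum>j\<in>UNIV. c $ j * x $ j) \<le> \<mu>"
      by (auto simp: truncation_def)
    then show "y \<in> {x \<in> val_vec ` polyhedron_of A b. trop_inner (val_vec c) x \<le> val \<mu>}"
      using val_mono[OF s0[OF x(1)] x(3)] v[OF x(1)] by auto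
  qed
qed

text \<open>
  The form in which regularity is used: near any point of the set there is an
  interior one.
\<close>

lemma trop_regular_near:
  assumes V: "trop_regular V" and x: "x \<in> V" and U: "open U" "x \<in> U"
  obtains y O' where "y \<in> U" "y \<in> O'" "y \<in> trop_space" "open O'" "O' \<inter> trop_space \<subseteq> V"
proof -
  let ?X = "top_of_set trop_space"
  have cl: "x \<in> ?X closure_of (?X interior_of V)" using V x unfolding trop_regular_def by simp
  then have xt: "x \<in> trop_space" unfolding in_closure_of by simp
  have "openin ?X (trop_space \<inter> U)" using U(1) by (auto simp: openin_open)
  then obtain y where y: "y \<in> ?X interior_of V" "y \<in> trop_space \<inter> U"
    using cl xt U(2) unfolding in_closure_of by blast
  have "openin ?X (?X interior_of V)" by simp
  then obtain O' where O': "open O'" "?X interior_of V = trop_space \<inter> O'"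
    unfolding openin_open by blast
  show thesis
    by (rule that[of y O']) (use y O' interior_of_subset[of ?X V] in auto)
qed

lemma open_ereal_contains_real:
  fixes S :: "ereal set"
  assumes "open S" "a \<in> S"
  obtains r where "ereal r \<in> S"
proof (cases a)
  case PInf
  then obtain r where "{ereal r<..} \<subseteq> S" using assms open_PInfty by blast
  then have "ereal (r + 1) \<in> S" by (rule subsetD) simp
  then show thesis by (rule that)
next
  case MInf
  then obtain r where "{..<ereal r} \<subseteq> S" using assms open_MInfty by blast
  then have "ereal (r - 1) \<in> S" by (rule subsetD) simp
  then show thesis by (rule that)
qed (use assms that in auto)

lemma open_ereal_vec_contains_real:
  fixes S :: "(ereal ^ 'n) set"
  assumes "open S" "a \<in> S"
  obtains r :: "real ^ 'n" where "(\<chi> j. ereal (r $ j)) \<in> S"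
proof -
  obtain T where T: "\<And>i. open (T i) \<and> a $ i \<in> T i" "\<And>y. (\<And>i. y $ i \<in> T i) \<Longrightarrow> y \<in> S"
    using assms unfolding open_vec_def by blast
  have "\<exists>r. ereal r \<in> T i" for i using T(1)[of i] open_ereal_contains_real by metis
  then obtain r where "\<And>i. ereal (r i) \<in> T i" by metis
  then have "(\<chi> j. ereal ((\<chi> i. r i) $ j)) \<in> S" by (intro T(2)) simp
  then show thesis by (rule that)
qed

lemma open_ereal_vec_real_box:
  fixes S :: "(ereal ^ 'n) set" and \<zeta> :: "real ^ 'n"
  assumes "open S" "(\<chi> j. ereal (\<zeta> $ j)) \<in> S"
  obtains \<delta> where "\<delta> > 0" "\<And>w :: real ^ 'n. (\<And>j. \<bar>w $ j - \<zeta> $ j\<bar> \<le> \<delta>) \<Longrightarrow> (\<chi> j. ereal (w $ j)) \<in> S"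
proof -
  let ?F = "\<lambda>v :: real ^ 'n. \<chi> j. ereal (v $ j)"
  have "continuous_on UNIV ?F" by (intro continuous_on_vec_lambda continuous_intros)
  then have "open (?F -` S)" using assms(1) by (simp add: open_vimage)
  moreover have "\<zeta> \<in> ?F -` S" using assms(2) by simp
  ultimately obtain e where e: "e > 0" "ball \<zeta> e \<subseteq> ?F -` S" by (rule openE)
  show thesis
  proof (rule that[of "e / (2 * real CARD('n))"])
    show "e / (2 * real CARD('n)) > 0" using e by simp
    fix w :: "real ^ 'n" assume w: "\<And>j. \<bar>w $ j - \<zeta> $ j\<bar> \<le> e / (2 * real CARD('n))"
    have "norm (w - \<zeta>) \<le> (\<Sum>j\<in>UNIV. \<bar>(w - \<zeta>) $ j\<bar>)" by (rule norm_le_l1_cart)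
    also have "\<dots> \<le> (\<Sum>j\<in>(UNIV :: 'n set). e / (2 * real CARD('n)))" by (intro sum_mono) (simp add: w)
    also have "\<dots> < e" using e by (simp add: field_simps)
    finally have "w \<in> ball \<zeta> e" by (simp add: dist_norm norm_minus_commute)
    then show "?F w \<in> S" using e by auto
  qed
qed

lemma val_polyhedron_lower:
  fixes A :: "puiseux ^ 'n ^ 'm"
  assumes z: "0 \<in> polyhedron_of A b" and y: "y \<in> val_vec ` polyhedron_of A b" and r: "0 \<le> r"
  shows "(\<chi> j. y $ j - ereal r) \<in> val_vec ` polyhedron_of A b"
proof -
  obtain p where p: "p \<in> polyhedron_of A b" "y = val_vec p" using y by auto
  define s where "s = psingle (- r) 1"
  have "0 \<le> s" using psingle_pos[of "- r" 1] by (simp add: s_def)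
  moreover have "s \<le> 1" unfolding s_def one_puiseux_def puiseux_le_iff
  proof (rule eventually_mono[OF eventually_ge_at_top[of 1]])
    fix t :: real assume t: "1 \<le> t"
    have "t powr (- r) \<le> t powr 0" using t r by (intro powr_mono) auto
    then show "peval (psingle (- r) 1) t \<le> peval (psingle 0 1) t" by (simp add: eval_psingle)
  qed
  ultimately have "(\<chi> j. s * p $ j) \<in> polyhedron_of A b" by (rule polyhedron_scale[OF z p(1)])
  moreover have "(\<chi> j. y $ j - ereal r) = val_vec (\<chi> j. s * p $ j)"
    by (simp add: p(2) val_vec_def vec_eq_iff val_mult s_def val_psingle minus_ereal_def add.commute)
  ultimately show ?thesis by blast
qed

text \<open>
  Regularity provides a point of the polyhedron with all coordinates positive, and scaling it down
  makes it satisfy the constraint on \<open>c\<close>. Hence the barycenter has no entry \<open>-\<infinity>\<close>.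
\<close>

lemma barycenter_pos:
  fixes A :: "puiseux ^ 'n ^ 'm"
  assumes nn: "polyhedron_of A b \<subseteq> {x. \<forall>i. 0 \<le> x $ i}" and z: "0 \<in> polyhedron_of A b"
    and reg: "trop_regular (val_vec ` polyhedron_of A b)"
    and c: "\<forall>i. 0 < c $ i" and \<mu>: "0 < \<mu>"
    and M: "is_tropical_barycenter (val_vec ` truncation A b c \<mu>) (val_vec M)"
  shows "M $ j \<noteq> 0"
proof -
  let ?V = "val_vec ` polyhedron_of A b"
  have "val_vec 0 \<in> ?V" using z by blast
  then obtain y O' where O': "y \<in> O'" "y \<in> trop_space" "open O'" "O' \<inter> trop_space \<subseteq> ?V"
    by (rule trop_regular_near[OF reg _ open_UNIV UNIV_I])
  obtain w :: "real ^ 'n" where "(\<chi> j. ereal (w $ j)) \<in> O'"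
    by (rule open_ereal_vec_contains_real[OF O'(3,1)])
  then have "(\<chi> j. ereal (w $ j)) \<in> ?V" using O'(4) by (auto simp: trop_space_def)
  then obtain p where p: "p \<in> polyhedron_of A b" "(\<chi> j. ereal (w $ j)) = val_vec p" by auto
  have pj: "p $ i \<noteq> 0" for i
  proof -
    have "val (p $ i) = ereal (w $ i)" using p(2) by (simp add: vec_eq_iff val_vec_def)
    then show ?thesis by auto
  qed
  define d where "d = (\<Sum>j\<in>UNIV. c $ j * p $ j)"
  have d: "0 \<le> d" unfolding d_def by (rule sum_nonneg) (use p nn c in \<open>auto simp: less_imp_le\<close>)
  define s where "s = \<mu> / (\<mu> + d)"
  have s: "0 < s" "s \<le> 1" "s * d \<le> \<mu>" using d \<mu> by (auto simp: s_def field_simps)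
  have "(\<chi> j. s * p $ j) \<in> polyhedron_of A b"
    using s by (intro polyhedron_scale[OF z p(1)]) auto
  moreover have "(\<Sum>j\<in>UNIV. c $ j * (s * p $ j)) = s * d"
    by (simp add: d_def sum_distrib_left ac_simps)
  ultimately have "(\<chi> j. s * p $ j) \<in> truncation A b c \<mu>" using s(3) by (simp add: truncation_def)
  then have "val_vec (\<chi> j. s * p $ j) \<le> val_vec M"
    using M unfolding is_tropical_barycenter_def by blast
  then have "val (s * p $ j) \<le> val (M $ j)" by (simp add: less_eq_vec_def val_vec_def)
  then show ?thesis using s(1) pj[of j] by auto
qed

text \<open>
  The valuation of the polyhedron is closed under subtracting a nonnegative constant from all entries. So an
  interior point that is close to \<open>a\<close> can be shifted strictly below \<open>a\<close> and remains interior.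
\<close>

lemma box_near_barycenter:
  fixes A :: "puiseux ^ 'n ^ 'm" and a :: "real ^ 'n"
  assumes z: "0 \<in> polyhedron_of A b"
    and reg: "trop_regular (val_vec ` polyhedron_of A b)"
    and a: "(\<chi> j. ereal (a $ j)) \<in> val_vec ` polyhedron_of A b" and e: "0 < e"
  obtains \<zeta> :: "real ^ 'n" and \<delta> where "0 < \<delta>" "\<forall>j. a $ j - e \<le> \<zeta> $ j" "\<forall>j. \<zeta> $ j < a $ j"
    "\<forall>w :: real ^ 'n. (\<forall>j. \<bar>w $ j - \<zeta> $ j\<bar> \<le> \<delta>) \<longrightarrow> (\<chi> j. ereal (w $ j)) \<in> val_vec ` polyhedron_of A b"
proof -
  let ?V = "val_vec ` polyhedron_of A b"
  define U where "U = {y :: ereal ^ 'n. \<forall>j. y $ j \<in> {ereal (a $ j - e / 2)<..<ereal (a $ j + e / 2)}}"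
  have "open (\<Inter>j. {y :: ereal ^ 'n. y $ j \<in> {ereal (a $ j - e / 2)<..<ereal (a $ j + e / 2)}})"
    by (intro open_INT ballI) (auto intro!: open_Collect_conj open_Collect_less continuous_intros)
  then have U: "open U" by (simp add: U_def INTER_eq)
  have aU: "(\<chi> j. ereal (a $ j)) \<in> U" using e by (simp add: U_def)
  obtain y O' where y: "y \<in> U" "y \<in> O'" "y \<in> trop_space" "open O'" "O' \<inter> trop_space \<subseteq> ?V"
    by (rule trop_regular_near[OF reg a U aU])
  define v :: "real ^ 'n" where "v = (\<chi> j. real_of_ereal (y $ j))"
  have yv: "y $ j = ereal (v $ j)" for j
  proof -
    have "ereal (a $ j - e / 2) < y $ j" "y $ j < ereal (a $ j + e / 2)" using y(1) by (auto simp: U_def)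
    then show ?thesis by (cases "y $ j") (auto simp: v_def)
  qed
  have v: "a $ j - e / 2 < v $ j" "v $ j < a $ j + e / 2" for j
    using y(1) by (auto simp: U_def yv)
  have "(\<chi> j. ereal (v $ j)) \<in> O'" using y(2) yv by (metis vec_lambda_unique)
  then obtain \<delta> where \<delta>: "\<delta> > 0" "\<And>w :: real ^ 'n. (\<And>j. \<bar>w $ j - v $ j\<bar> \<le> \<delta>) \<Longrightarrow> (\<chi> j. ereal (w $ j)) \<in> O'"
    using open_ereal_vec_real_box[OF y(4)] by metis
  define \<zeta> :: "real ^ 'n" where "\<zeta> = (\<chi> j. v $ j - e / 2)"
  have "(\<chi> j. ereal (w $ j)) \<in> ?V" if w: "\<forall>j. \<bar>w $ j - \<zeta> $ j\<bar> \<le> \<delta>" for w :: "real ^ 'n"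
  proof -
    have "(\<chi> j. ereal ((\<chi> i. w $ i + e / 2) $ j)) \<in> O'"
      by (rule \<delta>(2)) (use w in \<open>simp add: \<zeta>_def algebra_simps\<close>)
    then have "(\<chi> j. ereal (w $ j + e / 2)) \<in> ?V" using y(5) by (auto simp: trop_space_def)
    from val_polyhedron_lower[OF z this, of "e / 2"] show ?thesis using e by simp
  qed
  moreover have "a $ j - e \<le> \<zeta> $ j \<and> \<zeta> $ j < a $ j" for j
  proof -
    have "a $ j - e / 2 < v $ j" "v $ j < a $ j + e / 2" by (rule v)+
    then show ?thesis by (simp add: \<zeta>_def)
  qed
  ultimately show thesis by (intro that[OF \<delta>(1), of \<zeta>]) simp_all
qed

text \<open>
  Let \<open>i\<close> be an index with a positive coefficient. Raising the entry \<open>i\<close> of \<open>\<zeta>\<close> by \<open>\<delta>\<close> stays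
  in the valuation of the polyhedron. The terms with nonpositive coefficients, moved to the side of
  \<open>b\<close>, make up a quantity whose valuation does not change. Hence that valuation exceeds the valuation of the \<open>i\<close>-th term at \<open>\<zeta>\<close> by at least
  \<open>\<delta>\<close>, which absorbs constant factors: the row holds even if all variables with
  positive coefficients are taken twice as large as the others.
\<close>

lemma row_gap:
  fixes A :: "puiseux ^ 'n ^ 'm" and \<zeta> :: "real ^ 'n"
  assumes nn: "polyhedron_of A b \<subseteq> {x. \<forall>i. 0 \<le> x $ i}" and z: "0 \<in> polyhedron_of A b"
    and \<delta>: "0 < \<delta>"
    and box: "\<forall>w :: real ^ 'n. (\<forall>j. \<bar>w $ j - \<zeta> $ j\<bar> \<le> \<delta>) \<longrightarrow> (\<chi> j. ereal (w $ j)) \<in> val_vec ` polyhedron_of A b"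
  shows "(\<Sum>j\<in>UNIV. if 0 < A $ k $ j then A $ k $ j * psingle (\<zeta> $ j) 1 else A $ k $ j * psingle (\<zeta> $ j) (1/2)) \<le> b $ k"
proof -
  define a where "a j = A $ k $ j" for j
  define Pos where "Pos = {j. 0 < a j}"
  define Neg where "Neg = {j. a j \<le> 0}"
  define N where "N = b $ k + (\<Sum>j\<in>Neg. - a j * psingle (\<zeta> $ j) (1/2))"
  have b0: "0 \<le> b $ k" using z by (simp add: polyhedron_of_def less_eq_vec_def)
  have half: "0 \<le> psingle r (1/2)" for r using psingle_pos[of r "1/2"] by simp
  have N0: "0 \<le> N" unfolding N_def
    using b0 half by (intro add_nonneg_nonneg sum_nonneg mult_nonneg_nonneg) (auto simp: Neg_def)
  have vsum: "val (b $ k + (\<Sum>j\<in>Neg. - a j * q j)) = max (val (b $ k)) (SUP j\<in>Neg. val (- a j) + ereal (v $ j))"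
    if q: "\<And>j. 0 \<le> q j" "\<And>j. val (q j) = ereal (v $ j)" for q :: "'n \<Rightarrow> puiseux" and v :: "real ^ 'n"
  proof -
    have t: "0 \<le> - a j * q j" if "j \<in> Neg" for j
      using that q(1) by (intro mult_nonneg_nonneg) (auto simp: Neg_def)
    have "val (\<Sum>j\<in>Neg. - a j * q j) = (SUP j\<in>Neg. val (- a j * q j))"
      by (rule val_sum_nonneg) (use t in auto)
    then show ?thesis
      unfolding val_mult q(2) using b0 t by (subst val_add_nonneg) (auto intro: sum_nonneg)
  qed
  have vN: "val N = max (val (b $ k)) (SUP j\<in>Neg. val (- a j) + ereal (\<zeta> $ j))"
    unfolding N_def by (rule vsum) (simp_all add: half val_psingle)
  have le: "a i * psingle (\<zeta> $ i) 1 \<le> N / of_nat CARD('n)" if i: "i \<in> Pos" for i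
  proof -
    \<comment> \<open>A lift \<open>p\<close> of the raised point satisfies the row exactly, over the series.\<close>
    define w :: "real ^ 'n" where "w = (\<chi> j. if j = i then \<zeta> $ j + \<delta> else \<zeta> $ j)"
    have "(\<chi> j. ereal (w $ j)) \<in> val_vec ` polyhedron_of A b"
      by (rule box[rule_format]) (use \<delta> in \<open>simp add: w_def\<close>)
    then obtain p where p: "p \<in> polyhedron_of A b" "(\<chi> j. ereal (w $ j)) = val_vec p" by auto
    have vp: "val (p $ j) = ereal (w $ j)" for j using p(2) by (simp add: vec_eq_iff val_vec_def)
    have p0: "0 \<le> p $ j" for j using nn p(1) by auto
    have "(\<Sum>j\<in>UNIV. a j * p $ j) \<le> b $ k"
      using p(1) by (simp add: polyhedron_of_def less_eq_vec_def matrix_vector_mult_def a_def)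
    moreover have "(\<Sum>j\<in>UNIV. a j * p $ j) = (\<Sum>j\<in>Pos. a j * p $ j) + (\<Sum>j\<in>Neg. a j * p $ j)"
      by (subst sum.union_disjoint[symmetric]) (auto simp: Pos_def Neg_def intro!: sum.cong)
    moreover have "a i * p $ i \<le> (\<Sum>j\<in>Pos. a j * p $ j)"
      by (rule member_le_sum[OF i]) (auto simp: Pos_def p0)
    ultimately have "a i * p $ i \<le> b $ k + (\<Sum>j\<in>Neg. - a j * p $ j)" by (simp add: sum_negf)
    then have "val (a i * p $ i) \<le> val (b $ k + (\<Sum>j\<in>Neg. - a j * p $ j))"
      using i p0 by (intro val_mono) (auto simp: Pos_def)
    also have "\<dots> = max (val (b $ k)) (SUP j\<in>Neg. val (- a j) + ereal (w $ j))"
      by (rule vsum) (simp_all add: p0 vp)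
    also have "(SUP j\<in>Neg. val (- a j) + ereal (w $ j)) = (SUP j\<in>Neg. val (- a j) + ereal (\<zeta> $ j))"
      by (intro SUP_cong refl) (use i in \<open>auto simp: w_def Neg_def Pos_def\<close>)
    finally have "val (a i * p $ i) \<le> val N" unfolding vN .
    then have 1: "val (a i) + ereal (\<zeta> $ i + \<delta>) \<le> val N" by (simp add: val_mult vp w_def)
    have ai: "a i \<noteq> 0" using i by (auto simp: Pos_def)
    have "val (of_nat CARD('n) * (a i * psingle (\<zeta> $ i) 1)) < val N"
    proof -
      have "val (of_nat CARD('n) * (a i * psingle (\<zeta> $ i) 1)) = val (a i) + ereal (\<zeta> $ i)"
        by (simp add: val_mult val_of_nat val_psingle)
      also have "\<dots> < val (a i) + ereal (\<zeta> $ i + \<delta>)" using ai \<delta> by (simp add: val_nonzero)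
      finally show ?thesis using 1 by (rule less_le_trans)
    qed
    then have "of_nat CARD('n) * (a i * psingle (\<zeta> $ i) 1) \<le> N"
      using less_of_val_less N0 by (simp add: less_imp_le)
    then show ?thesis by (simp add: field_simps)
  qed
  have "(\<Sum>j\<in>UNIV. if 0 < a j then a j * psingle (\<zeta> $ j) 1 else a j * psingle (\<zeta> $ j) (1/2))
      = (\<Sum>j\<in>Pos. a j * psingle (\<zeta> $ j) 1) + (\<Sum>j\<in>Neg. a j * psingle (\<zeta> $ j) (1/2))"
    unfolding Pos_def Neg_def
    by (subst sum.If_cases) (auto simp: not_less intro!: arg_cong2[where f = "(+)"] sum.cong)
  also have "(\<Sum>j\<in>Pos. a j * psingle (\<zeta> $ j) 1) \<le> (\<Sum>j\<in>Pos. N / of_nat CARD('n))"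
    by (intro sum_mono le)
  also have "\<dots> \<le> (\<Sum>j\<in>(UNIV :: 'n set). N / of_nat CARD('n))"
    by (intro sum_mono2) (use N0 in auto)
  also have "\<dots> = N" by simp
  also have "N + (\<Sum>j\<in>Neg. a j * psingle (\<zeta> $ j) (1/2)) = b $ k"
    by (simp add: N_def sum_negf)
  finally show ?thesis by (simp only: a_def)
qed

lemma ev_box_in_polyhedron:
  fixes A :: "puiseux ^ 'n ^ 'm" and \<zeta> :: "real ^ 'n"
  assumes nn: "polyhedron_of A b \<subseteq> {x. \<forall>i. 0 \<le> x $ i}" and z: "0 \<in> polyhedron_of A b"
    and \<delta>: "0 < \<delta>"
    and box: "\<forall>w :: real ^ 'n. (\<forall>j. \<bar>w $ j - \<zeta> $ j\<bar> \<le> \<delta>) \<longrightarrow> (\<chi> j. ereal (w $ j)) \<in> val_vec ` polyhedron_of A b"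
  shows "\<forall>\<^sub>F t in at_top. \<forall>x :: real ^ 'n. (\<forall>j. t powr \<zeta> $ j / 2 \<le> x $ j \<and> x $ j \<le> t powr \<zeta> $ j) \<longrightarrow>
    x \<in> polyhedron_of (peval_mat A t) (peval_vec b t)"
proof -
  define T where "T k j = (if 0 < A $ k $ j then A $ k $ j * psingle (\<zeta> $ j) 1 else A $ k $ j * psingle (\<zeta> $ j) (1/2))" for k j
  have Tb: "(\<Sum>j\<in>UNIV. T k j) \<le> b $ k" for k
    unfolding T_def by (rule row_gap[OF nn z \<delta> box])
  have "\<forall>\<^sub>F t in at_top. \<forall>k. (\<Sum>j\<in>UNIV. peval (T k j) t) \<le> peval (b $ k) t"
  proof (intro eventually_all_finite)
    fix k
    show "\<forall>\<^sub>F t in at_top. (\<Sum>j\<in>UNIV. peval (T k j) t) \<le> peval (b $ k) t"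
      using Tb[of k, unfolded puiseux_le_iff] ev_eval_sum[of "T k" UNIV] by eventually_elim simp
  qed
  moreover have "\<forall>\<^sub>F t in at_top. \<forall>k j. \<forall>u. t powr \<zeta> $ j / 2 \<le> u \<and> u \<le> t powr \<zeta> $ j \<longrightarrow>
      peval (A $ k $ j) t * u \<le> peval (T k j) t"
  proof (intro eventually_all_finite)
    fix k j
    show "\<forall>\<^sub>F t in at_top. \<forall>u. t powr \<zeta> $ j / 2 \<le> u \<and> u \<le> t powr \<zeta> $ j \<longrightarrow>
      peval (A $ k $ j) t * u \<le> peval (T k j) t"
      using ev_sign_iff[of "A $ k $ j"] ev_eval_mult[of "A $ k $ j" "psingle (\<zeta> $ j) 1"]
        ev_eval_mult[of "A $ k $ j" "psingle (\<zeta> $ j) (1/2)"]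
    proof eventually_elim
      case (elim t)
      show ?case
      proof (cases "0 < A $ k $ j")
        case True
        then show ?thesis using elim by (auto simp: T_def eval_psingle intro!: mult_left_mono)
      next
        case False
        have "peval (A $ k $ j) t * u \<le> peval (A $ k $ j) t * (t powr \<zeta> $ j / 2)"
          if "t powr \<zeta> $ j / 2 \<le> u" for u
          using False elim that by (intro mult_left_mono_neg) auto
        moreover have "peval (T k j) t = peval (A $ k $ j) t * (t powr \<zeta> $ j / 2)"
          using False elim by (simp add: T_def eval_psingle)
        ultimately show ?thesis by (simp only: simp_thms all_simps ball_simps) blast
      qed
    qed
  qed
  ultimately show ?thesis
  proof eventually_elim
    case (elim t)
    show ?case
    proof (intro allI impI)
      fix x :: "real ^ 'n" assume x: "\<forall>j. t powr \<zeta> $ j / 2 \<le> x $ j \<and> x $ j \<le> t powr \<zeta> $ j"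
      have "(\<Sum>j\<in>UNIV. peval (A $ k $ j) t * x $ j) \<le> peval (b $ k) t" for k
        using elim x by (intro order_trans[OF sum_mono elim(1)[rule_format, of k]]) auto
      then show "x \<in> polyhedron_of (peval_mat A t) (peval_vec b t)"
        by (simp add: polyhedron_of_def less_eq_vec_def matrix_vector_mult_def peval_mat_def peval_vec_def)
    qed
  qed
qed

section \<open>Exponentially tilted measures on a polyhedron\<close>

lemma prod_Basis_vec: "(\<Prod>b\<in>(Basis :: (real ^ 'n) set). f b) = (\<Prod>i\<in>UNIV. f (axis i 1))"
proof -
  have eq: "(Basis :: (real ^ 'n) set) = (\<lambda>i. axis i 1) ` UNIV" by (auto simp: Basis_vec_def)
  show ?thesis unfolding eq by (subst prod.reindex) (auto simp: inj_on_def axis_eq_axis)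
qed

lemma nn_integral_exp_decay:
  fixes q :: real
  assumes "0 < q"
  shows "(\<integral>\<^sup>+x. ennreal (exp (- x / q)) * indicator {0..} x \<partial>lborel) = ennreal q"
proof -
  have "LIM x at_top. inverse q * x :> at_top"
    using assms by (intro filterlim_tendsto_pos_mult_at_top[OF tendsto_const _ filterlim_ident]) simp
  then have "LIM x at_top. - x / q :> at_bot"
    by (simp add: filterlim_uminus_at_top divide_inverse mult.commute)
  then have "((\<lambda>x. - q * exp (- x / q)) \<longlongrightarrow> - q * 0) at_top"
    by (intro tendsto_mult tendsto_const filterlim_compose[OF exp_at_bot])
  then have "(\<integral>\<^sup>+x. ennreal (exp (- x / q)) * indicator {0..} x \<partial>lborel) = ennreal (- q * 0 - (- q * exp (- 0 / q)))"
    by (intro nn_integral_FTC_atLeast) (auto intro!: derivative_eq_intros simp: assms less_imp_neq[OF assms, symmetric])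
  then show ?thesis by simp
qed

definition exp_decay :: "real ^ 'n \<Rightarrow> real ^ 'n \<Rightarrow> real" where
  "exp_decay q x = (\<Prod>j\<in>UNIV. exp (- (x $ j) / q $ j) * indicator {0..} (x $ j))"

lemma measurable_vec_nth [measurable]: "(\<lambda>x :: real ^ 'n. x $ j) \<in> borel_measurable borel"
  by (intro borel_measurable_continuous_onI continuous_intros)

lemma exp_decay_nonneg: "0 \<le> exp_decay q x"
  by (auto simp: exp_decay_def intro!: prod_nonneg)

lemma exp_decay_measurable [measurable]: "exp_decay q \<in> borel_measurable borel"
  unfolding exp_decay_def[abs_def] by measurable

lemma exp_decay_integral:
  fixes q :: "real ^ 'n"
  assumes q: "\<And>j. 0 < q $ j"
  shows "integrable lborel (exp_decay q)" "(\<integral>x. exp_decay q x \<partial>lborel) = (\<Prod>j\<in>UNIV. q $ j)"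
proof -
  have "(\<integral>\<^sup>+x. ennreal (exp_decay q x) \<partial>lborel) =
      (\<integral>\<^sup>+x. (\<Prod>b\<in>Basis. (ennreal (exp (- (x \<bullet> b) / (q \<bullet> b))) * indicator {0..} (x \<bullet> b))) \<partial>lborel)"
    by (intro nn_integral_cong)
      (simp add: exp_decay_def prod_Basis_vec inner_axis ennreal_mult'' prod_ennreal[symmetric] ennreal_indicator)
  also have "\<dots> = (\<Prod>b\<in>Basis. \<integral>\<^sup>+x. ennreal (exp (- x / (q \<bullet> b))) * indicator {0..} x \<partial>lborel)"
    by (rule nn_integral_lborel_prod) auto
  also have "\<dots> = (\<Prod>j\<in>UNIV. ennreal (q $ j))"
    unfolding prod_Basis_vec by (intro prod.cong refl) (use nn_integral_exp_decay[OF q] in \<open>simp add: inner_axis\<close>)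
  also have "\<dots> = ennreal (\<Prod>j\<in>UNIV. q $ j)"
    using q by (intro prod_ennreal) (simp add: less_imp_le)
  finally have nn: "(\<integral>\<^sup>+x. ennreal (exp_decay q x) \<partial>lborel) = ennreal (\<Prod>j\<in>UNIV. q $ j)" .
  show "integrable lborel (exp_decay q)"
    by (rule integrableI_nn_integral_finite[OF _ _ nn]) (auto simp: exp_decay_nonneg)
  show "(\<integral>x. exp_decay q x \<partial>lborel) = (\<Prod>j\<in>UNIV. q $ j)"
    by (subst integral_eq_nn_integral) (auto simp: nn exp_decay_nonneg prod_nonneg q less_imp_le)
qed

text \<open>
  In the application, \<open>A\<close>, \<open>b\<close>, \<open>c\<close>, \<open>\<mu>\<close> are evaluated at a fixed large \<open>t\<close>, \<open>M\<close> is the bound from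
  the vertices and \<open>w\<close> is \<open>t powr \<zeta>\<close>. The product of the entries of \<open>w\<close> measures the polyhedron from
  inside, that of \<open>M\<close> from outside. Both only have to be correct up to small powers of \<open>t\<close>.
\<close>

locale tilted_polyhedron =
  fixes A :: "real ^ 'n ^ 'm" and b :: "real ^ 'm" and c :: "real ^ 'n" and \<mu> :: real
    and M w :: "real ^ 'n"
  assumes mu: "0 < \<mu>" and c: "\<And>j. 0 < c $ j" and M: "\<And>j. 0 < M $ j" and w: "\<And>j. 0 < w $ j"
    and zero: "0 \<in> polyhedron_of A b"
    and nonneg: "\<And>x j. x \<in> polyhedron_of A b \<Longrightarrow> 0 \<le> x $ j"
    and bound: "\<And>x j. x \<in> polyhedron_of A b \<Longrightarrow> c \<bullet> x \<le> \<mu> \<Longrightarrow> x $ j \<le> M $ j"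
    and box: "\<And>x. (\<And>j. w $ j / 2 \<le> x $ j \<and> x $ j \<le> w $ j) \<Longrightarrow> x \<in> polyhedron_of A b"
    and cw: "\<And>j. c $ j * w $ j \<le> \<mu>"
begin

definition P where "P = polyhedron_of A b"
definition \<phi> where "\<phi> x = (c \<bullet> x) / \<mu>"
definition weight where "weight x = indicator P x * exp (- \<phi> x)"
definition total_mass where "total_mass = (\<integral>x. weight x \<partial>lborel)"
definition mean :: "real ^ 'n" where "mean = (\<chi> j. (\<integral>x. weight x * x $ j \<partial>lborel) / total_mass)"
definition q :: "real ^ 'n" where "q = (\<chi> j. 2 * real CARD('n) * M $ j)"

lemma P_row: "x \<in> P \<longleftrightarrow> (\<forall>k. A $ k \<bullet> x \<le> b $ k)"
  by (simp add: P_def polyhedron_of_def less_eq_vec_def matrix_vector_mult_def inner_vec_def)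

lemma closed_P: "closed P"
proof -
  have "closed (\<Inter>k. {x. A $ k \<bullet> x \<le> b $ k})"
    by (intro closed_INT ballI closed_Collect_le continuous_intros)
  moreover have "(\<Inter>k. {x. A $ k \<bullet> x \<le> b $ k}) = P" by (auto simp: P_row)
  ultimately show ?thesis by simp
qed

lemma P_sets [measurable]: "P \<in> sets borel" using closed_P by (rule borel_closed)

lemma \<phi>_measurable [measurable]: "\<phi> \<in> borel_measurable borel"
  unfolding \<phi>_def[abs_def] by measurable

lemma weight_measurable [measurable]: "weight \<in> borel_measurable borel"
  unfolding weight_def[abs_def] by measurable

lemma weight_nonneg: "0 \<le> weight x" by (simp add: weight_def)

lemma \<phi>_nonneg: "x \<in> P \<Longrightarrow> 0 \<le> \<phi> x"
  using nonneg c mu unfolding P_def \<phi>_def inner_vec_def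
  by (auto intro!: divide_nonneg_pos sum_nonneg simp: less_imp_le)

text \<open>
  If \<open>\<phi> x > 1\<close>, then \<open>x / \<phi> x\<close> still lies in the polyhedron, which contains the segment from \<open>0\<close>
  to \<open>x\<close>, and there the bound \<open>M\<close> applies.
\<close>

lemma coord_bound:
  assumes x: "x \<in> P" shows "x $ j \<le> M $ j * (1 + \<phi> x)"
proof (cases "\<phi> x \<le> 1")
  case True
  then have "x $ j \<le> M $ j" using bound x mu by (auto simp: P_def \<phi>_def field_simps)
  also have "\<dots> \<le> M $ j * (1 + \<phi> x)" using M[of j] \<phi>_nonneg[OF x] by simp
  finally show ?thesis .
next
  case False
  define r where "r = inverse (\<phi> x)"
  have r: "0 < r" "r \<le> 1" using False by (auto simp: r_def inverse_le_1_iff)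
  have b0: "0 \<le> b $ k" for k using zero P_row[of 0] by (simp add: P_def)
  have "r *\<^sub>R x \<in> P"
    unfolding P_row
  proof
    fix k
    have "A $ k \<bullet> (r *\<^sub>R x) \<le> r * b $ k" using x r by (simp add: P_row mult_left_mono)
    also have "\<dots> \<le> 1 * b $ k" using r b0 by (intro mult_right_mono) auto
    finally show "A $ k \<bullet> (r *\<^sub>R x) \<le> b $ k" by simp
  qed
  moreover have "c \<bullet> (r *\<^sub>R x) \<le> \<mu>" using False mu by (simp add: r_def \<phi>_def field_simps)
  ultimately have "r * x $ j \<le> M $ j" using bound[of "r *\<^sub>R x" j] by (simp add: P_def)
  then have "x $ j \<le> M $ j * \<phi> x" using False by (simp add: r_def field_simps)
  also have "\<dots> \<le> M $ j * (1 + \<phi> x)" using M[of j] by simp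
  finally show ?thesis .
qed

text \<open>
  Averaging the coordinate bounds over all \<open>j\<close> bounds \<open>\<phi> x\<close> from below by a linear function, and
  the exponential of a linear function is a product.
\<close>

lemma exp_half_le_exp_decay:
  assumes x: "x \<in> P" shows "exp (- (\<phi> x / 2)) \<le> exp (1 / 2) * exp_decay q x"
proof -
  have "(\<Sum>j\<in>UNIV. x $ j / q $ j) \<le> (\<Sum>j\<in>(UNIV :: 'n set). (1 + \<phi> x) / (2 * real CARD('n)))"
  proof (rule sum_mono)
    fix j
    have "x $ j / M $ j \<le> 1 + \<phi> x" using coord_bound[OF x, of j] M[of j] by (simp add: field_simps)
    then have "(x $ j / M $ j) / (2 * real CARD('n)) \<le> (1 + \<phi> x) / (2 * real CARD('n))"
      by (rule divide_right_mono) simp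
    then show "x $ j / q $ j \<le> (1 + \<phi> x) / (2 * real CARD('n))"
      by (simp add: q_def ac_simps)
  qed
  also have "\<dots> = (1 + \<phi> x) / 2" by simp
  finally have "- (\<phi> x / 2) \<le> 1 / 2 + (\<Sum>j\<in>UNIV. - (x $ j) / q $ j)"
    by (simp add: sum_negf field_simps)
  then have "exp (- (\<phi> x / 2)) \<le> exp (1 / 2) * exp (\<Sum>j\<in>UNIV. - (x $ j) / q $ j)"
    by (simp flip: exp_add)
  also have "exp (\<Sum>j\<in>UNIV. - (x $ j) / q $ j) = exp_decay q x"
    using nonneg x by (simp add: exp_sum exp_decay_def P_def)
  finally show ?thesis .
qed

lemma q_pos: "0 < q $ j" using M[of j] by (simp add: q_def)

text \<open>
  Half of the decay of the density pays for integrability. The other half is available for the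
  growth of the integrand.
\<close>

lemma dominated:
  fixes g :: "real ^ 'n \<Rightarrow> real"
  assumes g [measurable]: "g \<in> borel_measurable borel"
    and C: "\<And>x. x \<in> P \<Longrightarrow> \<bar>g x\<bar> \<le> C * exp (\<phi> x / 2)"
  shows "integrable lborel (\<lambda>x. weight x * g x)"
    "(\<integral>x. weight x * g x \<partial>lborel) \<le> C * exp (1 / 2) * (\<Prod>j\<in>UNIV. q $ j)"
proof -
  have "0 \<le> C"
  proof -
    have "0 \<le> C * exp (\<phi> 0 / 2)" using C[of 0] zero by (auto simp: P_def)
    then show ?thesis by (simp add: zero_le_mult_iff)
  qed
  have le: "\<bar>weight x * g x\<bar> \<le> C * exp (1 / 2) * exp_decay q x" for x
  proof (cases "x \<in> P")
    case True
    then have "\<bar>weight x * g x\<bar> = exp (- \<phi> x) * \<bar>g x\<bar>" by (simp add: weight_def abs_mult)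
    also have "\<dots> \<le> exp (- \<phi> x) * (C * exp (\<phi> x / 2))" by (intro mult_left_mono C True) simp
    also have "\<dots> = C * exp (- (\<phi> x / 2))" by (simp flip: exp_add)
    also have "\<dots> \<le> C * (exp (1 / 2) * exp_decay q x)"
      using \<open>0 \<le> C\<close> by (intro mult_left_mono exp_half_le_exp_decay True)
    finally show ?thesis by simp
  qed (use \<open>0 \<le> C\<close> exp_decay_nonneg[of q x] in \<open>simp add: weight_def\<close>)
  have int: "integrable lborel (\<lambda>x. C * exp (1 / 2) * exp_decay q x)"
    by (intro integrable_mult_right exp_decay_integral q_pos)
  show "integrable lborel (\<lambda>x. weight x * g x)"
  proof (rule Bochner_Integration.integrable_bound[OF int])
    show "AE x in lborel. norm (weight x * g x) \<le> norm (C * exp (1 / 2) * exp_decay q x)"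
      using le by (intro AE_I2) (smt (verit) real_norm_def)
  qed measurable
  have "(\<integral>x. weight x * g x \<partial>lborel) \<le> (\<integral>x. C * exp (1 / 2) * exp_decay q x \<partial>lborel)"
  proof (rule integral_mono'[OF int])
    fix x
    show "weight x * g x \<le> C * exp (1 / 2) * exp_decay q x" using le[of x] by linarith
    show "0 \<le> C * exp (1 / 2) * exp_decay q x" using \<open>0 \<le> C\<close> by (simp add: exp_decay_nonneg)
  qed
  also have "\<dots> = C * exp (1 / 2) * (\<Prod>j\<in>UNIV. q $ j)"
    by (subst integral_mult_right_zero) (simp add: exp_decay_integral q_pos)
  finally show "(\<integral>x. weight x * g x \<partial>lborel) \<le> C * exp (1 / 2) * (\<Prod>j\<in>UNIV. q $ j)" .
qed

lemma one_plus_le: "0 \<le> u \<Longrightarrow> 1 + u \<le> 2 * exp (u / 2)" for u :: real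
  using exp_ge_add_one_self[of "u / 2"] by linarith

lemma weight_integrable: "integrable lborel weight" and total_mass_le: "total_mass \<le> exp (1 / 2) * (\<Prod>j\<in>UNIV. q $ j)"
  using dominated[of "\<lambda>_. 1" 1] \<phi>_nonneg by (auto simp: total_mass_def)

lemma coord_le_exp:
  assumes "x \<in> P" shows "\<bar>x $ j\<bar> \<le> (2 * M $ j) * exp (\<phi> x / 2)"
proof -
  have "\<bar>x $ j\<bar> \<le> M $ j * (1 + \<phi> x)" using coord_bound[OF assms] nonneg assms by (simp add: P_def)
  also have "\<dots> \<le> M $ j * (2 * exp (\<phi> x / 2))"
    using M[of j] by (intro mult_left_mono one_plus_le \<phi>_nonneg assms) auto
  finally show ?thesis by simp
qed

lemma coord_integrable: "integrable lborel (\<lambda>x. weight x * x $ j)"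
  and coord_integral_le: "(\<integral>x. weight x * x $ j \<partial>lborel) \<le> 2 * M $ j * exp (1 / 2) * (\<Prod>j\<in>UNIV. q $ j)"
  by (rule dominated[OF measurable_vec_nth]; rule coord_le_exp; assumption)+

definition box_volume where "box_volume = (\<Prod>j\<in>(UNIV :: 'n set). w $ j / 2)"

lemma box_volume_pos: "0 < box_volume" unfolding box_volume_def using w by (intro prod_pos) simp

text \<open>
  On the box the density is at least \<open>exp (- n)\<close>, as each of the \<open>n\<close> terms of \<open>\<langle>c, x\<rangle>\<close> is at most
  \<open>\<mu>\<close> there.
\<close>

lemma box_lower:
  fixes g :: "real ^ 'n \<Rightarrow> real"
  assumes int: "integrable lborel (\<lambda>x. weight x * g x)" and nn: "\<And>x. x \<in> P \<Longrightarrow> 0 \<le> g x" and "0 \<le> r"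
    and r: "\<And>x. (\<And>j. w $ j / 2 \<le> x $ j) \<Longrightarrow> r \<le> g x"
  shows "exp (- real CARD('n)) * r * box_volume \<le> (\<integral>x. weight x * g x \<partial>lborel)"
proof -
  let ?B = "cbox ((1/2) *\<^sub>R w) w"
  have B: "emeasure lborel ?B = ennreal box_volume"
  proof -
    have "emeasure lborel ?B = ennreal (\<Prod>b\<in>Basis. (w - (1/2) *\<^sub>R w) \<bullet> b)"
      by (rule emeasure_lborel_cbox) (use w in \<open>auto simp: Basis_vec_def inner_axis less_imp_le\<close>)
    also have "(\<Prod>b\<in>Basis. (w - (1/2) *\<^sub>R w) \<bullet> b) = box_volume"
      unfolding prod_Basis_vec box_volume_def by (intro prod.cong refl) (simp add: inner_axis)
    finally show ?thesis .
  qed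
  have "(\<integral>x. (exp (- real CARD('n)) * r) * indicator ?B x \<partial>lborel) \<le> (\<integral>x. weight x * g x \<partial>lborel)"
  proof (rule integral_mono'[OF int])
    fix x
    show "0 \<le> weight x * g x" using nn by (cases "x \<in> P") (auto simp: weight_def)
    show "(exp (- real CARD('n)) * r) * indicator ?B x \<le> weight x * g x"
    proof (cases "x \<in> ?B")
      case True
      then have x: "w $ j / 2 \<le> x $ j" "x $ j \<le> w $ j" for j by (auto simp: mem_box_cart)
      have "x \<in> P" unfolding P_def by (rule box) (use x in auto)
      have "c \<bullet> x \<le> (\<Sum>j\<in>(UNIV :: 'n set). \<mu>)"
        unfolding inner_vec_def inner_real_def
      proof (rule sum_mono)
        fix j
        have "c $ j * x $ j \<le> c $ j * w $ j" using x(2) c[of j] by (intro mult_left_mono) auto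
        then show "c $ j * x $ j \<le> \<mu>" using cw[of j] by linarith
      qed
      then have "\<phi> x \<le> real CARD('n)" using mu by (simp add: \<phi>_def field_simps)
      then have "exp (- real CARD('n)) * r \<le> exp (- \<phi> x) * g x"
        using r[of x] x(1) \<open>0 \<le> r\<close> by (intro mult_mono) auto
      then show ?thesis using True \<open>x \<in> P\<close> by (simp add: weight_def)
    qed (use \<open>0 \<le> weight x * g x\<close> in simp)
  qed
  also have "(\<integral>x. (exp (- real CARD('n)) * r) * indicator ?B x \<partial>lborel) = exp (- real CARD('n)) * r * box_volume"
    using box_volume_pos by (simp add: measure_def B)
  finally show ?thesis .
qed

lemma total_mass_ge: "exp (- real CARD('n)) * box_volume \<le> total_mass"
  using box_lower[of "\<lambda>_. 1" 1] weight_integrable by (simp add: total_mass_def)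

lemma total_mass_pos: "0 < total_mass" using total_mass_ge box_volume_pos by (smt (verit) exp_gt_zero mult_pos_pos)

lemma coord_integral_ge: "exp (- real CARD('n)) * (w $ j / 2) * box_volume \<le> (\<integral>x. weight x * x $ j \<partial>lborel)"
  by (rule box_lower[OF coord_integrable]) (use nonneg w in \<open>auto simp: P_def less_imp_le\<close>)
end

section \<open>The entropic central path as a mean\<close>

definition entropic_const :: "nat \<Rightarrow> real" where
  "entropic_const n = 2 * exp (1 / 2) * exp (real n) * (4 * real n) ^ n"

context tilted_polyhedron begin

lemma q_prod: "(\<Prod>j\<in>UNIV. q $ j) = (4 * real CARD('n)) ^ CARD('n) * (\<Prod>j\<in>UNIV. M $ j / w $ j) * box_volume"
proof -
  have "(\<Prod>j\<in>UNIV. q $ j) = (\<Prod>j\<in>UNIV. (4 * real CARD('n)) * (M $ j / w $ j) * (w $ j / 2))"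
    by (rule prod.cong) (use w in \<open>auto simp: q_def less_imp_neq[symmetric]\<close>)
  also have "\<dots> = (4 * real CARD('n)) ^ CARD('n) * (\<Prod>j\<in>UNIV. M $ j / w $ j) * box_volume"
    by (simp only: prod.distrib prod_constant box_volume_def power_mult_distrib)
  finally show ?thesis .
qed


lemma mean_upper: "mean $ j \<le> entropic_const CARD('n) * M $ j * (\<Prod>i\<in>UNIV. M $ i / w $ i)"
proof -
  have "mean $ j \<le> (2 * M $ j * exp (1 / 2) * (\<Prod>j\<in>UNIV. q $ j)) / (exp (- real CARD('n)) * box_volume)"
    unfolding mean_def vec_lambda_beta
    using coord_integral_le total_mass_ge box_volume_pos M[of j] q_pos
    by (intro frac_le mult_nonneg_nonneg prod_nonneg) (auto simp: less_imp_le)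
  also have "\<dots> = entropic_const CARD('n) * M $ j * (\<Prod>i\<in>UNIV. M $ i / w $ i)"
    unfolding q_prod entropic_const_def using box_volume_pos by (simp add: exp_minus field_simps)
  finally show ?thesis .
qed

lemma mean_lower: "w $ j / entropic_const CARD('n) * (\<Prod>i\<in>UNIV. w $ i / M $ i) \<le> mean $ j"
proof -
  have inv: "(\<Prod>i\<in>UNIV. w $ i / M $ i) * (\<Prod>i\<in>UNIV. M $ i / w $ i) = 1"
    unfolding prod.distrib[symmetric] using M w by (intro prod.neutral) (auto simp: less_imp_neq[symmetric])
  have "0 < (\<Prod>i\<in>UNIV. M $ i / w $ i)" using M w by (intro prod_pos) simp
  then have inv': "(\<Prod>i\<in>UNIV. w $ i / M $ i) = 1 / (\<Prod>i\<in>UNIV. M $ i / w $ i)"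
    unfolding eq_divide_eq using inv by auto
  have qp: "0 < (\<Prod>j\<in>UNIV. q $ j)" using q_pos by (intro prod_pos) simp
  have "w $ j / entropic_const CARD('n) * (\<Prod>i\<in>UNIV. w $ i / M $ i) = (exp (- real CARD('n)) * (w $ j / 2) * box_volume) / (exp (1 / 2) * (\<Prod>j\<in>UNIV. q $ j))"
    unfolding inv' q_prod entropic_const_def using box_volume_pos by (simp add: exp_minus field_simps)
  also have "\<dots> \<le> mean $ j"
    unfolding mean_def vec_lambda_beta
  proof (rule frac_le)
    have "0 \<le> exp (- real CARD('n)) * (w $ j / 2) * box_volume" using box_volume_pos w[of j] by simp
    then show "0 \<le> (\<integral>x. weight x * x $ j \<partial>lborel)" using coord_integral_ge[of j] by linarith
  qed (use coord_integral_ge[of j] total_mass_le total_mass_pos in auto)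
  finally show ?thesis .
qed

lemma affine_integral:
  "integrable lborel (\<lambda>x. weight x * (u \<bullet> x + k))"
  "(\<integral>x. weight x * (u \<bullet> x + k) \<partial>lborel) = total_mass * (u \<bullet> mean + k)"
proof -
  have eq: "weight x * (u \<bullet> x + k) = (\<Sum>j\<in>UNIV. u $ j * (weight x * x $ j)) + k * weight x" for x
    by (simp add: inner_vec_def sum_distrib_left algebra_simps)
  show "integrable lborel (\<lambda>x. weight x * (u \<bullet> x + k))"
    unfolding eq
    by (intro Bochner_Integration.integrable_add Bochner_Integration.integrable_sum integrable_mult_right coord_integrable weight_integrable)
  have "(\<integral>x. weight x * (u \<bullet> x + k) \<partial>lborel) = (\<Sum>j\<in>UNIV. u $ j * (\<integral>x. weight x * x $ j \<partial>lborel)) + k * total_mass"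
    unfolding eq total_mass_def
    by (subst Bochner_Integration.integral_add)
      (auto intro!: Bochner_Integration.integrable_sum integrable_mult_right coord_integrable weight_integrable
        simp: Bochner_Integration.integral_sum coord_integrable)
  also have "\<dots> = (\<Sum>j\<in>UNIV. u $ j * (total_mass * mean $ j)) + k * total_mass"
    using total_mass_pos by (simp add: mean_def)
  also have "\<dots> = total_mass * (u \<bullet> mean + k)"
    by (simp add: inner_vec_def sum_distrib_left algebra_simps)
  finally show "(\<integral>x. weight x * (u \<bullet> x + k) \<partial>lborel) = total_mass * (u \<bullet> mean + k)" .
qed

definition \<theta> where "\<theta> = (- 1 / \<mu>) *\<^sub>R c"

lemma weight_alt: "weight x = indicator P x * exp (\<theta> \<bullet> x)"
  by (simp add: weight_def \<phi>_def \<theta>_def)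

lemma log_partition_alt:
  "log_partition P (\<theta> + v) = ln_ennreal (\<integral>\<^sup>+x. ennreal (weight x * exp (v \<bullet> x)) \<partial>lborel)"
  unfolding log_partition_def
  by (intro arg_cong[where f = ln_ennreal] nn_integral_cong)
    (simp add: weight_alt inner_add_left exp_add indicator_def)

lemma log_partition_finite:
  assumes "integrable lborel (\<lambda>x. weight x * exp (v \<bullet> x))" "0 < (\<integral>x. weight x * exp (v \<bullet> x) \<partial>lborel)"
  shows "log_partition P (\<theta> + v) = ereal (ln (\<integral>x. weight x * exp (v \<bullet> x) \<partial>lborel))"
  unfolding log_partition_alt using assms
  by (subst nn_integral_eq_integral) (auto simp: weight_nonneg ln_ennreal_def)

lemma log_partition_\<theta>: "log_partition P \<theta> = ereal (ln total_mass)"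
  using log_partition_finite[of 0] weight_integrable total_mass_pos by (simp add: total_mass_def)

lemma ln_le_ln_ennreal: "0 < r \<Longrightarrow> ennreal r \<le> N \<Longrightarrow> ereal (ln r) \<le> ln_ennreal N"
  by (cases N) (auto simp: ln_ennreal_def ennreal_le_iff top_unique)

text \<open>
  Jensen's inequality for the exponential, from the tangent line bound \<open>1 + u \<le> exp u\<close> with
  \<open>u = \<langle>v, x - mean\<rangle>\<close>, which integrates to \<open>0\<close> against the density. The right-hand side may be
  infinite.
\<close>

lemma jensen: "ereal (v \<bullet> mean + ln total_mass) \<le> log_partition P (\<theta> + v)"
proof -
  define G where "G x = exp (v \<bullet> mean) * (weight x * (v \<bullet> x + (1 - v \<bullet> mean)))" for x
  have int: "integrable lborel G" unfolding G_def by (intro integrable_mult_right affine_integral)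
  have IG: "(\<integral>x. G x \<partial>lborel) = exp (v \<bullet> mean) * total_mass"
    unfolding G_def by (subst integral_mult_right_zero) (simp add: affine_integral)
  have le: "G x \<le> weight x * exp (v \<bullet> x)" for x
  proof -
    have "v \<bullet> x + (1 - v \<bullet> mean) \<le> exp (v \<bullet> x - v \<bullet> mean)"
      using exp_ge_add_one_self[of "v \<bullet> x - v \<bullet> mean"] by linarith
    then have "G x \<le> exp (v \<bullet> mean) * (weight x * exp (v \<bullet> x - v \<bullet> mean))"
      unfolding G_def by (intro mult_left_mono weight_nonneg) auto
    also have "\<dots> = weight x * exp (v \<bullet> x)" by (simp add: exp_diff)
    finally show ?thesis .
  qed
  have "ennreal (exp (v \<bullet> mean) * total_mass) \<le> ennreal (\<integral>x. max 0 (G x) \<partial>lborel)"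
    unfolding IG[symmetric] by (intro ennreal_leI integral_mono int Bochner_Integration.integrable_max) auto
  also have "\<dots> = (\<integral>\<^sup>+x. ennreal (max 0 (G x)) \<partial>lborel)"
    by (rule nn_integral_eq_integral[symmetric]) (auto intro: int)
  also have "\<dots> \<le> (\<integral>\<^sup>+x. ennreal (weight x * exp (v \<bullet> x)) \<partial>lborel)"
    by (intro nn_integral_mono ennreal_leI) (use le weight_nonneg in auto)
  finally have "ereal (ln (exp (v \<bullet> mean) * total_mass)) \<le> log_partition P (\<theta> + v)"
    unfolding log_partition_alt using total_mass_pos by (intro ln_le_ln_ennreal) auto
  then show ?thesis using total_mass_pos by (simp add: ln_mult)
qed

lemma exp_quadratic_bound: "exp v \<le> 1 + v + v\<^sup>2 * exp \<bar>v\<bar>" for v :: real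
  using Taylor_exp_field[of v 1] by (simp add: power2_eq_square mult.commute)

lemma linear_growth: "\<exists>\<kappa>>0. \<forall>x\<in>P. \<bar>u \<bullet> x + k\<bar> \<le> \<kappa> * (1 + \<phi> x)"
proof (intro exI conjI ballI)
  let ?\<kappa> = "(\<Sum>j\<in>UNIV. \<bar>u $ j\<bar> * M $ j) + \<bar>k\<bar> + 1"
  have s: "0 \<le> (\<Sum>j\<in>UNIV. \<bar>u $ j\<bar> * M $ j)" using M by (intro sum_nonneg) (simp add: less_imp_le)
  then show "0 < ?\<kappa>" by linarith
  fix x assume x: "x \<in> P"
  have "\<bar>u \<bullet> x\<bar> \<le> (\<Sum>j\<in>UNIV. \<bar>u $ j * x $ j\<bar>)" unfolding inner_vec_def inner_real_def by (rule sum_abs)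
  also have "\<dots> \<le> (\<Sum>j\<in>UNIV. (\<bar>u $ j\<bar> * M $ j) * (1 + \<phi> x))"
  proof (rule sum_mono)
    fix j
    have "\<bar>u $ j * x $ j\<bar> = \<bar>u $ j\<bar> * x $ j" using nonneg x by (simp add: abs_mult P_def)
    also have "\<dots> \<le> \<bar>u $ j\<bar> * (M $ j * (1 + \<phi> x))" by (intro mult_left_mono coord_bound x) simp
    finally show "\<bar>u $ j * x $ j\<bar> \<le> (\<bar>u $ j\<bar> * M $ j) * (1 + \<phi> x)" by simp
  qed
  also have "\<dots> = (\<Sum>j\<in>UNIV. \<bar>u $ j\<bar> * M $ j) * (1 + \<phi> x)" by (simp add: sum_distrib_right)
  finally have "\<bar>u \<bullet> x + k\<bar> \<le> (\<Sum>j\<in>UNIV. \<bar>u $ j\<bar> * M $ j) * (1 + \<phi> x) + \<bar>k\<bar> * 1" by linarith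
  also have "\<dots> \<le> (\<Sum>j\<in>UNIV. \<bar>u $ j\<bar> * M $ j) * (1 + \<phi> x) + (\<bar>k\<bar> + 1) * (1 + \<phi> x)"
    using \<phi>_nonneg[OF x] by (intro add_left_mono mult_mono) auto
  finally show "\<bar>u \<bullet> x + k\<bar> \<le> ?\<kappa> * (1 + \<phi> x)" by (simp add: algebra_simps)
qed

text \<open>
  The hypothesis says that the affine function of \<open>v\<close> with slope \<open>x'\<close> supports the log-partition
  function at \<open>\<theta>\<close>. Its slope in the direction \<open>u\<close> is at most the directional derivative, which is
  \<open>\<langle>u, mean\<rangle>\<close>: with \<open>Y = \<langle>u, x - x'\<rangle>\<close>, expanding \<open>exp (s Y)\<close> to first order for small \<open>s > 0\<close> leaves an
  error of order \<open>s\<^sup>2\<close> with an integrable coefficient. As \<open>u\<close> is arbitrary, equality follows.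
\<close>

lemma mean_unique:
  assumes x': "\<And>v. ereal (v \<bullet> x' + ln total_mass) \<le> log_partition P (\<theta> + v)"
  shows "x' = mean"
proof -
  have ineq: "0 \<le> u \<bullet> (mean - x')" for u
  proof -
    define Y where "Y x = u \<bullet> x + (- (u \<bullet> x'))" for x
    have [measurable]: "Y \<in> borel_measurable borel" unfolding Y_def[abs_def] by measurable
    obtain \<kappa> where \<kappa>: "0 < \<kappa>" "\<And>x. x \<in> P \<Longrightarrow> \<bar>Y x\<bar> \<le> \<kappa> * (1 + \<phi> x)"
      using linear_growth[of u "- (u \<bullet> x')"] unfolding Y_def by blast
    \<comment> \<open>Twice the exponent \<open>s0 * \<bar>Y x\<bar>\<close> is then at most \<open>(1 + \<phi> x) / 2\<close>, the growth that the density tolerates.\<close>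
    define s0 where "s0 = 1 / (4 * \<kappa>)"
    have s0: "0 < s0" using \<kappa>(1) by (simp add: s0_def)
    have Yb: "s0 * \<bar>Y x\<bar> \<le> 1 / 4 + \<phi> x / 4" if "x \<in> P" for x
    proof -
      have "s0 * \<bar>Y x\<bar> \<le> s0 * (\<kappa> * (1 + \<phi> x))" using \<kappa>(2)[OF that] s0 by (intro mult_left_mono) auto
      then show ?thesis using \<kappa>(1) by (simp add: s0_def field_simps)
    qed
    define R where "R x = (Y x)\<^sup>2 * exp (s0 * \<bar>Y x\<bar>)" for x
    have [measurable]: "R \<in> borel_measurable borel" unfolding R_def[abs_def] by measurable
    have "\<bar>R x\<bar> \<le> (2 / s0\<^sup>2 * exp (1 / 2)) * exp (\<phi> x / 2)" if x: "x \<in> P" for x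
    proof -
      define z where "z = s0 * \<bar>Y x\<bar>"
      have z: "0 \<le> z" "z \<le> 1 / 4 + \<phi> x / 4" using s0 Yb[OF x] by (auto simp: z_def)
      \<comment> \<open>The quadratic factor is traded for a second copy of the exponential.\<close>
      have "z\<^sup>2 \<le> 2 * exp z" using exp_lower_Taylor_quadratic[OF z(1)] z(1) by (simp add: field_simps)
      then have "z\<^sup>2 * exp z \<le> 2 * exp z * exp z" by (intro mult_right_mono) auto
      also have "\<dots> = 2 * exp (2 * z)" by (simp flip: exp_add)
      also have "\<dots> \<le> 2 * (exp (1 / 2) * exp (\<phi> x / 2))" using z(2) by (simp flip: exp_add)
      finally have "z\<^sup>2 * exp z / s0\<^sup>2 \<le> 2 * (exp (1 / 2) * exp (\<phi> x / 2)) / s0\<^sup>2"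
        by (intro divide_right_mono) auto
      moreover have "\<bar>R x\<bar> = z\<^sup>2 * exp z / s0\<^sup>2" using s0 by (simp add: R_def z_def power_mult_distrib abs_mult)
      ultimately show ?thesis by simp
    qed
    then have intR: "integrable lborel (\<lambda>x. weight x * R x)" by (rule dominated(1)[rotated]) measurable
    define K where "K = (\<integral>x. weight x * R x \<partial>lborel)"
    have step: "0 \<le> total_mass * (u \<bullet> (mean - x')) + s * K" if s: "0 < s" "s \<le> s0" for s
    proof -
      have "\<bar>exp ((s *\<^sub>R u) \<bullet> x)\<bar> \<le> exp (1 / 4 + s * (u \<bullet> x')) * exp (\<phi> x / 2)" if x: "x \<in> P" for x
      proof -
        have "s * Y x \<le> s * \<bar>Y x\<bar>" using s by (intro mult_left_mono) auto
        also have "\<dots> \<le> s0 * \<bar>Y x\<bar>" using s by (intro mult_right_mono) auto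
        also have "\<dots> \<le> 1 / 4 + \<phi> x / 2" using Yb[OF x] \<phi>_nonneg[OF x] by linarith
        finally have "s * (u \<bullet> x) \<le> (1 / 4 + s * (u \<bullet> x')) + \<phi> x / 2" by (simp add: Y_def algebra_simps)
        then show ?thesis by (simp flip: exp_add)
      qed
      then have int: "integrable lborel (\<lambda>x. weight x * exp ((s *\<^sub>R u) \<bullet> x))"
        by (rule dominated(1)[rotated]) measurable
      have pos: "0 < (\<integral>x. weight x * exp ((s *\<^sub>R u) \<bullet> x) \<partial>lborel)"
      proof -
        have "\<not> (AE x in lborel. weight x * exp ((s *\<^sub>R u) \<bullet> x) = 0)"
        proof
          assume "AE x in lborel. weight x * exp ((s *\<^sub>R u) \<bullet> x) = 0"
          then have "AE x in lborel. weight x = 0" by simp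
          then have "total_mass = 0" unfolding total_mass_def by (simp add: integral_eq_zero_AE)
          then show False using total_mass_pos by simp
        qed
        then have "(\<integral>x. weight x * exp ((s *\<^sub>R u) \<bullet> x) \<partial>lborel) \<noteq> 0"
          by (subst integral_nonneg_eq_0_iff_AE[OF int]) (auto simp: weight_nonneg)
        moreover have "0 \<le> (\<integral>x. weight x * exp ((s *\<^sub>R u) \<bullet> x) \<partial>lborel)"
          by (intro integral_nonneg_AE) (auto simp: weight_nonneg)
        ultimately show ?thesis by linarith
      qed
      have "ereal ((s *\<^sub>R u) \<bullet> x' + ln total_mass) \<le> ereal (ln (\<integral>x. weight x * exp ((s *\<^sub>R u) \<bullet> x) \<partial>lborel))"
        using x'[of "s *\<^sub>R u"] unfolding log_partition_finite[OF int pos] .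
      then have "exp ((s *\<^sub>R u) \<bullet> x' + ln total_mass) \<le> (\<integral>x. weight x * exp ((s *\<^sub>R u) \<bullet> x) \<partial>lborel)"
        using pos by (simp add: ln_ge_iff)
      then have "exp (s * (u \<bullet> x')) * total_mass \<le> (\<integral>x. weight x * exp ((s *\<^sub>R u) \<bullet> x) \<partial>lborel)"
        using total_mass_pos by (simp add: exp_add)
      then have "total_mass \<le> exp (- (s * (u \<bullet> x'))) * (\<integral>x. weight x * exp ((s *\<^sub>R u) \<bullet> x) \<partial>lborel)"
        by (simp add: exp_minus field_simps)
      also have "\<dots> = (\<integral>x. weight x * exp (s * Y x) \<partial>lborel)"
        unfolding integral_mult_right_zero[symmetric]
        by (intro Bochner_Integration.integral_cong refl) (simp add: Y_def algebra_simps exp_diff exp_minus field_simps)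
      also have "\<dots> \<le> (\<integral>x. weight x * ((s *\<^sub>R u) \<bullet> x + (1 - s * (u \<bullet> x'))) + s\<^sup>2 * (weight x * R x) \<partial>lborel)"
      proof (rule integral_mono_AE')
        show "integrable lborel (\<lambda>x. weight x * ((s *\<^sub>R u) \<bullet> x + (1 - s * (u \<bullet> x'))) + s\<^sup>2 * (weight x * R x))"
          by (intro Bochner_Integration.integrable_add affine_integral integrable_mult_right intR)
        have le: "weight x * exp (s * Y x) \<le> weight x * ((s *\<^sub>R u) \<bullet> x + (1 - s * (u \<bullet> x'))) + s\<^sup>2 * (weight x * R x)" for x
        proof -
          have "exp (s * Y x) \<le> 1 + s * Y x + (s * Y x)\<^sup>2 * exp \<bar>s * Y x\<bar>" by (rule exp_quadratic_bound)
          also have "\<dots> \<le> 1 + s * Y x + s\<^sup>2 * R x"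
            using s s0 by (auto simp: R_def power_mult_distrib abs_mult intro!: mult_left_mono mult_right_mono)
          finally have "weight x * exp (s * Y x) \<le> weight x * (1 + s * Y x + s\<^sup>2 * R x)"
            by (intro mult_left_mono weight_nonneg)
          then show ?thesis by (simp add: Y_def algebra_simps)
        qed
        then show "AE x in lborel. weight x * exp (s * Y x) \<le> weight x * ((s *\<^sub>R u) \<bullet> x + (1 - s * (u \<bullet> x'))) + s\<^sup>2 * (weight x * R x)"
          by simp
        show "AE x in lborel. 0 \<le> weight x * ((s *\<^sub>R u) \<bullet> x + (1 - s * (u \<bullet> x'))) + s\<^sup>2 * (weight x * R x)"
          by (intro AE_I2 order_trans[OF _ le]) (simp add: weight_nonneg)
      qed
      also have "\<dots> = total_mass * ((s *\<^sub>R u) \<bullet> mean + (1 - s * (u \<bullet> x'))) + s\<^sup>2 * K"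
        by (subst Bochner_Integration.integral_add)
          (auto simp: affine_integral intR K_def simp del: inner_scaleR_left)
      finally have "0 \<le> s * (total_mass * (u \<bullet> (mean - x')) + s * K)"
        by (simp add: inner_diff_right algebra_simps power2_eq_square)
      then show ?thesis using s(1) by (simp add: zero_le_mult_iff)
    qed
    have "0 \<le> total_mass * (u \<bullet> (mean - x'))"
    proof (rule tendsto_lowerbound[OF _ _ trivial_limit_at_right_real])
      have "((\<lambda>s. total_mass * (u \<bullet> (mean - x')) + s * K) \<longlongrightarrow> total_mass * (u \<bullet> (mean - x')) + 0 * K) (at_right 0)"
        by (intro tendsto_intros)
      then show "((\<lambda>s. total_mass * (u \<bullet> (mean - x')) + s * K) \<longlongrightarrow> total_mass * (u \<bullet> (mean - x'))) (at_right 0)" by simp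
      show "\<forall>\<^sub>F s in at_right 0. 0 \<le> total_mass * (u \<bullet> (mean - x')) + s * K"
        using eventually_at_right_less[of 0] eventually_at_right_real[OF s0]
        by eventually_elim (use step in auto)
    qed
    then show ?thesis using total_mass_pos by (simp add: zero_le_mult_iff)
  qed
  have "0 \<le> (x' - mean) \<bullet> (mean - x')" by (rule ineq)
  then have "(x' - mean) \<bullet> (x' - mean) \<le> 0" by (simp add: inner_diff_right inner_diff_left)
  then have "(x' - mean) \<bullet> (x' - mean) = 0" using inner_ge_zero[of "x' - mean"] by linarith
  then show ?thesis by simp
qed

text \<open>
  Every nontrivial row is strict almost everywhere because hyperplanes are null sets, and therefore
  strict at the mean.
\<close>

lemma mean_mem_interior: "mean \<in> interior P"
proof (rule interiorI)
  let ?U = "\<Inter>k\<in>{k. A $ k \<noteq> 0}. {x. A $ k \<bullet> x < b $ k}"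
  show "open ?U" by (intro open_INT ballI open_Collect_less continuous_intros) simp
  have b0: "0 \<le> b $ k" for k using zero P_row[of 0] by (simp add: P_def)
  show "?U \<subseteq> P"
  proof
    fix x assume x: "x \<in> ?U"
    have "A $ k \<bullet> x \<le> b $ k" for k
    proof (cases "A $ k = 0")
      case True
      then show ?thesis using b0 by simp
    next
      case False
      then have "A $ k \<bullet> x < b $ k" using x by blast
      then show ?thesis by simp
    qed
    then show "x \<in> P" by (simp add: P_row)
  qed
  show "mean \<in> ?U"
  proof (intro INT_I CollectI)
    fix k assume "k \<in> {k. A $ k \<noteq> 0}"
    then have k: "A $ k \<noteq> 0" by simp
    define s where "s x = weight x * ((- A $ k) \<bullet> x + b $ k)" for x
    have int: "integrable lborel s" unfolding s_def by (rule affine_integral)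
    have nn: "AE x in lborel. 0 \<le> s x" by (auto simp: s_def weight_def indicator_def P_row)
    have "integral\<^sup>L lborel s \<noteq> 0"
    proof
      assume "integral\<^sup>L lborel s = 0"
      then have "AE x in lborel. s x = 0" by (subst (asm) integral_nonneg_eq_0_iff_AE[OF int nn])
      moreover have "AE x in lborel. x \<notin> {x. A $ k \<bullet> x = b $ k}"
      proof (rule AE_not_in)
        have "negligible {x. A $ k \<bullet> x = b $ k}" using k by (intro negligible_hyperplane) simp
        moreover have "{x. A $ k \<bullet> x = b $ k} \<in> sets borel"
          by (intro borel_closed closed_Collect_eq continuous_intros)
        ultimately show "{x. A $ k \<bullet> x = b $ k} \<in> null_sets lborel"
          by (simp add: negligible_iff_null_sets null_sets_completion_iff)
      qed
      ultimately have "AE x in lborel. weight x = 0" by eventually_elim (auto simp: s_def)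
      then have "total_mass = 0" unfolding total_mass_def by (simp add: integral_eq_zero_AE)
      then show False using total_mass_pos by simp
    qed
    moreover have "0 \<le> integral\<^sup>L lborel s" by (rule integral_nonneg_AE[OF nn])
    moreover have "integral\<^sup>L lborel s = total_mass * ((- A $ k) \<bullet> mean + b $ k)"
      unfolding s_def by (rule affine_integral)
    ultimately have "0 < total_mass * ((- A $ k) \<bullet> mean + b $ k)" by linarith
    then show "A $ k \<bullet> mean < b $ k" using total_mass_pos by (simp add: zero_less_mult_iff)
  qed
qed

lemma barrier_ge: "ereal (\<theta> \<bullet> x - ln total_mass) \<le> entropic_barrier P x"
  unfolding entropic_barrier_def fenchel_conjugate_def
  by (rule SUP_upper2[of \<theta>]) (simp_all add: log_partition_\<theta>)

text \<open>
  The value \<open>\<langle>\<theta>, x\<rangle> - ln total_mass\<close> is the term for \<open>\<theta>\<close> in the supremum that defines the conjugate. It is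
  the maximum exactly if \<open>x\<close> is a subgradient of the log-partition function at \<open>\<theta>\<close>.
\<close>

lemma barrier_le_iff:
  "entropic_barrier P x \<le> ereal (\<theta> \<bullet> x - ln total_mass) \<longleftrightarrow> (\<forall>v. ereal (v \<bullet> x + ln total_mass) \<le> log_partition P (\<theta> + v))"
proof -
  have "(ereal (\<eta> \<bullet> x) - f \<le> ereal (\<theta> \<bullet> x - ln total_mass)) \<longleftrightarrow> ereal ((\<eta> - \<theta>) \<bullet> x + ln total_mass) \<le> f" for \<eta> f
    by (cases f) (auto simp: inner_diff_left algebra_simps)
  then have "entropic_barrier P x \<le> ereal (\<theta> \<bullet> x - ln total_mass) \<longleftrightarrow>
      (\<forall>\<eta>. ereal ((\<eta> - \<theta>) \<bullet> x + ln total_mass) \<le> log_partition P \<eta>)"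
    unfolding entropic_barrier_def fenchel_conjugate_def SUP_le_iff by simp
  also have "\<dots> \<longleftrightarrow> (\<forall>v. ereal (v \<bullet> x + ln total_mass) \<le> log_partition P (\<theta> + v))"
  proof (intro iffI allI)
    fix v assume "\<forall>\<eta>. ereal ((\<eta> - \<theta>) \<bullet> x + ln total_mass) \<le> log_partition P \<eta>"
    from this[rule_format, of "\<theta> + v"] show "ereal (v \<bullet> x + ln total_mass) \<le> log_partition P (\<theta> + v)" by simp
  next
    fix \<eta> assume "\<forall>v. ereal (v \<bullet> x + ln total_mass) \<le> log_partition P (\<theta> + v)"
    from this[rule_format, of "\<eta> - \<theta>"] show "ereal ((\<eta> - \<theta>) \<bullet> x + ln total_mass) \<le> log_partition P \<eta>" by simp
  qed
  finally show ?thesis .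
qed

lemma objective_ge: "ereal (- \<mu> * ln total_mass) \<le> entropic_objective P c \<mu> x"
  and objective_le_iff: "entropic_objective P c \<mu> x \<le> ereal (- \<mu> * ln total_mass) \<longleftrightarrow>
    entropic_barrier P x \<le> ereal (\<theta> \<bullet> x - ln total_mass)"
proof -
  have cx: "c \<bullet> x = - \<mu> * (\<theta> \<bullet> x)" using mu by (simp add: \<theta>_def)
  show "ereal (- \<mu> * ln total_mass) \<le> entropic_objective P c \<mu> x"
    unfolding entropic_objective_def cx
  proof (cases "entropic_barrier P x")
    case (real r)
    have "\<mu> * (\<theta> \<bullet> x - ln total_mass) \<le> \<mu> * r"
      using barrier_ge[of x] mu by (intro mult_left_mono) (auto simp: real)
    then have "- \<mu> * ln total_mass \<le> - \<mu> * (\<theta> \<bullet> x) + \<mu> * r" by (simp add: right_diff_distrib)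
    then show "ereal (- \<mu> * ln total_mass) \<le> ereal (- \<mu> * (\<theta> \<bullet> x)) + ereal \<mu> * entropic_barrier P x"
      unfolding real by simp
  qed (use barrier_ge[of x] mu in auto)
  show "entropic_objective P c \<mu> x \<le> ereal (- \<mu> * ln total_mass) \<longleftrightarrow>
    entropic_barrier P x \<le> ereal (\<theta> \<bullet> x - ln total_mass)"
    unfolding entropic_objective_def cx
  proof (cases "entropic_barrier P x")
    case (real r)
    have "- \<mu> * (\<theta> \<bullet> x) + \<mu> * r \<le> - \<mu> * ln total_mass \<longleftrightarrow> \<mu> * r \<le> \<mu> * (\<theta> \<bullet> x - ln total_mass)"
      by (simp add: algebra_simps)
    also have "\<dots> \<longleftrightarrow> r \<le> \<theta> \<bullet> x - ln total_mass" using mu by simp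
    finally show "ereal (- \<mu> * (\<theta> \<bullet> x)) + ereal \<mu> * entropic_barrier P x \<le> ereal (- \<mu> * ln total_mass) \<longleftrightarrow>
        entropic_barrier P x \<le> ereal (\<theta> \<bullet> x - ln total_mass)"
      unfolding real by simp
  qed (use barrier_ge[of x] mu in auto)
qed

text \<open>
  The least value of the objective is \<open>- \<mu> * ln total_mass\<close>, and it is attained exactly at the subgradients
  of the log-partition function at \<open>\<theta> = - c / \<mu>\<close>. The mean is one by \<open>jensen\<close>, and it is the only
  one by \<open>mean_unique\<close>.
\<close>

theorem entropic_central_path_eq_mean: "entropic_central_path (polyhedron_of A b) c \<mu> = mean"
  unfolding P_def[symmetric] entropic_central_path_def
proof (rule the_equality)
  have le: "entropic_objective P c \<mu> mean \<le> ereal (- \<mu> * ln total_mass)"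
    unfolding objective_le_iff barrier_le_iff using jensen by blast
  show "mean \<in> interior P \<and> (\<forall>y\<in>interior P. entropic_objective P c \<mu> mean \<le> entropic_objective P c \<mu> y)"
    using mean_mem_interior le objective_ge order_trans by blast
  fix x assume "x \<in> interior P \<and> (\<forall>y\<in>interior P. entropic_objective P c \<mu> x \<le> entropic_objective P c \<mu> y)"
  then have "entropic_objective P c \<mu> x \<le> ereal (- \<mu> * ln total_mass)"
    using mean_mem_interior le order_trans by blast
  then show "x = mean" unfolding objective_le_iff barrier_le_iff by (intro mean_unique) blast
qed
end

section \<open>The limit of the central path\<close>

lemma ev_tilted_polyhedron:
  fixes A :: "puiseux ^ 'n ^ 'm" and \<zeta> :: "real ^ 'n"
  assumes nn: "polyhedron_of A b \<subseteq> {x. \<forall>i. 0 \<le> x $ i}" and z: "0 \<in> polyhedron_of A b"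
    and c: "\<forall>i. 0 < c $ i" and \<mu>: "0 < \<mu>" and M: "\<And>j. 0 < M $ j"
    and bnd: "\<forall>\<^sub>F t in at_top. \<forall>x\<in>truncation (peval_mat A t) (peval_vec b t) (peval_vec c t) (peval \<mu> t).
       \<forall>j. 0 \<le> x $ j \<and> x $ j \<le> peval (M $ j) t"
    and c\<zeta>: "\<And>j. c $ j * psingle (\<zeta> $ j) 1 \<le> \<mu>"
    and \<delta>: "0 < \<delta>"
    and box: "\<forall>w :: real ^ 'n. (\<forall>j. \<bar>w $ j - \<zeta> $ j\<bar> \<le> \<delta>) \<longrightarrow> (\<chi> j. ereal (w $ j)) \<in> val_vec ` polyhedron_of A b"
  shows "\<forall>\<^sub>F t in at_top. tilted_polyhedron (peval_mat A t) (peval_vec b t) (peval_vec c t) (peval \<mu> t)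
    (peval_vec M t) (\<chi> j. t powr \<zeta> $ j)"
proof -
  have b0: "0 \<le> b $ k" for k using z by (simp add: polyhedron_of_def less_eq_vec_def)
  have "\<forall>\<^sub>F t in at_top. \<forall>k. 0 \<le> peval (b $ k) t"
    using b0 by (intro eventually_all_finite) (simp add: puiseux_le_iff)
  moreover have "\<forall>\<^sub>F t in at_top. \<forall>j. 0 < peval (c $ j) t"
    using c by (intro eventually_all_finite) (simp add: puiseux_less_iff)
  moreover have "\<forall>\<^sub>F t in at_top. \<forall>j. 0 < peval (M $ j) t"
    using M by (intro eventually_all_finite) (simp add: puiseux_less_iff)
  moreover have "\<forall>\<^sub>F t in at_top. 0 < peval \<mu> t" using \<mu> by (simp add: puiseux_less_iff)
  moreover have "\<forall>\<^sub>F t in at_top. \<forall>j. peval (c $ j) t * t powr \<zeta> $ j \<le> peval \<mu> t"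
  proof (rule eventually_all_finite)
    fix j
    show "\<forall>\<^sub>F t in at_top. peval (c $ j) t * t powr \<zeta> $ j \<le> peval \<mu> t"
      using c\<zeta>[of j, unfolded puiseux_le_iff] ev_eval_mult[of "c $ j" "psingle (\<zeta> $ j) 1"]
      by eventually_elim (simp add: eval_psingle)
  qed
  moreover have "\<forall>\<^sub>F t in at_top. \<forall>x :: real ^ 'n. (\<forall>j. t powr \<zeta> $ j / 2 \<le> x $ j \<and> x $ j \<le> t powr \<zeta> $ j) \<longrightarrow>
    x \<in> polyhedron_of (peval_mat A t) (peval_vec b t)"
    by (rule ev_box_in_polyhedron[OF nn z \<delta> box])
  ultimately show ?thesis
    using bnd eventually_gt_at_top[of 0]
  proof eventually_elim
    case (elim t)
    let ?P = "polyhedron_of (peval_mat A t) (peval_vec b t)"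
    have z': "0 \<in> ?P" using elim(1) by (simp add: polyhedron_of_def less_eq_vec_def peval_vec_def)
    have inner: "peval_vec c t \<bullet> x = (\<Sum>j\<in>UNIV. peval_vec c t $ j * x $ j)" for x
      by (simp add: inner_vec_def)
    show ?case
    proof
      fix x j assume x: "x \<in> ?P"
      define d where "d = \<bar>\<Sum>j\<in>UNIV. peval_vec c t $ j * x $ j\<bar>"
      \<comment> \<open>The bounds are known on the truncation only; a small positive multiple of \<open>x\<close> lies in it.\<close>
      define r where "r = peval \<mu> t / (peval \<mu> t + d)"
      have r: "0 < r" "r \<le> 1" "r * d \<le> peval \<mu> t"
        using elim(4) by (auto simp: r_def d_def field_simps)
      have "(\<chi> j. r * x $ j) \<in> ?P" using r by (intro polyhedron_scale[OF z' x]) auto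
      moreover have "(\<Sum>j\<in>UNIV. peval_vec c t $ j * (r * x $ j)) \<le> peval \<mu> t"
      proof -
        have "(\<Sum>j\<in>UNIV. peval_vec c t $ j * (r * x $ j)) = r * (\<Sum>j\<in>UNIV. peval_vec c t $ j * x $ j)"
          by (simp add: sum_distrib_left ac_simps)
        also have "\<dots> \<le> r * d" using r by (intro mult_left_mono) (auto simp: d_def)
        finally show ?thesis using r(3) by linarith
      qed
      ultimately have "(\<chi> j. r * x $ j) \<in> truncation (peval_mat A t) (peval_vec b t) (peval_vec c t) (peval \<mu> t)"
        by (simp add: truncation_def)
      then have "0 \<le> (\<chi> j. r * x $ j) $ j" using elim(7) by blast
      then show "0 \<le> x $ j" using r(1) by (simp add: zero_le_mult_iff)
    next
      fix x j assume "x \<in> ?P" "peval_vec c t \<bullet> x \<le> peval \<mu> t"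
      then have "x \<in> truncation (peval_mat A t) (peval_vec b t) (peval_vec c t) (peval \<mu> t)"
        by (simp add: truncation_def inner)
      then have "x $ j \<le> peval (M $ j) t" using elim(7) by blast
      then show "x $ j \<le> peval_vec M t $ j" by (simp add: peval_vec_def)
    next
      fix x :: "real ^ 'n"
      assume "\<And>j. (\<chi> j. t powr \<zeta> $ j) $ j / 2 \<le> x $ j \<and> x $ j \<le> (\<chi> j. t powr \<zeta> $ j) $ j"
      then show "x \<in> ?P" using elim(6) by simp
    qed (use elim z' in \<open>simp_all add: peval_vec_def\<close>)
  qed
qed

lemma prod_le_powr:
  fixes f :: "'n::finite \<Rightarrow> real"
  assumes "\<And>i. 0 \<le> f i" "\<And>i. f i \<le> t powr e" "0 < t"
  shows "(\<Prod>i\<in>UNIV. f i) \<le> t powr (e * real CARD('n))"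
proof -
  have "(\<Prod>i\<in>UNIV. f i) \<le> (\<Prod>i\<in>(UNIV :: 'n set). t powr e)" by (intro prod_mono) (use assms in auto)
  also have "\<dots> = t powr (e * real CARD('n))" using assms(3) by (simp add: powr_powr flip: powr_realpow)
  finally show ?thesis .
qed

text \<open>
  With \<open>M\<close> and \<open>w\<close> within \<open>t powr e\<close> of \<open>t powr a\<close>, each of the \<open>n\<close> ratios \<open>M / w\<close> contributes
  at most \<open>2 * e\<close> to the exponent; the coordinate itself and the constant contribute \<open>e\<close> each.
\<close>

lemma tilted_polyhedron_mean_bounds:
  fixes M w a :: "real ^ 'n"
  assumes tp: "tilted_polyhedron A b c \<mu> M w" and t: "1 < t" and C: "entropic_const CARD('n) \<le> t powr e"
    and Mt: "\<And>j. M $ j \<le> t powr (a $ j + e)" and wt: "\<And>j. t powr (a $ j - e) \<le> w $ j"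
  defines "y \<equiv> entropic_central_path (polyhedron_of A b) c \<mu>"
  shows "t powr (a $ j - (2 * real CARD('n) + 2) * e) \<le> y $ j"
    "y $ j \<le> t powr (a $ j + (2 * real CARD('n) + 2) * e)"
proof -
  interpret tilted_polyhedron A b c \<mu> M w by (rule tp)
  let ?n = "real CARD('n)" and ?C = "entropic_const CARD('n)"
  have y: "y = mean" unfolding y_def by (rule entropic_central_path_eq_mean)
  have Cpos: "0 < ?C" by (simp add: entropic_const_def)
  have ratio: "M $ i / w $ i \<le> t powr (2 * e)" for i
  proof -
    have "M $ i / w $ i \<le> t powr (a $ i + e) / t powr (a $ i - e)"
      using Mt[of i] wt[of i] t by (intro frac_le) auto
    also have "\<dots> = t powr (2 * e)" using t by (simp flip: powr_diff)
    finally show ?thesis .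
  qed
  have Mpos: "0 < M $ i" and wpos: "0 < w $ i" for i
    using tp by (auto simp: tilted_polyhedron_def)
  have R: "(\<Prod>i\<in>UNIV. M $ i / w $ i) \<le> t powr (2 * e * ?n)"
    by (rule prod_le_powr) (use ratio Mpos wpos t in \<open>auto simp: less_imp_le\<close>)
  have Rpos: "0 < (\<Prod>i\<in>UNIV. M $ i / w $ i)" using Mpos wpos by (intro prod_pos) simp
  have inv: "(\<Prod>i\<in>UNIV. w $ i / M $ i) = 1 / (\<Prod>i\<in>UNIV. M $ i / w $ i)"
    by (simp add: prod_dividef)
  have "y $ j \<le> ?C * M $ j * (\<Prod>i\<in>UNIV. M $ i / w $ i)" unfolding y by (rule mean_upper)
  also have "\<dots> \<le> t powr e * t powr (a $ j + e) * t powr (2 * e * ?n)"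
    using C Mt R Cpos Mpos Rpos by (intro mult_mono) (auto simp: less_imp_le)
  also have "\<dots> = t powr (a $ j + (2 * ?n + 2) * e)" by (simp add: algebra_simps flip: powr_add)
  finally show "y $ j \<le> t powr (a $ j + (2 * ?n + 2) * e)" .
  have split_powr: "t powr (u - e - k) = t powr u / t powr e * (1 / t powr k)" for u k
    by (simp add: powr_diff)
  have "a $ j - (2 * ?n + 2) * e = (a $ j - e) - e - 2 * e * ?n" by (simp add: algebra_simps)
  then have "t powr (a $ j - (2 * ?n + 2) * e) = t powr (a $ j - e) / t powr e * (1 / t powr (2 * e * ?n))"
    by (simp only: split_powr)
  also have "\<dots> \<le> w $ j / ?C * (\<Prod>i\<in>UNIV. w $ i / M $ i)"
    unfolding inv
    by (intro mult_mono frac_le divide_nonneg_pos) (use C wt[of j] R Cpos wpos[of j] Rpos t in \<open>auto simp: less_imp_le\<close>)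
  also have "\<dots> \<le> y $ j" unfolding y by (rule mean_lower)
  finally show "t powr (a $ j - (2 * ?n + 2) * e) \<le> y $ j" .
qed

theorem theorem1:
  fixes A :: "puiseux ^ 'n ^ 'm" and b :: "puiseux ^ 'm" and c :: "puiseux ^ 'n"
  assumes "polyhedron_of A b \<subseteq> {x. \<forall>i. 0 \<le> x $ i}" and "0 \<in> polyhedron_of A b"
    and "trop_regular (val_vec ` polyhedron_of A b)"
    and "\<forall>i. 0 < c $ i"
  shows "\<forall>\<mu>>0.
    tropical_polytope {x \<in> val_vec ` polyhedron_of A b. trop_inner (val_vec c) x \<le> val \<mu>} \<and>
    (\<exists>x. is_tropical_barycenter
           {x \<in> val_vec ` polyhedron_of A b. trop_inner (val_vec c) x \<le> val \<mu>} x \<and>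
         ((\<lambda>t. trop_log_vec t
              (entropic_central_path (polyhedron_of (peval_mat A t) (peval_vec b t))
                (peval_vec c t) (peval \<mu> t))) \<longlongrightarrow> x) at_top)"
proof (intro allI impI)
  fix \<mu> :: puiseux assume \<mu>: "0 < \<mu>"
  note nn = assms(1) and z = assms(2) and reg = assms(3) and c = assms(4)
  let ?V = "val_vec ` polyhedron_of A b"
  let ?S = "{x \<in> ?V. trop_inner (val_vec c) x \<le> val \<mu>}"
  have S: "?S = val_vec ` truncation A b c \<mu>" by (rule val_truncation[OF nn z c \<mu>])
  obtain M :: "puiseux ^ 'n" where M0: "\<forall>j. 0 \<le> M $ j" and poly: "tropical_polytope ?S"
    and bary: "is_tropical_barycenter ?S (val_vec M)"
    and bnd: "\<forall>\<^sub>F t in at_top. \<forall>x\<in>truncation (peval_mat A t) (peval_vec b t) (peval_vec c t) (peval \<mu> t).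
       \<forall>j. 0 \<le> x $ j \<and> x $ j \<le> peval (M $ j) t"
    unfolding S by (rule truncation_tropical[OF nn z c \<mu>])
  have Mpos: "0 < M $ j" for j
    using barycenter_pos[OF nn z reg c \<mu> bary[unfolded S], of j] M0 by (simp add: less_le)
  define a :: "real ^ 'n" where "a = (\<chi> j. lead_exp (M $ j))"
  have va: "val (M $ j) = ereal (a $ j)" for j using Mpos[of j] by (simp add: a_def val_nonzero)
  have Ma: "val_vec M = (\<chi> j. ereal (a $ j))" by (simp add: val_vec_def va)
  have aV: "(\<chi> j. ereal (a $ j)) \<in> ?V" and ca: "trop_inner (val_vec c) (\<chi> j. ereal (a $ j)) \<le> val \<mu>"
    using bary unfolding is_tropical_barycenter_def Ma by auto
  define y where "y t = entropic_central_path (polyhedron_of (peval_mat A t) (peval_vec b t))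
                (peval_vec c t) (peval \<mu> t)" for t
  have bounds: "\<forall>\<^sub>F t in at_top. \<forall>j. t powr (a $ j - (2 * real CARD('n) + 2) * e) \<le> y t $ j \<and>
      y t $ j \<le> t powr (a $ j + (2 * real CARD('n) + 2) * e)" if e: "0 < e" for e
  proof -
    obtain \<zeta> :: "real ^ 'n" and \<delta> where \<delta>: "0 < \<delta>" and \<zeta>: "\<forall>j. a $ j - e \<le> \<zeta> $ j" "\<forall>j. \<zeta> $ j < a $ j"
      and box: "\<forall>w :: real ^ 'n. (\<forall>j. \<bar>w $ j - \<zeta> $ j\<bar> \<le> \<delta>) \<longrightarrow> (\<chi> j. ereal (w $ j)) \<in> ?V"
      by (rule box_near_barycenter[OF z reg aV e])
    have c\<zeta>: "c $ j * psingle (\<zeta> $ j) 1 \<le> \<mu>" for j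
    proof (rule less_imp_le, rule less_of_val_less)
      have cj: "c $ j \<noteq> 0" using c by (metis less_irrefl)
      have "val (c $ j * psingle (\<zeta> $ j) 1) < val (c $ j) + ereal (a $ j)"
        using \<zeta>(2) cj by (simp add: val_mult val_psingle val_nonzero)
      also have "\<dots> \<le> trop_inner (val_vec c) (\<chi> j. ereal (a $ j))"
        unfolding trop_inner_SUP by (rule SUP_upper2[of j]) (simp_all add: val_vec_def)
      also have "\<dots> \<le> val \<mu>" by (rule ca)
      finally show "val (c $ j * psingle (\<zeta> $ j) 1) < val \<mu>" .
    qed (use \<mu> in simp)
    have tp: "\<forall>\<^sub>F t in at_top. tilted_polyhedron (peval_mat A t) (peval_vec b t) (peval_vec c t) (peval \<mu> t)
      (peval_vec M t) (\<chi> j. t powr \<zeta> $ j)"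
      by (rule ev_tilted_polyhedron[OF nn z c \<mu> Mpos bnd c\<zeta> \<delta> box])
    have Mt: "\<forall>\<^sub>F t in at_top. \<forall>j. peval (M $ j) t < t powr (a $ j + e)"
      using M0 e va by (intro eventually_all_finite ev_peval_less_powr) auto
    have Cpos: "0 < entropic_const CARD('n)" by (simp add: entropic_const_def)
    have "\<forall>\<^sub>F t in at_top. peval (psingle 0 (entropic_const CARD('n))) t < t powr e"
      by (rule ev_peval_less_powr) (use Cpos e in \<open>simp_all add: psingle_pos val_psingle less_imp_le\<close>)
    then have "\<forall>\<^sub>F t in at_top. entropic_const CARD('n) < t powr e"
      using eventually_gt_at_top[of 0] by eventually_elim (simp add: eval_psingle)
    then show ?thesis
      using tp Mt eventually_gt_at_top[of 1]
    proof eventually_elim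
      case (elim t)
      have M: "peval_vec M t $ j \<le> t powr (a $ j + e)" for j using elim(3) by (simp add: peval_vec_def less_imp_le)
      have w: "t powr (a $ j - e) \<le> (\<chi> j. t powr \<zeta> $ j) $ j" for j
        using \<zeta>(1) elim(4) by simp
      show ?case
        unfolding y_def
        using tilted_polyhedron_mean_bounds[OF elim(2,4) less_imp_le[OF elim(1)] M w] by blast
    qed
  qed
  have "((\<lambda>t. trop_log_vec t (y t)) \<longlongrightarrow> val_vec M) at_top"
  proof (rule vec_tendstoI)
    fix j
    have "((\<lambda>t. log t (y t $ j)) \<longlongrightarrow> a $ j) at_top"
    proof (rule tendstoI)
      fix \<epsilon> :: real assume \<epsilon>: "0 < \<epsilon>"
      \<comment> \<open>Any \<open>e\<close> with \<open>(2 * n + 2) * e < \<epsilon>\<close> would do.\<close>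
      define e where "e = \<epsilon> / (2 * real CARD('n) + 3)"
      have e: "0 < e" "(2 * real CARD('n) + 2) * e < \<epsilon>" using \<epsilon> by (auto simp: e_def field_simps)
      show "\<forall>\<^sub>F t in at_top. dist (log t (y t $ j)) (a $ j) < \<epsilon>"
        using bounds[OF e(1)] eventually_gt_at_top[of 1]
      proof eventually_elim
        case (elim t)
        let ?k = "(2 * real CARD('n) + 2) * e"
        have b: "t powr (a $ j - ?k) \<le> y t $ j" "y t $ j \<le> t powr (a $ j + ?k)" using elim(1) by auto
        have "0 < t powr (a $ j - ?k)" using elim(2) by simp
        then have "0 < y t $ j" using b(1) by linarith
        then have "a $ j - ?k \<le> log t (y t $ j)" "log t (y t $ j) \<le> a $ j + ?k"
          using b elim(2) by (simp_all add: le_log_iff log_le_iff)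
        then show ?case using e(2) by (simp add: dist_real_def abs_less_iff)
      qed
    qed
    then have "((\<lambda>t. ereal (log t (y t $ j))) \<longlongrightarrow> val_vec M $ j) at_top"
      by (simp add: val_vec_def va)
    moreover have "\<forall>\<^sub>F t in at_top. trop_log_vec t (y t) $ j = ereal (log t (y t $ j))"
      using bounds[OF zero_less_one] eventually_gt_at_top[of 1]
    proof eventually_elim
      case (elim t)
      have "0 < t powr (a $ j - (2 * real CARD('n) + 2) * 1)" using elim(2) by simp
      then have "y t $ j \<noteq> 0" using elim(1)[rule_format, of j] by linarith
      then show ?case by (simp add: trop_log_vec_def trop_log_def)
    qed
    ultimately show "((\<lambda>t. trop_log_vec t (y t) $ j) \<longlongrightarrow> val_vec M $ j) at_top"
      by (simp add: tendsto_cong)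
  qed
  then show "tropical_polytope ?S \<and> (\<exists>x. is_tropical_barycenter ?S x \<and>
         ((\<lambda>t. trop_log_vec t
              (entropic_central_path (polyhedron_of (peval_mat A t) (peval_vec b t))
                (peval_vec c t) (peval \<mu> t))) \<longlongrightarrow> x) at_top)"
    using poly bary unfolding y_def by blast
qed

end
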